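(* If $(K,v)$ is henselian, then $\deg f=\deg_Qf\cdot\deg Q$ for every $f\in\mathrm{KP}_\infty(\mathcal Q)$ and every $Q\in\mathcal Q$.
   Context: Let $(K,v)$ be a valued field, $\Gamma$ the divisible hull of $vK$, embedded in a divisible ordered abelian group $\Lambda$. Let $\nu\colon K[x]\to\Lambda\cup\{\infty\}$ be a valuation extending $v$ which is well-specified, i.e. it is not the case that simultaneously $\nu^{-1}(\infty)=0$, the value group of $\nu$ modulo $\Gamma$ is torsion, and the residue field of $\nu$ is algebraic over that of $v$. For $s\ge0$ let $\partial_s$ be the $s$-th Hasse–Schmidt derivative, defined by $f(x+y)=\sum_{s\ge0}(\partial_sf)y^s$. For nonconstant $f$ with $\nu(f)<\infty$ the level is $\epsilon_\nu(f)=\max\{(\nu(f)-\nu(\partial_sf))/s: s\ge1\}$; $\epsilon_\nu(a)=-\infty$ for $a\in K$. A monic $Q\in K[x]$ is a key polynomial for $\nu$ if $\epsilon_\nu(f)<\epsilon_\nu(Q)$ whenever $\deg f<\deg Q$. For monic $Q$, each $f$ has a unique $Q$-expansion $f=\sum_{i\ge0}f_{Q,i}Q^i$ with $\deg f_{Q,i}<\deg Q$; set $\nu_Q(f)=\min_i\nu(f_{Q,i}Q^i)$, $S_Q(f)=\{i:\nu(f_{Q,i}Q^i)=\nu_Q(f)\}$, $\deg_Qf=\max S_Q(f)$. Fix $m\ge1$ such that the set $\Psi_m$ of key polynomials of degree $m$ for $\nu$ is nonempty and has no element of maximal $\nu$-value. Let $\mathcal Q\subseteq\Psi_m$ be well-ordered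 by $Q<R\iff\nu(Q)<\nu(R)$ and cofinal in $\Psi_m$ for $\nu$-values. A polynomial $f$ is $\mathcal Q$-stable if $\nu_Q(f)=\nu(f)$ for all $Q$ in some final segment of $\mathcal Q$, $\mathcal Q$-unstable otherwise. Assume unstable polynomials exist; limit key polynomials are the monic $\mathcal Q$-unstable polynomials of minimal degree, forming the set $\mathrm{KP}_\infty(\mathcal Q)$. *)

theory Defs
  imports "HOL-Computational_Algebra.Polynomial" "HOL-Library.Extended"
begin

text \<open>Values live in a linearly ordered abelian group 'g (the group Lambda),
  extended by +infinity (Pinf) and -infinity (Minf, only used for levels).\<close>

definition nsm :: "nat \<Rightarrow> 'g::ab_group_add \<Rightarrow> 'g" where
  "nsm n x = (\<Sum>i<n. x)"

definition divisible_group :: "'g::ab_group_add itself \<Rightarrow> bool" where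
  "divisible_group _ \<longleftrightarrow> (\<forall>(x::'g) n. n > 0 \<longrightarrow> (\<exists>y. nsm n y = x))"

text \<open>division of an element of a divisible torsion-free group by a positive integer\<close>
definition ndiv :: "nat \<Rightarrow> 'g::ab_group_add \<Rightarrow> 'g" where
  "ndiv s x = (THE y. nsm s y = x)"

definition valuation_on_field :: "('k::field \<Rightarrow> 'g::linordered_ab_group_add extended) \<Rightarrow> bool" where
  "valuation_on_field v \<longleftrightarrow>
     (\<forall>a. v a = Pinf \<longleftrightarrow> a = 0) \<and> (\<forall>a. v a \<noteq> Minf) \<and>
     (\<forall>a b. v (a * b) = v a + v b) \<and> (\<forall>a b. min (v a) (v b) \<le> v (a + b))"

text \<open>A valuation on K[x] (possibly with nontrivial support) extending v.\<close>
definition valuation_on_polys :: "('k::field poly \<Rightarrow> 'g::linordered_ab_group_add extended) \<Rightarrow> bool" where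
  "valuation_on_polys \<nu> \<longleftrightarrow>
     \<nu> 0 = Pinf \<and> (\<forall>f. \<nu> f \<noteq> Minf) \<and>
     (\<forall>f g. \<nu> (f * g) = \<nu> f + \<nu> g) \<and> (\<forall>f g. min (\<nu> f) (\<nu> g) \<le> \<nu> (f + g))"

definition extends_val :: "('k::field poly \<Rightarrow> 'g extended) \<Rightarrow> ('k \<Rightarrow> 'g extended) \<Rightarrow> bool" where
  "extends_val \<nu> v \<longleftrightarrow> (\<forall>a. \<nu> [:a:] = v a)"

definition henselian :: "('k::field \<Rightarrow> 'g::linordered_ab_group_add extended) \<Rightarrow> bool" where
  "henselian v \<longleftrightarrow>
     (\<forall>f a. lead_coeff f = 1 \<and> (\<forall>i. v (coeff f i) \<ge> 0) \<and> v a \<ge> 0 \<and> v (poly f a) > 0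
            \<and> v (poly (pderiv f) a) = 0
        \<longrightarrow> (\<exists>b. poly f b = 0 \<and> v (b - a) > 0))"

definition value_group :: "('k \<Rightarrow> 'g extended) \<Rightarrow> 'g set" where
  "value_group v = {\<gamma>. \<exists>a. v a = Fin \<gamma>}"

definition div_hull :: "'g::ab_group_add set \<Rightarrow> 'g set" where
  "div_hull G = {\<gamma>. \<exists>n>0. nsm n \<gamma> \<in> G}"

definition poly_value_group :: "('k::field poly \<Rightarrow> 'g::ab_group_add extended) \<Rightarrow> 'g set" where
  "poly_value_group \<nu> = {\<gamma> - \<delta> | \<gamma> \<delta>. \<exists>f g. \<nu> f = Fin \<gamma> \<and> \<nu> g = Fin \<delta>}"

definition support_trivial :: "('k::field poly \<Rightarrow> 'g extended) \<Rightarrow> bool" where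
  "support_trivial \<nu> \<longleftrightarrow> (\<forall>f. \<nu> f = Pinf \<longrightarrow> f = 0)"

definition value_group_torsion_mod :: "('k::field poly \<Rightarrow> 'g::ab_group_add extended) \<Rightarrow> ('k \<Rightarrow> 'g extended) \<Rightarrow> bool" where
  "value_group_torsion_mod \<nu> v \<longleftrightarrow>
     (\<forall>\<gamma>\<in>poly_value_group \<nu>. \<exists>n>0. nsm n \<gamma> \<in> div_hull (value_group v))"

text \<open>Residue field of nu algebraic over that of v: every residue class f/g
  (nu g finite, nu f >= nu g) is a root of a monic polynomial with coefficients
  residues of elements of the valuation ring of v.\<close>
definition residue_algebraic :: "('k::field poly \<Rightarrow> 'g::linordered_ab_group_add extended) \<Rightarrow> ('k \<Rightarrow> 'g extended) \<Rightarrow> bool" where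
  "residue_algebraic \<nu> v \<longleftrightarrow>
     (\<forall>f g. \<nu> g \<noteq> Pinf \<and> \<nu> g \<le> \<nu> f \<longrightarrow>
        (\<exists>n>0. \<exists>a::nat \<Rightarrow> 'k. (\<forall>i. v (a i) \<ge> 0) \<and>
            \<nu> (f ^ n + (\<Sum>i<n. [:a i:] * f ^ i * g ^ (n - i))) > \<nu> (g ^ n)))"

definition well_specified :: "('k::field poly \<Rightarrow> 'g::linordered_ab_group_add extended) \<Rightarrow> ('k \<Rightarrow> 'g extended) \<Rightarrow> bool" where
  "well_specified \<nu> v \<longleftrightarrow>
     \<not> (support_trivial \<nu> \<and> value_group_torsion_mod \<nu> v \<and> residue_algebraic \<nu> v)"

text \<open>Hasse--Schmidt derivative: coefficient of y^s in f(x+y).\<close>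
definition hasse :: "nat \<Rightarrow> 'k::comm_ring_1 poly \<Rightarrow> 'k poly" where
  "hasse s f = coeff (pcompose (map_poly (\<lambda>c. [:c:]) f) [:[:0, 1:], 1:]) s"

text \<open>Level. Terms with nu(hasse s f) = infinity are -infinity; for s > deg f
  they all are, so the max is over 1..deg f. Convention: level +infinity for
  nonconstant f with nu f = infinity.\<close>
definition level :: "('k::field poly \<Rightarrow> 'g::linordered_ab_group_add extended) \<Rightarrow> 'k poly \<Rightarrow> 'g extended" where
  "level \<nu> f =
     (if degree f = 0 then Minf
      else case \<nu> f of
        Fin a \<Rightarrow> Max ((\<lambda>s. case \<nu> (hasse s f) of Fin b \<Rightarrow> Fin (ndiv s (a - b)) | _ \<Rightarrow> Minf) ` {1..degree f})
      | _ \<Rightarrow> Pinf)"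

definition key_poly :: "('k::field poly \<Rightarrow> 'g::linordered_ab_group_add extended) \<Rightarrow> 'k poly \<Rightarrow> bool" where
  "key_poly \<nu> Q \<longleftrightarrow> lead_coeff Q = 1 \<and> (\<forall>f. degree f < degree Q \<longrightarrow> level \<nu> f < level \<nu> Q)"

definition qexp :: "'k::field poly \<Rightarrow> 'k poly \<Rightarrow> nat \<Rightarrow> 'k poly" where
  "qexp Q f = (THE c. (\<forall>i. degree (c i) < degree Q) \<and>
        (\<exists>N. (\<forall>i\<ge>N. c i = 0) \<and> f = (\<Sum>i<N. c i * Q ^ i)))"

definition nuQ :: "('k::field poly \<Rightarrow> 'g::linordered_ab_group_add extended) \<Rightarrow> 'k poly \<Rightarrow> 'k poly \<Rightarrow> 'g extended" where
  "nuQ \<nu> Q f = Min ((\<lambda>i. \<nu> (qexp Q f i * Q ^ i)) ` {..degree f})"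

definition SQ :: "('k::field poly \<Rightarrow> 'g::linordered_ab_group_add extended) \<Rightarrow> 'k poly \<Rightarrow> 'k poly \<Rightarrow> nat set" where
  "SQ \<nu> Q f = {i. \<nu> (qexp Q f i * Q ^ i) = nuQ \<nu> Q f}"

definition degQ :: "('k::field poly \<Rightarrow> 'g::linordered_ab_group_add extended) \<Rightarrow> 'k poly \<Rightarrow> 'k poly \<Rightarrow> nat" where
  "degQ \<nu> Q f = Max (SQ \<nu> Q f)"

definition Psi :: "('k::field poly \<Rightarrow> 'g::linordered_ab_group_add extended) \<Rightarrow> nat \<Rightarrow> 'k poly set" where
  "Psi \<nu> m = {Q. key_poly \<nu> Q \<and> degree Q = m}"

definition stable :: "('k::field poly \<Rightarrow> 'g::linordered_ab_group_add extended) \<Rightarrow> 'k poly set \<Rightarrow> 'k poly \<Rightarrow> bool" where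
  "stable \<nu> \<Q> f \<longleftrightarrow> (\<exists>Q0\<in>\<Q>. \<forall>Q\<in>\<Q>. \<nu> Q0 \<le> \<nu> Q \<longrightarrow> nuQ \<nu> Q f = \<nu> f)"

definition limit_key_polys :: "('k::field poly \<Rightarrow> 'g::linordered_ab_group_add extended) \<Rightarrow> 'k poly set \<Rightarrow> 'k poly set" where
  "limit_key_polys \<nu> \<Q> = {f. lead_coeff f = 1 \<and> \<not> stable \<nu> \<Q> f \<and>
       (\<forall>g. \<not> stable \<nu> \<Q> g \<longrightarrow> degree f \<le> degree g)}"

end

theory Submission
  imports "HOL-Algebra.Algebraic_Closure_Type" Defs
begin

text \<open>Let \<open>\<delta>\<close> be the level of a key polynomial \<open>Q\<close> and give the variable \<open>y\<close> the value \<open>\<delta>\<close>. Under the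
  resulting Gauss valuation, \<open>g(x + y)\<close> has initial form of degree \<open>0\<close> in \<open>y\<close> whenever
  \<open>deg g < deg Q\<close>, while that of \<open>Q(x + y)\<close> has some degree \<open>r \<ge> 1\<close>. Hence \<open>\<nu>\<^sub>Q(h)\<close> is the Gauss value
  of \<open>h(x + y)\<close>, and the degree of its initial form is \<open>r deg\<^sub>Q h\<close>. The maps \<open>h \<mapsto> \<nu>(h mod Q)\<close> and
  \<open>h \<mapsto> \<nu>(h mod f)\<close> are valuations on the simple extensions of \<open>K\<close> defined by \<open>Q\<close> and by a limit key
  polynomial \<open>f\<close>. Since \<open>K\<close> is henselian, both are induced by one valuation of the algebraic closure,
  so \<open>f(\<eta> + y)\<close> has initial degree \<open>r deg\<^sub>Q f\<close> at every root \<open>\<eta>\<close> of \<open>Q\<close>, and \<open>Q(\<theta> + y)\<close> has initial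
  degree \<open>r\<close> at every root \<open>\<theta>\<close> of \<open>f\<close>. They count the roots \<open>\<theta>\<close> of \<open>f\<close> with
  \<open>\<eta> - \<theta>\<close> of value at least \<open>\<delta>\<close> and the roots \<open>\<eta>\<close> of \<open>Q\<close> with the same property;
  counting these pairs twice gives \<open>deg Q \<cdot> r deg\<^sub>Q f = deg f \<cdot> r\<close>.\<close>

subsection \<open>Multiples and Gauss valuations\<close>

text \<open>Irreducibility and separability of \<open>Q\<close> and \<open>f\<close> are not
  presupposed: roots are counted with multiplicity, and conjugation is by
  \<open>K\<close>-endomorphisms of the closure. The same \<open>r\<close> occurs in both counts
  because a Hasse derivative of \<open>Q\<close> of order at least \<open>1\<close> has degree below
  \<open>deg Q \<le> deg f\<close>, so its value at a root of either polynomial is its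
  \<open>\<nu>\<close>-value. The constant coefficients do differ: \<open>Q\<close> vanishes at
  \<open>\<eta>\<close>, while at \<open>\<theta>\<close> it has the value
  \<open>\<nu>(Q mod f)\<close>. Since \<open>r \<ge> 1\<close>, the bound
  \<open>\<nu>(Q) \<le> \<nu>(Q mod f)\<close> suffices, and instability of \<open>f\<close> gives
  it when \<open>deg f = deg Q\<close>. Instability also makes
  \<open>h \<mapsto> \<nu>(h mod f)\<close> multiplicative: a product whose value changed under
  reduction would force \<open>\<nu>\<^sub>Q(f) \<ge> \<nu>(f)\<close> far out in
  \<open>\<Q>\<close>. That the two valuations come from a single one of the closure rests on
  conjugates having equal value: a minimal polynomial whose roots share one value has a Newton
  polygon with a single slope, which leaves one possible value for each residue class.\<close>

lemma nsm_0 [simp]: "nsm 0 x = 0"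
  by (simp add: nsm_def)

lemma nsm_Suc [simp]: "nsm (Suc n) x = nsm n x + x"
  by (simp add: nsm_def)

lemma nsm_add_left: "nsm (m + n) x = nsm m x + nsm n x"
  by (induction n) (auto simp: algebra_simps)

lemma nsm_add_right: "nsm n (x + y) = nsm n x + nsm n y"
  by (induction n) (auto simp: algebra_simps)

lemma nsm_zero [simp]: "nsm n 0 = 0"
  by (induction n) auto

lemma nsm_mult: "nsm (m * n) x = nsm m (nsm n x)"
  by (induction m) (auto simp: nsm_add_left algebra_simps)

lemma nsm_mono:
  fixes x y :: "'g::linordered_ab_group_add"
  shows "x \<le> y \<Longrightarrow> nsm n x \<le> nsm n y"
  by (induction n) (auto intro: add_mono)

lemma nsm_strict_mono:
  fixes x y :: "'g::linordered_ab_group_add"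
  assumes "x < y" "n > 0"
  shows "nsm n x < nsm n y"
  using assms(2)
proof (induction n)
  case (Suc n)
  have "nsm n x \<le> nsm n y" using assms(1) by (intro nsm_mono) auto
  then show ?case using assms(1) by (simp add: add_le_less_mono)
qed simp

lemma nsm_less_iff:
  fixes x y :: "'g::linordered_ab_group_add"
  shows "n > 0 \<Longrightarrow> nsm n x < nsm n y \<longleftrightarrow> x < y"
  by (metis nsm_strict_mono nsm_mono not_less)

lemma nsm_le_iff:
  fixes x y :: "'g::linordered_ab_group_add"
  shows "n > 0 \<Longrightarrow> nsm n x \<le> nsm n y \<longleftrightarrow> x \<le> y"
  by (meson nsm_less_iff not_less)

lemma nsm_eq_iff:
  fixes x y :: "'g::linordered_ab_group_add"
  shows "n > 0 \<Longrightarrow> nsm n x = nsm n y \<longleftrightarrow> x = y"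
  by (simp add: nsm_le_iff order_eq_iff)

lemma nsm_ndiv:
  fixes x :: "'g::linordered_ab_group_add"
  assumes "divisible_group TYPE('g)" "n > 0"
  shows "nsm n (ndiv n x) = x"
proof -
  obtain y where y: "nsm n y = x"
    using assms unfolding divisible_group_def by blast
  show ?thesis
    unfolding ndiv_def
  proof (rule theI[of "\<lambda>z. nsm n z = x", OF y])
    fix z assume "nsm n z = x"
    with y show "z = y" using nsm_eq_iff[OF assms(2), of z y] by simp
  qed
qed

text \<open>The support may be nonzero, so that the functions
  \<open>h \<mapsto> \<nu>(h mod P)\<close>, infinite on all multiples of \<open>P\<close>, are
  instances, just as \<open>v\<close>, \<open>\<nu>\<close> and the extension of \<open>v\<close> to
  the closure.\<close>

locale ring_valuation =
  fixes u :: "'r::comm_ring_1 \<Rightarrow> 'g::linordered_ab_group_add extended"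
  assumes val_0 [simp]: "u 0 = Pinf"
    and val_1 [simp]: "u 1 = Fin 0"
    and val_not_Minf [simp]: "u x \<noteq> Minf"
    and val_mult: "u (x * y) = u x + u y"
    and val_add: "min (u x) (u y) \<le> u (x + y)"
begin

lemma val_cases: "(u x = Pinf \<Longrightarrow> thesis) \<Longrightarrow> (\<And>a. u x = Fin a \<Longrightarrow> thesis) \<Longrightarrow> thesis"
  using val_not_Minf by (metis extended.exhaust)

lemma val_uminus [simp]: "u (- x) = u x"
proof -
  have *: "u (- 1) + u (- 1) = Fin 0"
    by (metis mult_minus_right mult.right_neutral minus_minus val_1 val_mult)
  have "u (- 1) = Fin 0"
    using * by (cases "- 1 :: 'r" rule: val_cases) auto
  then have "u (- 1 * x) = Fin 0 + u x"
    by (simp only: val_mult)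
  then show ?thesis by (cases x rule: val_cases) auto
qed

lemma val_diff_commute: "u (x - y) = u (y - x)"
  by (metis minus_diff_eq val_uminus)

lemma val_add_ge: "c \<le> u x \<Longrightarrow> c \<le> u y \<Longrightarrow> c \<le> u (x + y)"
  by (meson min.boundedI order_trans val_add)

lemma val_add_gt: "c < u x \<Longrightarrow> c < u y \<Longrightarrow> c < u (x + y)"
  by (meson less_le_trans min_less_iff_conj val_add)

lemma val_diff_ge: "c \<le> u x \<Longrightarrow> c \<le> u y \<Longrightarrow> c \<le> u (x - y)"
  using val_add_ge[of c x "- y"] by simp

lemma val_diff_gt: "c < u x \<Longrightarrow> c < u y \<Longrightarrow> c < u (x - y)"
  using val_add_gt[of c x "- y"] by simp

lemma val_sum_ge: "(\<And>i. i \<in> A \<Longrightarrow> c \<le> u (h i)) \<Longrightarrow> c \<le> u (sum h A)"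
  by (induction A rule: infinite_finite_induct) (auto intro: val_add_ge)

lemma val_sum_gt: "(\<And>i. i \<in> A \<Longrightarrow> Fin c < u (h i)) \<Longrightarrow> Fin c < u (sum h A)"
  by (induction A rule: infinite_finite_induct) (auto intro: val_add_gt)

lemma val_add_eq: "u x < u y \<Longrightarrow> u (x + y) = u x"
proof (rule antisym)
  assume *: "u x < u y"
  show "u x \<le> u (x + y)" using * by (intro val_add_ge) auto
  show "u (x + y) \<le> u x"
  proof (rule ccontr)
    assume "\<not> u (x + y) \<le> u x"
    then have "u x < u (x + y)" by simp
    then have "u x < u (x + y - y)" using * by (rule val_diff_gt)
    then show False by simp
  qed
qed

lemma val_diff_neq: "u x \<noteq> u y \<Longrightarrow> u (x - y) = min (u x) (u y)"
proof (cases "u x < u y")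
  case True
  then show ?thesis using val_add_eq[of x "- y"] by (simp add: min_def less_imp_le)
next
  case False
  assume "u x \<noteq> u y"
  then have "u y < u x" using False by simp
  then show ?thesis using val_add_eq[of "- y" x] by (auto simp: min_def)
qed

lemma val_mult_ge: "Fin a \<le> u x \<Longrightarrow> Fin b \<le> u y \<Longrightarrow> Fin (a + b) \<le> u (x * y)"
  by (cases x rule: val_cases; cases y rule: val_cases) (auto simp: val_mult intro: add_mono)

lemma val_mult_gt: "Fin a < u x \<Longrightarrow> Fin b \<le> u y \<Longrightarrow> Fin (a + b) < u (x * y)"
  by (cases x rule: val_cases; cases y rule: val_cases) (auto simp: val_mult intro: add_less_le_mono)

lemma val_mult_gt': "Fin a \<le> u x \<Longrightarrow> Fin b < u y \<Longrightarrow> Fin (a + b) < u (x * y)"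
  using val_mult_gt[of b y a x] by (simp add: mult.commute add.commute)

lemma val_mult_Fin: "u x = Fin a \<Longrightarrow> u y = Fin b \<Longrightarrow> u (x * y) = Fin (a + b)"
  by (simp add: val_mult)

lemma val_power_ge: "Fin a \<le> u x \<Longrightarrow> Fin (nsm n a) \<le> u (x ^ n)"
proof (induction n)
  case (Suc n)
  then show ?case using val_mult_ge[of a x "nsm n a" "x ^ n"] by (simp add: add.commute)
qed auto

lemma val_power_gt: "Fin a < u x \<Longrightarrow> n > 0 \<Longrightarrow> Fin (nsm n a) < u (x ^ n)"
proof (cases n)
  case (Suc k)
  assume "Fin a < u x"
  then show ?thesis using Suc val_mult_gt[of a x "nsm k a" "x ^ k"] val_power_ge[of a x k]
    by (simp add: add.commute less_imp_le)
qed auto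

lemma val_power_Fin: "u x = Fin a \<Longrightarrow> u (x ^ n) = Fin (nsm n a)"
  by (induction n) (auto simp: val_mult add.commute)

text \<open>A lower bound rather than a value, since a polynomial all of whose coefficients have
  value \<open>Pinf\<close>, such as \<open>0\<close>, has no Gauss value in
  \<open>'g\<close>.\<close>

definition gauss_ge :: "'g \<Rightarrow> 'r poly \<Rightarrow> 'g \<Rightarrow> bool" where
  "gauss_ge \<delta> p \<gamma> \<longleftrightarrow> (\<forall>s. Fin (\<gamma> - nsm s \<delta>) \<le> u (coeff p s))"

text \<open>\<open>gauss_top \<delta> p \<gamma> r\<close>: the value of \<open>p\<close> under the Gauss extension of \<open>u\<close> giving the variable
  the value \<open>\<delta>\<close> is \<open>\<gamma>\<close>, and \<open>r\<close> is the degree of the initial form of \<open>p\<close>.\<close>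

definition gauss_top :: "'g \<Rightarrow> 'r poly \<Rightarrow> 'g \<Rightarrow> nat \<Rightarrow> bool" where
  "gauss_top \<delta> p \<gamma> r \<longleftrightarrow> gauss_ge \<delta> p \<gamma> \<and> u (coeff p r) = Fin (\<gamma> - nsm r \<delta>) \<and>
     (\<forall>s>r. Fin (\<gamma> - nsm s \<delta>) < u (coeff p s))"

lemma gauss_topD:
  assumes "gauss_top \<delta> p \<gamma> r"
  shows "gauss_ge \<delta> p \<gamma>" "u (coeff p r) = Fin (\<gamma> - nsm r \<delta>)"
    "s > r \<Longrightarrow> Fin (\<gamma> - nsm s \<delta>) < u (coeff p s)"
  using assms by (auto simp: gauss_top_def)

lemma gauss_ge_mono: "gauss_ge \<delta> p \<gamma> \<Longrightarrow> \<gamma>' \<le> \<gamma> \<Longrightarrow> gauss_ge \<delta> p \<gamma>'"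
  unfolding gauss_ge_def
  by (metis diff_right_mono less_eq_extended.simps(1) order_trans)

lemma gauss_ge_diff: "gauss_ge \<delta> p \<gamma> \<Longrightarrow> gauss_ge \<delta> q \<gamma> \<Longrightarrow> gauss_ge \<delta> (p - q) \<gamma>"
  by (auto simp: gauss_ge_def intro: val_diff_ge)

lemma gauss_ge_add: "gauss_ge \<delta> p \<gamma> \<Longrightarrow> gauss_ge \<delta> q \<gamma> \<Longrightarrow> gauss_ge \<delta> (p + q) \<gamma>"
  by (auto simp: gauss_ge_def intro: val_add_ge)

lemma gauss_ge_0 [simp]: "gauss_ge \<delta> 0 \<gamma>"
  by (simp add: gauss_ge_def)

lemma gauss_top_ge_le: "gauss_top \<delta> p \<gamma> r \<Longrightarrow> gauss_ge \<delta> p \<gamma>' \<Longrightarrow> \<gamma>' \<le> \<gamma>"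
  unfolding gauss_top_def gauss_ge_def
  by (metis diff_le_eq diff_add_cancel less_eq_extended.simps(1))

lemma gauss_top_unique:
  assumes "gauss_top \<delta> p \<gamma> r" "gauss_top \<delta> p \<gamma>' r'"
  shows "\<gamma> = \<gamma>'" "r = r'"
proof -
  show *: "\<gamma> = \<gamma>'"
    using assms by (meson gauss_top_ge_le gauss_topD(1) antisym)
  show "r = r'"
    using assms unfolding * gauss_top_def
    by (metis less_irrefl linorder_neqE_nat)
qed

text \<open>Gauss's lemma for initial forms. In the convolution for the coefficient of index
  \<open>n\<close>, a summand with \<open>i > r\<close> or \<open>n - i > r'\<close> exceeds the
  bound strictly. For \<open>n = r + r'\<close> the summand \<open>i = r\<close> is the only one
  left, so nothing cancels it; for larger \<open>n\<close> none is left.\<close>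

lemma gauss_top_mult:
  assumes p: "gauss_top \<delta> p \<gamma> r" and q: "gauss_top \<delta> q \<gamma>' r'"
  shows "gauss_top \<delta> (p * q) (\<gamma> + \<gamma>') (r + r')"
proof -
  have split: "\<gamma> + \<gamma>' - nsm n \<delta> = (\<gamma> - nsm i \<delta>) + (\<gamma>' - nsm (n - i) \<delta>)" if "i \<le> n" for n i
  proof -
    have "nsm n \<delta> = nsm i \<delta> + nsm (n - i) \<delta>"
      using that by (metis le_add_diff_inverse nsm_add_left)
    then show ?thesis by simp
  qed
  have ge: "Fin (\<gamma> - nsm i \<delta>) \<le> u (coeff p i)" "Fin (\<gamma>' - nsm i \<delta>) \<le> u (coeff q i)" for i
    using p q by (auto simp: gauss_top_def gauss_ge_def)
  have gt: "Fin (\<gamma> + \<gamma>' - nsm n \<delta>) < u (coeff p i * coeff q (n - i))"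
    if "i \<le> n" "i > r \<or> n - i > r'" for n i
    using that(2)
  proof
    assume "i > r"
    then show ?thesis
      using p by (subst split[OF that(1)], intro val_mult_gt ge) (auto simp: gauss_top_def)
  next
    assume "n - i > r'"
    then show ?thesis
      using q by (subst split[OF that(1)], intro val_mult_gt' ge) (auto simp: gauss_top_def)
  qed
  show ?thesis
    unfolding gauss_top_def
  proof (intro conjI allI impI)
    show "gauss_ge \<delta> (p * q) (\<gamma> + \<gamma>')"
      unfolding gauss_ge_def coeff_mult
    proof (intro allI val_sum_ge)
      fix n i :: nat assume "i \<in> {..n}"
      then have "i \<le> n" by simp
      then show "Fin (\<gamma> + \<gamma>' - nsm n \<delta>) \<le> u (coeff p i * coeff q (n - i))"
        by (subst split) (auto intro: val_mult_ge ge)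
    qed
    show "Fin (\<gamma> + \<gamma>' - nsm s \<delta>) < u (coeff (p * q) s)" if "s > r + r'" for s
      unfolding coeff_mult
      by (intro val_sum_gt gt) (use that in auto)
    have "coeff (p * q) (r + r') = coeff p r * coeff q (r + r' - r)
        + (\<Sum>i\<in>{..r + r'} - {r}. coeff p i * coeff q (r + r' - i))"
      unfolding coeff_mult by (rule sum.remove) auto
    moreover have "u (coeff p r * coeff q (r + r' - r)) = Fin (\<gamma> + \<gamma>' - nsm (r + r') \<delta>)"
      using val_mult_Fin[OF gauss_topD(2)[OF p] gauss_topD(2)[OF q]] split[of r "r + r'"] by simp
    moreover have "Fin (\<gamma> + \<gamma>' - nsm (r + r') \<delta>) <
        u (\<Sum>i\<in>{..r + r'} - {r}. coeff p i * coeff q (r + r' - i))"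
      by (intro val_sum_gt gt) auto
    ultimately show "u (coeff (p * q) (r + r')) = Fin (\<gamma> + \<gamma>' - nsm (r + r') \<delta>)"
      by (simp add: val_add_eq)
  qed
qed

lemma gauss_top_1: "gauss_top \<delta> 1 0 0"
  by (auto simp: gauss_top_def gauss_ge_def split: if_splits)

lemma gauss_top_power: "gauss_top \<delta> p \<gamma> r \<Longrightarrow> gauss_top \<delta> (p ^ n) (nsm n \<gamma>) (n * r)"
proof (induction n)
  case (Suc n)
  then show ?case using gauss_top_mult[of \<delta> p \<gamma> r "p ^ n" "nsm n \<gamma>" "n * r"] by (simp add: add.commute)
qed (use gauss_top_1 in simp)

text \<open>The Gauss value of \<open>c + y\<close> is the smaller of \<open>u c\<close> and
  \<open>\<delta>\<close>, and \<open>y\<close> belongs to the initial form unless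
  \<open>u c\<close> is strictly smaller. All root counts below come from this case
  distinction.\<close>

lemma gauss_top_linear:
  "gauss_top \<delta> [:c, 1:] (case u c of Fin a \<Rightarrow> min a \<delta> | _ \<Rightarrow> \<delta>) (if Fin \<delta> \<le> u c then 1 else 0)"
proof -
  show ?thesis
    unfolding gauss_top_def gauss_ge_def
    by (cases c rule: val_cases)
      (auto simp: coeff_pCons min_def less_eq_extended.simps le_diff_eq split: nat.splits)
qed

lemma gauss_top_prod_linear:
  "\<exists>\<gamma>. gauss_top \<delta> (\<Prod>a\<in>#A. [:c a, 1:]) \<gamma> (size {#a \<in># A. Fin \<delta> \<le> u (c a)#})"
proof (induction A)
  case empty
  then show ?case using gauss_top_1 by auto
next
  case (add a A)
  then obtain \<gamma> where "gauss_top \<delta> (\<Prod>a\<in>#A. [:c a, 1:]) \<gamma> (size {#a \<in># A. Fin \<delta> \<le> u (c a)#})" ..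
  from gauss_top_mult[OF gauss_top_linear[of \<delta> "c a"] this] show ?case
    by (auto split: if_splits)
qed

text \<open>A bound for elementary symmetric functions: the coefficient of index \<open>s\<close> is
  a sum of products of \<open>size A - s\<close> elements of value at least
  \<open>\<delta>\<close>.\<close>

lemma gauss_ge_prod_linear:
  assumes "\<And>a. a \<in># A \<Longrightarrow> Fin \<delta> \<le> u (c a)"
  shows "gauss_ge \<delta> (\<Prod>a\<in>#A. [:c a, 1:]) (nsm (size A) \<delta>)"
proof -
  have "gauss_top \<delta> (\<Prod>a\<in>#A. [:c a, 1:]) (nsm (size A) \<delta>) (size A)"
    using assms
  proof (induction A)
    case empty
    then show ?case using gauss_top_1 by auto
  next
    case (add a A)
    have *: "Fin \<delta> \<le> u (c a)" using add.prems by simp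
    then have "gauss_top \<delta> [:c a, 1:] \<delta> 1"
      using gauss_top_linear[of \<delta> "c a"]
      by (cases "c a" rule: val_cases) (auto simp: min_def split: if_splits)
    from gauss_top_mult[OF this, of "\<Prod>a\<in>#A. [:c a, 1:]" "nsm (size A) \<delta>" "size A"] add show ?case
      by (simp add: add.commute del: mult_pCons_left)
  qed
  then show ?thesis by (rule gauss_topD)
qed

end

subsection \<open>Taylor and Q-expansions\<close>

locale ring_hom_map =
  fixes h :: "'a::comm_ring_1 \<Rightarrow> 'b::comm_ring_1"
  assumes hom_1 [simp]: "h 1 = 1"
    and hom_add: "h (x + y) = h x + h y"
    and hom_mult: "h (x * y) = h x * h y"
begin

lemma hom_0 [simp]: "h 0 = 0"
  using hom_add[of 0 0] by simp

lemma hom_uminus: "h (- x) = - h x"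
  using hom_add[of x "- x"] by (simp add: eq_neg_iff_add_eq_0 add.commute)

lemma hom_diff: "h (x - y) = h x - h y"
  using hom_add[of x "- y"] by (simp add: hom_uminus)

lemma hom_sum: "h (sum g A) = (\<Sum>i\<in>A. h (g i))"
  by (induction A rule: infinite_finite_induct) (auto simp: hom_add)

lemma hom_power: "h (x ^ n) = h x ^ n"
  by (induction n) (auto simp: hom_mult)

lemma hom_prod_mset: "h (prod_mset A) = (\<Prod>x\<in>#A. h x)"
  by (induction A) (auto simp: hom_mult)

lemma map_poly_hom_add: "map_poly h (p + q) = map_poly h p + map_poly h q"
  by (rule poly_eqI) (simp add: coeff_map_poly hom_add)

lemma map_poly_hom_mult: "map_poly h (p * q) = map_poly h p * map_poly h q"
  by (rule poly_eqI) (simp add: coeff_map_poly coeff_mult hom_sum hom_mult)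

lemma map_poly_ring_hom: "ring_hom_map (map_poly h)"
  by unfold_locales (auto simp: map_poly_hom_add map_poly_hom_mult)

lemma poly_map_poly: "poly (map_poly h p) (h x) = h (poly p x)"
  by (induction p) (auto simp: map_poly_pCons hom_add hom_mult)

end

lemma ring_hom_map_comp: "ring_hom_map g \<Longrightarrow> ring_hom_map h \<Longrightarrow> ring_hom_map (\<lambda>x. g (h x))"
  by (simp add: ring_hom_map_def)

lemma ring_hom_map_pcompose: "ring_hom_map (\<lambda>p. pcompose p q)"
  by unfold_locales (auto simp: pcompose_1 pcompose_add pcompose_mult)

lemma ring_hom_map_const_poly: "ring_hom_map (\<lambda>c. [:c:])"
  by unfold_locales auto

text \<open>Keeps all Hasse derivatives in one polynomial in \<open>y\<close>; that this is a ring
  homomorphism stands in for the Leibniz rule.\<close>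

definition taylor :: "'k::comm_ring_1 poly \<Rightarrow> 'k poly poly" where
  "taylor f = pcompose (map_poly (\<lambda>c. [:c:]) f) [:[:0, 1:], 1:]"

lemma hasse_taylor: "hasse s f = coeff (taylor f) s"
  by (simp add: hasse_def taylor_def)

lemma ring_hom_taylor: "ring_hom_map taylor"
  unfolding taylor_def
  by (intro ring_hom_map_comp[OF ring_hom_map_pcompose] ring_hom_map.map_poly_ring_hom
      ring_hom_map_const_poly)

lemma hasse_of_0 [simp]: "hasse s 0 = 0"
  by (simp add: hasse_taylor taylor_def)

lemma hasse_pCons: "hasse s (pCons a p) =
    (if s = 0 then [:a:] else hasse (s - 1) p) + [:0, 1:] * hasse s p"
  by (cases s) (simp_all add: hasse_taylor taylor_def map_poly_pCons pcompose_pCons coeff_pCons)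

lemma hasse_0 [simp]: "hasse 0 f = f"
  by (induction f) (auto simp: hasse_pCons)

lemma coeff_hasse_eq_0: "i + s > degree f \<Longrightarrow> coeff (hasse s f) i = 0"
proof (induction f arbitrary: i s)
  case (pCons a p)
  show ?case
  proof (cases "p = 0")
    case True
    with pCons.prems show ?thesis by (auto simp: hasse_pCons coeff_pCons split: nat.splits)
  next
    case False
    with pCons.IH[of "i - 1" s] pCons.IH[of i "s - 1"] pCons.prems show ?thesis
      by (auto simp: hasse_pCons coeff_pCons split: nat.splits)
  qed
qed simp

lemma hasse_eq_0: "s > degree f \<Longrightarrow> hasse s f = 0"
  by (rule poly_eqI) (simp add: coeff_hasse_eq_0)

lemma degree_hasse_less:
  assumes "s \<ge> 1" "degree f \<ge> 1"
  shows "degree (hasse s f) < degree f"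
proof -
  have "degree (hasse s f) \<le> degree f - 1"
    by (rule degree_le) (use assms in \<open>auto intro!: coeff_hasse_eq_0\<close>)
  then show ?thesis using assms by linarith
qed

lemma hasse_degree: "hasse (degree f) f = [:lead_coeff f:]"
proof (induction f)
  case (pCons a p)
  then show ?case
    by (cases "p = 0") (auto simp: hasse_pCons hasse_eq_0)
qed simp

lemma degree_mod_lt:
  fixes Q :: "'k::field poly"
  shows "degree Q \<ge> 1 \<Longrightarrow> degree (h mod Q) < degree Q"
  using degree_mod_less[of Q h] by force

text \<open>Reduction modulo \<open>Q\<close> isolates the digit of index \<open>0\<close>, and
  cancelling one factor \<open>Q\<close> shifts the others down.\<close>

lemma Q_expansion_unique:
  fixes Q :: "'k::field poly"
  assumes "degree Q \<ge> 1" "\<And>i. degree (c i) < degree Q" "\<And>i. degree (d i) < degree Q"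
    and "(\<Sum>i<N. c i * Q ^ i) = (\<Sum>i<N. d i * Q ^ i)" "i < N"
  shows "c i = d i"
  using assms(2-)
proof (induction N arbitrary: c d i)
  case (Suc N)
  have split: "(\<Sum>i<Suc N. c i * Q ^ i) = c 0 + (\<Sum>i<N. c (Suc i) * Q ^ i) * Q" for c
    by (subst sum.lessThan_Suc_shift) (simp add: sum_distrib_left sum_distrib_right mult_ac)
  have eq: "c 0 + (\<Sum>i<N. c (Suc i) * Q ^ i) * Q = d 0 + (\<Sum>i<N. d (Suc i) * Q ^ i) * Q"
    using Suc.prems(3) unfolding split .
  from arg_cong[OF eq, of "\<lambda>p. p mod Q"] have 0: "c 0 = d 0"
    using Suc.prems(1)[of 0] Suc.prems(2)[of 0] by (simp add: mod_poly_less)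
  have "Q \<noteq> 0" using assms(1) by auto
  with eq 0 have "(\<Sum>i<N. c (Suc i) * Q ^ i) = (\<Sum>i<N. d (Suc i) * Q ^ i)"
    by simp
  from Suc.IH[OF _ _ this] Suc.prems(1,2) have "i < N \<Longrightarrow> c (Suc i) = d (Suc i)" for i
    by blast
  with 0 Suc.prems(4) show ?case by (cases i) auto
qed simp

lemma Q_expansion_exists:
  fixes Q :: "'k::field poly"
  assumes "degree Q \<ge> 1"
  shows "\<exists>c. (\<forall>i. degree (c i) < degree Q) \<and> (\<forall>i>degree h. c i = 0) \<and>
    h = (\<Sum>i\<le>degree h. c i * Q ^ i)"
proof (induction "degree h" arbitrary: h rule: less_induct)
  case less
  show ?case
  proof (cases "degree h < degree Q")
    case True
    let ?c = "\<lambda>i. if i = 0 then h else 0"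
    have "(\<Sum>i\<le>degree h. ?c i * Q ^ i) = (\<Sum>i\<le>degree h. if i = 0 then h else 0)"
      by (rule sum.cong) auto
    then show ?thesis
      using True assms by (intro exI[of _ ?c]) auto
  next
    case False
    define g where "g = h div Q"
    have h: "h = h mod Q + g * Q" by (simp add: g_def)
    have "Q \<noteq> 0" using assms by auto
    have deg: "degree g < degree h"
    proof (cases "g = 0")
      case True
      then show ?thesis using False assms by simp
    next
      case nz: False
      have "degree (h mod Q) < degree Q"
        by (rule degree_mod_lt[OF assms])
      also have "degree Q \<le> degree (g * Q)"
        using nz \<open>Q \<noteq> 0\<close> by (simp add: degree_mult_eq)
      finally have "degree h = degree (g * Q)"
        by (subst h) (rule degree_add_eq_right)
      then show ?thesis using nz \<open>Q \<noteq> 0\<close> assms by (simp add: degree_mult_eq)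
    qed
    from less.hyps[OF this] obtain c where c: "\<And>i. degree (c i) < degree Q"
      "\<And>i. i > degree g \<Longrightarrow> c i = 0" "g = (\<Sum>i\<le>degree g. c i * Q ^ i)" by blast
    define d where "d i = (case i of 0 \<Rightarrow> h mod Q | Suc j \<Rightarrow> c j)" for i
    obtain n where n: "degree h = Suc n" "degree g \<le> n"
      using deg by (cases "degree h") auto
    have "g = (\<Sum>i\<le>n. c i * Q ^ i)"
      by (subst c(3), rule sum.mono_neutral_left) (use n c(2) in auto)
    then have "g * Q = (\<Sum>i\<le>n. d (Suc i) * Q ^ Suc i)"
      by (simp add: d_def sum_distrib_left mult_ac)
    then have "h = (\<Sum>i\<le>degree h. d i * Q ^ i)"
      using h unfolding n(1) by (subst sum.atMost_Suc_shift) (simp add: d_def)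
    moreover have "degree (d i) < degree Q" for i
      using c(1) degree_mod_lt[OF assms] by (cases i) (auto simp: d_def)
    moreover have "d i = 0" if "i > degree h" for i
      using that c(2) n by (cases i) (auto simp: d_def)
    ultimately show ?thesis by blast
  qed
qed

lemma qexp_properties:
  fixes Q h :: "'k::field poly"
  assumes "degree Q \<ge> 1"
  shows "degree (qexp Q h i) < degree Q" "i > degree h \<Longrightarrow> qexp Q h i = 0"
    "h = (\<Sum>i\<le>degree h. qexp Q h i * Q ^ i)"
proof -
  obtain c where c: "\<And>i. degree (c i) < degree Q" "\<And>i. i > degree h \<Longrightarrow> c i = 0"
      "h = (\<Sum>i\<le>degree h. c i * Q ^ i)"
    using Q_expansion_exists[OF assms, of h] by blast
  have "qexp Q h = c"
    unfolding qexp_def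
  proof (rule the_equality)
    show "(\<forall>i. degree (c i) < degree Q) \<and>
      (\<exists>N. (\<forall>i\<ge>N. c i = 0) \<and> h = (\<Sum>i<N. c i * Q ^ i))"
      using c by (auto intro!: exI[of _ "Suc (degree h)"] simp: lessThan_Suc_atMost)
  next
    fix d assume "(\<forall>i. degree (d i) < degree Q) \<and>
      (\<exists>N. (\<forall>i\<ge>N. d i = 0) \<and> h = (\<Sum>i<N. d i * Q ^ i))"
    then obtain N where d: "\<And>i. degree (d i) < degree Q" "\<And>i. i \<ge> N \<Longrightarrow> d i = 0"
      "h = (\<Sum>i<N. d i * Q ^ i)" by blast
    show "d = c"
    proof
      fix i
      define M where "M = Suc (N + degree h + i)"
      have "h = (\<Sum>i<M. c i * Q ^ i)"
        by (subst c(3), rule sum.mono_neutral_left) (auto simp: M_def c(2))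
      moreover have "h = (\<Sum>i<M. d i * Q ^ i)"
        by (subst d(3), rule sum.mono_neutral_left) (auto simp: M_def d(2))
      ultimately have "(\<Sum>i<M. d i * Q ^ i) = (\<Sum>i<M. c i * Q ^ i)" by simp
      from Q_expansion_unique[OF assms d(1) c(1) this, of i]
      show "d i = c i" by (simp add: M_def)
    qed
  qed
  with c show "degree (qexp Q h i) < degree Q" "i > degree h \<Longrightarrow> qexp Q h i = 0"
    "h = (\<Sum>i\<le>degree h. qexp Q h i * Q ^ i)" by simp_all
qed

lemma qexp_small:
  fixes Q h :: "'k::field poly"
  assumes "degree Q \<ge> 1" "degree h < degree Q"
  shows "qexp Q h i = (if i = 0 then h else 0)"
proof -
  define d where "d i = (if i = 0 then h else 0)" for i :: nat
  define N where "N = Suc (degree h + i)"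
  have "h = (\<Sum>i<N. qexp Q h i * Q ^ i)"
    by (subst qexp_properties(3)[OF assms(1)], rule sum.mono_neutral_left)
      (auto simp: qexp_properties(2)[OF assms(1)] N_def)
  moreover have "(\<Sum>i<N. d i * Q ^ i) = (\<Sum>i<N. if i = 0 then h else 0)"
    by (rule sum.cong) (auto simp: d_def)
  ultimately have "(\<Sum>i<N. qexp Q h i * Q ^ i) = (\<Sum>i<N. d i * Q ^ i)"
    by (simp add: N_def)
  from Q_expansion_unique[OF assms(1) qexp_properties(1)[OF assms(1)] _ this, of i]
  show ?thesis using assms by (simp add: d_def N_def)
qed

text \<open>Since \<open>Q\<close> has an initial form of degree \<open>r \<ge> 1\<close>, the summands of a \<open>Q\<close>-expansion have initial
  forms of distinct degrees, which therefore cannot cancel.\<close>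

lemma (in ring_valuation) gauss_top_Q_expansion:
  fixes \<nu> :: "'k::field poly \<Rightarrow> 'g extended" and T :: "'k poly \<Rightarrow> 'r poly"
  assumes T: "ring_hom_map T" and \<nu>: "ring_valuation \<nu>" and Q: "degree Q \<ge> 1"
    and small: "\<And>g. g \<noteq> 0 \<Longrightarrow> degree g < degree Q \<Longrightarrow> \<exists>a. \<nu> g = Fin a \<and> gauss_top \<delta> (T g) a 0"
    and Qtop: "\<nu> Q = Fin \<gamma>" "gauss_top \<delta> (T Q) \<gamma> r" "r \<ge> 1" and "h \<noteq> 0"
  shows "\<exists>\<kappa>. nuQ \<nu> Q h = Fin \<kappa> \<and> gauss_top \<delta> (T h) \<kappa> (r * degQ \<nu> Q h)"
proof -
  interpret T: ring_hom_map T by fact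
  interpret nu: ring_valuation \<nu> by fact
  define t where "t i = qexp Q h i * Q ^ i" for i
  have t: "\<exists>a. \<nu> (t i) = Fin a \<and> gauss_top \<delta> (T (t i)) a (r * i)" if nz: "qexp Q h i \<noteq> 0" for i
  proof -
    obtain a where a: "\<nu> (qexp Q h i) = Fin a" "gauss_top \<delta> (T (qexp Q h i)) a 0"
      using small[OF nz qexp_properties(1)[OF Q]] by blast
    have "\<nu> (t i) = Fin (a + nsm i \<gamma>)"
      unfolding t_def by (intro nu.val_mult_Fin a nu.val_power_Fin Qtop)
    moreover have "gauss_top \<delta> (T (t i)) (a + nsm i \<gamma>) (r * i)"
      using gauss_top_mult[OF a(2) gauss_top_power[OF Qtop(2), of i]]
      by (simp add: t_def T.hom_mult T.hom_power mult.commute)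
    ultimately show ?thesis by blast
  qed
  have hsum: "h = (\<Sum>i\<le>degree h. t i)"
    unfolding t_def by (rule qexp_properties(3)[OF Q])
  define V where "V = (\<lambda>i. \<nu> (t i)) ` {..degree h}"
  have nuQ: "nuQ \<nu> Q h = Min V"
    by (simp add: nuQ_def V_def t_def)
  have "\<exists>i\<le>degree h. t i \<noteq> 0"
    using hsum \<open>h \<noteq> 0\<close> by (metis atMost_iff sum.neutral)
  then obtain i0 where i0: "i0 \<le> degree h" "qexp Q h i0 \<noteq> 0" by (auto simp: t_def)
  have V: "finite V" "V \<noteq> {}" by (auto simp: V_def)
  then have minV: "Min V \<in> V" by simp
  then obtain j where j: "Min V = \<nu> (t j)"
    unfolding V_def by (rule imageE)
  moreover have "Min V \<le> \<nu> (t i0)" using i0 V by (auto simp: V_def)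
  ultimately have "\<nu> (t j) \<le> \<nu> (t i0)" by simp
  note j = j this
  obtain \<kappa> where \<kappa>: "Min V = Fin \<kappa>"
    using j t[OF i0(2)] by (cases "t j" rule: nu.val_cases) auto
  have ge: "Fin \<kappa> \<le> \<nu> (t i)" for i
  proof (cases "i \<le> degree h")
    case True
    then show ?thesis using V unfolding \<kappa>[symmetric] by (auto simp: V_def)
  next
    case False
    then show ?thesis by (simp add: t_def qexp_properties(2)[OF Q])
  qed
  define S where "S = SQ \<nu> Q h"
  have S: "S = {i. \<nu> (t i) = Fin \<kappa>}"
    by (simp add: S_def SQ_def nuQ \<kappa> t_def)
  have "S \<subseteq> {..degree h}"
  proof
    fix i assume "i \<in> S"
    then have "t i \<noteq> 0" using S by auto
    then show "i \<in> {..degree h}"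
      using qexp_properties(2)[OF Q, of h i] unfolding t_def by (metis atMost_iff linorder_not_less mult_zero_left)
  qed
  then have "finite S" by (rule finite_subset) simp
  moreover have "j \<in> S" using j(1) \<kappa> S by simp
  ultimately have d: "degQ \<nu> Q h \<in> S" "\<And>i. i \<in> S \<Longrightarrow> i \<le> degQ \<nu> Q h"
    unfolding degQ_def S_def[symmetric] by (auto intro: Max_in)
  define d where "d = degQ \<nu> Q h"
  note d = d[folded d_def]
  have coeff_ge: "Fin (\<kappa> - nsm s \<delta>) \<le> u (coeff (T (t i)) s)" for i s
  proof (cases "qexp Q h i = 0")
    case False
    then obtain a where a: "\<nu> (t i) = Fin a" "gauss_top \<delta> (T (t i)) a (r * i)" using t by blast
    then have "gauss_ge \<delta> (T (t i)) \<kappa>"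
      using ge[of i] by (intro gauss_ge_mono[OF gauss_topD(1)]) auto
    then show ?thesis by (simp add: gauss_ge_def)
  qed (simp add: t_def)
  \<comment> \<open>A summand exceeds the bound strictly at \<open>y^s\<close> for one of two
    reasons: its own value is larger than \<open>\<kappa>\<close>, or it has value
    \<open>\<kappa>\<close> and \<open>s\<close> lies beyond the degree \<open>r * i\<close> of its
    initial form. This isolates the largest index in \<open>S\<close>.\<close>
  have coeff_gt: "Fin (\<kappa> - nsm s \<delta>) < u (coeff (T (t i)) s)" if "i \<in> S \<Longrightarrow> s > r * i" for i s
  proof (cases "qexp Q h i = 0")
    case False
    then obtain a where a: "\<nu> (t i) = Fin a" "gauss_top \<delta> (T (t i)) a (r * i)" using t by blast
    show ?thesis
    proof (cases "i \<in> S")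
      case True
      then have "a = \<kappa>" using a S by simp
      then show ?thesis using gauss_topD(3)[OF a(2)] that[OF True] by simp
    next
      case False
      then have "\<kappa> < a" using ge[of i] a S by auto
      then have "Fin (\<kappa> - nsm s \<delta>) < Fin (a - nsm s \<delta>)" by simp
      also have "\<dots> \<le> u (coeff (T (t i)) s)" using a(2) by (simp add: gauss_top_def gauss_ge_def)
      finally show ?thesis .
    qed
  qed (simp add: t_def)
  have Th: "coeff (T h) s = (\<Sum>i\<le>degree h. coeff (T (t i)) s)" for s
    by (subst hsum) (simp add: T.hom_sum coeff_sum)
  have "gauss_top \<delta> (T h) \<kappa> (r * d)"
    unfolding gauss_top_def
  proof (intro conjI allI impI)
    show "gauss_ge \<delta> (T h) \<kappa>"
      unfolding gauss_ge_def Th by (intro allI val_sum_ge coeff_ge)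
    show "Fin (\<kappa> - nsm s \<delta>) < u (coeff (T h) s)" if "s > r * d" for s
      unfolding Th
    proof (intro val_sum_gt coeff_gt)
      fix i assume "i \<in> S"
      then have "r * i \<le> r * d" using d(2) by (intro mult_le_mono2)
      then show "r * i < s" using that by linarith
    qed
    have "d \<le> degree h" using d(1) \<open>S \<subseteq> _\<close> by auto
    then have "coeff (T h) (r * d) = coeff (T (t d)) (r * d) +
        (\<Sum>i\<in>{..degree h} - {d}. coeff (T (t i)) (r * d))"
      unfolding Th by (intro sum.remove) auto
    moreover have "u (coeff (T (t d)) (r * d)) = Fin (\<kappa> - nsm (r * d) \<delta>)"
    proof -
      have *: "\<nu> (t d) = Fin \<kappa>" using d(1) S by simp
      then have "qexp Q h d \<noteq> 0" by (auto simp: t_def)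
      from t[OF this] * show ?thesis by (auto simp: gauss_top_def)
    qed
    moreover have "Fin (\<kappa> - nsm (r * d) \<delta>) < u (\<Sum>i\<in>{..degree h} - {d}. coeff (T (t i)) (r * d))"
    proof (intro val_sum_gt coeff_gt)
      fix i assume "i \<in> {..degree h} - {d}" "i \<in> S"
      then have "i < d" using d(2)[of i] by auto
      then show "r * i < r * d" using Qtop(3) by simp
    qed
    ultimately show "u (coeff (T h) (r * d)) = Fin (\<kappa> - nsm (r * d) \<delta>)"
      by (simp add: val_add_eq)
  qed
  then show ?thesis using nuQ \<kappa> d_def by auto
qed

subsection \<open>Key polynomials and limit key polynomials\<close>

text \<open>A product modulo \<open>P\<close> may be computed from reduced representatives, so
  multiplicativity has to be checked for factors of degree below \<open>deg P\<close> alone; the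
  remainder itself is additive.\<close>

lemma ring_valuation_mod:
  fixes P :: "'k::field poly" and \<nu> :: "'k poly \<Rightarrow> 'g::linordered_ab_group_add extended"
  assumes "ring_valuation \<nu>" and P: "degree P \<ge> 1"
    and mult: "\<And>a b. a \<noteq> 0 \<Longrightarrow> b \<noteq> 0 \<Longrightarrow> degree a < degree P \<Longrightarrow> degree b < degree P \<Longrightarrow>
      \<nu> ((a * b) mod P) = \<nu> (a * b)"
  shows "ring_valuation (\<lambda>h. \<nu> (h mod P))"
proof -
  interpret nu: ring_valuation \<nu> by fact
  have deg: "degree (h mod P) < degree P" for h
    by (rule degree_mod_lt[OF P])
  show ?thesis
  proof
    show "\<nu> (1 mod P) = Fin 0" using P by (simp add: mod_poly_less)
  next
    fix x y
    have "\<nu> (x * y mod P) = \<nu> ((x mod P) * (y mod P) mod P)" by (simp add: mod_mult_eq)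
    also have "\<dots> = \<nu> ((x mod P) * (y mod P))"
      using mult[of "x mod P" "y mod P"] deg
      by (cases "x mod P = 0 \<or> y mod P = 0") auto
    finally show "\<nu> (x * y mod P) = \<nu> (x mod P) + \<nu> (y mod P)"
      by (simp add: nu.val_mult)
  qed (simp_all add: poly_mod_add_left nu.val_add)
qed

locale poly_valuation = ring_valuation \<nu>
  for \<nu> :: "'k::field poly \<Rightarrow> 'g::linordered_ab_group_add extended" +
  assumes divisible: "divisible_group TYPE('g)"
    and val_const: "a \<noteq> 0 \<Longrightarrow> \<nu> [:a:] \<noteq> Pinf"
begin

text \<open>For a key polynomial, \<open>\<delta>\<close> will be its level and \<open>r\<close> the
  largest order of a Hasse derivative attaining the maximum in the level. In this form no division
  in the value group remains.\<close>

definition gauss_key :: "'k poly \<Rightarrow> 'g \<Rightarrow> nat \<Rightarrow> 'g \<Rightarrow> bool" where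
  "gauss_key Q \<gamma> r \<delta> \<longleftrightarrow> degree Q \<ge> 1 \<and> \<nu> Q = Fin \<gamma> \<and> r \<ge> 1 \<and> gauss_top \<delta> (taylor Q) \<gamma> r \<and>
    (\<forall>g. g \<noteq> 0 \<longrightarrow> degree g < degree Q \<longrightarrow> (\<exists>a. \<nu> g = Fin a \<and> gauss_top \<delta> (taylor g) a 0))"

lemma gauss_keyD:
  assumes "gauss_key Q \<gamma> r \<delta>"
  shows "degree Q \<ge> 1" "\<nu> Q = Fin \<gamma>" "r \<ge> 1" "gauss_top \<delta> (taylor Q) \<gamma> r"
    "g \<noteq> 0 \<Longrightarrow> degree g < degree Q \<Longrightarrow> \<exists>a. \<nu> g = Fin a \<and> gauss_top \<delta> (taylor g) a 0"
  using assms by (auto simp: gauss_key_def)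

lemma gauss_key_nuQ:
  assumes "gauss_key Q \<gamma> r \<delta>" "h \<noteq> 0"
  shows "\<exists>\<kappa>. nuQ \<nu> Q h = Fin \<kappa> \<and> gauss_top \<delta> (taylor h) \<kappa> (r * degQ \<nu> Q h)"
  using gauss_keyD[OF assms(1)] assms(2)
  by (intro gauss_top_Q_expansion[OF ring_hom_taylor ring_valuation_axioms])

text \<open>A quotient \<open>(\<nu> f - \<nu> (hasse s f)) / s\<close> is at most
  \<open>\<delta>\<close> iff \<open>\<nu> (hasse s f)\<close> is at least
  \<open>\<nu> f - s \<delta>\<close>. With \<open>\<delta>\<close> the level of \<open>Q\<close>,
  these are the Gauss bounds for \<open>taylor Q\<close>; for a polynomial of smaller level they are
  strict for all \<open>s \<ge> 1\<close>, which is initial degree \<open>0\<close>.\<close>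

lemma key_poly_gauss_key:
  assumes key: "key_poly \<nu> Q" and deg: "degree Q \<ge> 1" and \<gamma>: "\<nu> Q = Fin \<gamma>"
  shows "\<exists>r \<delta>. gauss_key Q \<gamma> r \<delta>"
proof -
  define l where "l s = (case \<nu> (hasse s Q) of Fin b \<Rightarrow> Fin (ndiv s (\<gamma> - b)) | _ \<Rightarrow> Minf)" for s
  have level: "level \<nu> Q = Max (l ` {1..degree Q})"
    using deg \<gamma> by (simp add: level_def l_def)
  have fin: "finite (l ` {1..degree Q})" and ne: "l ` {1..degree Q} \<noteq> {}"
    using deg by auto
  \<comment> \<open>The derivative of order \<open>deg Q\<close> is the constant \<open>1\<close>,
    which keeps the level from being \<open>Minf\<close>.\<close>
  have "\<nu> (hasse (degree Q) Q) = Fin 0"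
    using key by (simp add: hasse_degree key_poly_def flip: one_pCons)
  then have "l (degree Q) = Fin (ndiv (degree Q) \<gamma>)" by (simp add: l_def)
  moreover have "l (degree Q) \<le> level \<nu> Q"
    unfolding level using deg fin by (intro Max_ge) auto
  moreover have "level \<nu> Q \<in> l ` {1..degree Q}"
    unfolding level by (rule Max_in[OF fin ne])
  ultimately obtain \<delta> s0 where \<delta>: "level \<nu> Q = Fin \<delta>" and s0: "s0 \<in> {1..degree Q}" "l s0 = Fin \<delta>"
    by (auto simp: l_def split: extended.splits)
  have *: "ndiv s x \<le> y \<longleftrightarrow> x \<le> nsm s y" "ndiv s x < y \<longleftrightarrow> x < nsm s y"
      "ndiv s x = y \<longleftrightarrow> x = nsm s y" if "s \<ge> 1" for s and x y :: 'g
    using nsm_ndiv[OF divisible, of s x] nsm_le_iff[of s "ndiv s x" y]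
      nsm_less_iff[of s "ndiv s x" y] nsm_eq_iff[of s "ndiv s x" y] that by auto
  have ge: "Fin (\<gamma> - nsm s \<delta>) \<le> \<nu> (hasse s Q)" for s
  proof -
    consider "s = 0" | "s \<in> {1..degree Q}" | "s > degree Q" by force
    then show ?thesis
    proof cases
      case 2
      then have "l s \<le> Fin \<delta>" using fin unfolding \<delta>[symmetric] level by (intro Max_ge) auto
      then show ?thesis using 2 *(1)[of s]
        by (cases "hasse s Q" rule: val_cases) (auto simp: l_def algebra_simps)
    qed (auto simp: \<gamma> hasse_eq_0)
  qed
  define E where "E = {s \<in> {1..degree Q}. \<nu> (hasse s Q) = Fin (\<gamma> - nsm s \<delta>)}"
  define r where "r = Max E"
  have "s0 \<in> E" using s0 *(3)[of s0]
    by (cases "hasse s0 Q" rule: val_cases) (auto simp: l_def E_def algebra_simps)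
  moreover have "finite E" by (simp add: E_def)
  ultimately have r: "r \<in> E" "\<And>s. s \<in> E \<Longrightarrow> s \<le> r" unfolding r_def by (auto intro: Max_in)
  have 1: "r \<ge> 1" using r by (auto simp: E_def)
  have 2: "gauss_top \<delta> (taylor Q) \<gamma> r"
    unfolding gauss_top_def gauss_ge_def hasse_taylor[symmetric]
  proof (intro conjI allI impI ge)
    show "\<nu> (hasse r Q) = Fin (\<gamma> - nsm r \<delta>)" using r by (simp add: E_def)
    fix s assume s: "s > r"
    show "Fin (\<gamma> - nsm s \<delta>) < \<nu> (hasse s Q)"
    proof (cases "s \<le> degree Q")
      case True
      then have "\<nu> (hasse s Q) \<noteq> Fin (\<gamma> - nsm s \<delta>)"
        using r(2)[of s] s 1 by (auto simp: E_def)
      then show ?thesis using ge[of s] by simp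
    qed (simp add: hasse_eq_0)
  qed
  have 3: "\<exists>a. \<nu> g = Fin a \<and> gauss_top \<delta> (taylor g) a 0" if g: "g \<noteq> 0" "degree g < degree Q" for g
  proof -
    have lv: "level \<nu> g < Fin \<delta>"
      using key g unfolding key_poly_def \<delta>[symmetric] by blast
    \<comment> \<open>A nonconstant polynomial of infinite value has level \<open>Pinf\<close> by
      convention, which \<open>lv\<close> excludes; nonzero constants are covered by
      \<open>val_const\<close>.\<close>
    obtain a where a: "\<nu> g = Fin a"
    proof (cases "degree g = 0")
      case True
      then obtain c where "g = [:c:]" "c \<noteq> 0" using g by (auto elim: degree_eq_zeroE)
      then show thesis using that val_const by (cases g rule: val_cases) auto
    next
      case False
      then show thesis using that lv
        by (cases g rule: val_cases) (auto simp: level_def)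
    qed
    have gt: "Fin (a - nsm s \<delta>) < \<nu> (hasse s g)" if s: "s \<ge> 1" for s
    proof (cases "s \<le> degree g")
      case True
      define l' where "l' s = (case \<nu> (hasse s g) of Fin b \<Rightarrow> Fin (ndiv s (a - b)) | _ \<Rightarrow> Minf)" for s
      have "l' s \<le> level \<nu> g"
        using True s a by (auto simp: level_def l'_def intro!: Max_ge)
      then have "l' s < Fin \<delta>" using lv by (rule le_less_trans)
      then show ?thesis using s *(2)[of s]
        by (cases "hasse s g" rule: val_cases) (auto simp: l'_def algebra_simps)
    qed (simp add: hasse_eq_0)
    have ge: "Fin (a - nsm s \<delta>) \<le> \<nu> (hasse s g)" for s
      using gt[of s] a by (cases "s = 0") (auto simp: less_imp_le)
    have "gauss_top \<delta> (taylor g) a 0"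
      unfolding gauss_top_def gauss_ge_def hasse_taylor[symmetric]
      using ge gt a by simp
    with a show ?thesis by blast
  qed
  from deg \<gamma> 1 2 3 show ?thesis unfolding gauss_key_def by blast
qed

text \<open>If \<open>a b = q Q + r\<close> with \<open>q \<noteq> 0\<close>, the initial form of \<open>q Q\<close> has positive degree while those of
  \<open>a b\<close> and \<open>r\<close> have degree \<open>0\<close>, so \<open>q Q\<close> must have larger value than one of them.\<close>

lemma key_poly_val_mod:
  assumes key: "key_poly \<nu> Q" and deg: "degree Q \<ge> 1" and \<gamma>: "\<nu> Q = Fin \<gamma>"
    and a: "a \<noteq> 0" "degree a < degree Q" and b: "b \<noteq> 0" "degree b < degree Q"
  shows "\<nu> ((a * b) mod Q) = \<nu> (a * b)"
proof (rule ccontr)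
  assume neq: "\<nu> ((a * b) mod Q) \<noteq> \<nu> (a * b)"
  obtain r \<delta> where *: "gauss_key Q \<gamma> r \<delta>"
    using key_poly_gauss_key[OF key deg \<gamma>] by blast
  note r = gauss_keyD(3)[OF *] and Qt = gauss_keyD(4)[OF *] and small = gauss_keyD(5)[OF *]
  interpret T: ring_hom_map "taylor :: 'k poly \<Rightarrow> _" by (rule ring_hom_taylor)
  define q where "q = (a * b) div Q"
  define c where "c = (a * b) mod Q"
  have Q0: "Q \<noteq> 0" using deg by auto
  have qQ: "q * Q = a * b - c" by (simp add: q_def c_def minus_mod_eq_div_mult)
  have "q \<noteq> 0"
  proof
    assume "q = 0"
    then have "a * b = c" using qQ by simp
    then show False using neq by (simp add: c_def)
  qed
  have "degree q < degree Q"
  proof -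
    have "degree c < degree Q" by (simp add: c_def degree_mod_lt[OF deg])
    moreover have "degree q + degree Q = degree (q * Q)" using \<open>q \<noteq> 0\<close> Q0 by (simp add: degree_mult_eq)
    moreover have "degree (q * Q) \<le> max (degree (a * b)) (degree c)"
      unfolding qQ by (rule degree_diff_le_max)
    moreover have "degree (a * b) \<le> degree a + degree b" by (rule degree_mult_le)
    ultimately show ?thesis using a b by linarith
  qed
  obtain va where va: "\<nu> a = Fin va" "gauss_top \<delta> (taylor a) va 0" using small[OF a] by blast
  obtain vb where vb: "\<nu> b = Fin vb" "gauss_top \<delta> (taylor b) vb 0" using small[OF b] by blast
  obtain vq where vq: "\<nu> q = Fin vq" "gauss_top \<delta> (taylor q) vq 0"
    using small[OF \<open>q \<noteq> 0\<close> \<open>degree q < degree Q\<close>] by blast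
  have ab: "\<nu> (a * b) = Fin (va + vb)" "gauss_top \<delta> (taylor (a * b)) (va + vb) 0"
    using gauss_top_mult[OF va(2) vb(2)] val_mult_Fin[OF va(1) vb(1)] by (simp_all add: T.hom_mult)
  have qQv: "\<nu> (q * Q) = Fin (vq + \<gamma>)" "gauss_top \<delta> (taylor (q * Q)) (vq + \<gamma>) r"
    using gauss_top_mult[OF vq(2) Qt] val_mult_Fin[OF vq(1) \<gamma>] by (simp_all add: T.hom_mult)
  \<comment> \<open>As the two values differ, there is no cancellation in \<open>a * b - c\<close>,
    and the value of \<open>q * Q\<close> bounds both from below.\<close>
  have eq: "Fin (vq + \<gamma>) = min (\<nu> (a * b)) (\<nu> c)"
    unfolding qQv(1)[symmetric] qQ by (rule val_diff_neq) (use neq c_def in auto)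
  have "Fin (vq + \<gamma> - nsm r \<delta>) < \<nu> (coeff (taylor (a * b)) r)"
  proof (rule le_less_trans)
    show "Fin (vq + \<gamma> - nsm r \<delta>) \<le> Fin (va + vb - nsm r \<delta>)"
      using eq ab(1) by (metis diff_right_mono less_eq_extended.simps(1) min.cobounded1)
    show "Fin (va + vb - nsm r \<delta>) < \<nu> (coeff (taylor (a * b)) r)"
      using gauss_topD(3)[OF ab(2)] r by simp
  qed
  moreover have "Fin (vq + \<gamma> - nsm r \<delta>) < \<nu> (coeff (taylor c) r)"
  proof (cases "c = 0")
    case False
    then obtain vc where vc: "\<nu> c = Fin vc" "gauss_top \<delta> (taylor c) vc 0"
      using small[of c] degree_mod_lt[OF deg] unfolding c_def by blast
    show ?thesis
    proof (rule le_less_trans)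
      show "Fin (vq + \<gamma> - nsm r \<delta>) \<le> Fin (vc - nsm r \<delta>)"
        using eq vc(1) by (metis diff_right_mono less_eq_extended.simps(1) min.cobounded2)
      show "Fin (vc - nsm r \<delta>) < \<nu> (coeff (taylor c) r)"
        using gauss_topD(3)[OF vc(2)] r by simp
    qed
  qed simp
  ultimately have "Fin (vq + \<gamma> - nsm r \<delta>) < \<nu> (coeff (taylor (q * Q)) r)"
    unfolding qQ T.hom_diff coeff_diff by (rule val_diff_gt)
  then show False using gauss_topD(2)[OF qQv(2)] by simp
qed

end

locale limit_key_poly = poly_valuation \<nu>
  for \<nu> :: "'k::field poly \<Rightarrow> 'g::linordered_ab_group_add extended" +
  fixes \<Q> :: "'k poly set" and m :: nat and f :: "'k poly"
  assumes m_pos: "m \<ge> 1"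
    and \<Q>_key: "Q \<in> \<Q> \<Longrightarrow> key_poly \<nu> Q" and \<Q>_deg: "Q \<in> \<Q> \<Longrightarrow> degree Q = m"
    and \<Q>_fin: "Q \<in> \<Q> \<Longrightarrow> \<nu> Q \<noteq> Pinf" and \<Q>_ne: "\<Q> \<noteq> {}"
    and f_limit: "f \<in> limit_key_polys \<nu> \<Q>"
begin

lemma \<Q>_gauss_key:
  assumes "Q \<in> \<Q>"
  obtains \<gamma> r \<delta> where "gauss_key Q \<gamma> r \<delta>"
proof -
  obtain \<gamma> where "\<nu> Q = Fin \<gamma>" using \<Q>_fin[OF assms] by (cases Q rule: val_cases) auto
  then show thesis
    using key_poly_gauss_key[of Q \<gamma>] \<Q>_key \<Q>_deg assms m_pos that by auto
qed

lemma f_monic: "lead_coeff f = 1" and f_unstable: "\<not> stable \<nu> \<Q> f"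
  and f_minimal: "degree g < degree f \<Longrightarrow> stable \<nu> \<Q> g"
  using f_limit by (auto simp: limit_key_polys_def not_le[symmetric])

lemma f_nonzero: "f \<noteq> 0"
  using f_monic by auto

text \<open>Below degree \<open>m\<close> a polynomial is its own \<open>Q\<close>-expansion, so it
  is stable.\<close>

lemma degree_f: "m \<le> degree f"
proof (rule ccontr)
  assume "\<not> m \<le> degree f"
  have "nuQ \<nu> Q f = \<nu> f" if "Q \<in> \<Q>" for Q
  proof -
    have deg: "degree Q \<ge> 1" "degree f < degree Q"
      using \<Q>_deg[OF that] m_pos \<open>\<not> m \<le> degree f\<close> by auto
    have "nuQ \<nu> Q f = Min ((\<lambda>i. if i = 0 then \<nu> f else Pinf) ` {..degree f})"
      unfolding nuQ_def by (rule arg_cong[of _ _ Min], rule image_cong) (auto simp: qexp_small[OF deg])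
    also have "\<dots> = \<nu> f"
      by (rule Min_eqI) auto
    finally show ?thesis .
  qed
  then have "stable \<nu> \<Q> f" using \<Q>_ne by (auto simp: stable_def)
  then show False using f_unstable by simp
qed

text \<open>The Gauss bound at \<open>s = 0\<close> concerns the constant Taylor coefficient, which
  is \<open>h\<close> itself.\<close>

lemma nuQ_le_val:
  assumes "Q \<in> \<Q>" "h \<noteq> 0"
  shows "nuQ \<nu> Q h \<le> \<nu> h"
proof -
  obtain \<gamma> r \<delta> where "gauss_key Q \<gamma> r \<delta>"
    using \<Q>_gauss_key[OF assms(1)] .
  from gauss_key_nuQ[OF this assms(2)] obtain \<kappa> where "nuQ \<nu> Q h = Fin \<kappa>" "gauss_ge \<delta> (taylor h) \<kappa>" by (auto simp: gauss_top_def)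
  then have "Fin (\<kappa> - nsm 0 \<delta>) \<le> \<nu> (coeff (taylor h) 0)" unfolding gauss_ge_def by blast
  with \<open>nuQ \<nu> Q h = Fin \<kappa>\<close> show ?thesis by (simp flip: hasse_taylor)
qed

lemma unstable_above:
  assumes "Q0 \<in> \<Q>"
  obtains Q where "Q \<in> \<Q>" "\<nu> Q0 \<le> \<nu> Q" "nuQ \<nu> Q f < \<nu> f"
proof -
  obtain Q where "Q \<in> \<Q>" "\<nu> Q0 \<le> \<nu> Q" "nuQ \<nu> Q f \<noteq> \<nu> f"
    using f_unstable assms unfolding stable_def by blast
  with nuQ_le_val[OF _ f_nonzero] show thesis using that by (metis order_le_imp_less_or_eq)
qed

text \<open>Final segments of \<open>\<Q>\<close> are nested, so finitely many stability conditions
  hold from a common point on. Multiplicativity modulo \<open>f\<close> requires this for four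
  polynomials at once.\<close>

lemma stable_set:
  assumes "finite G" "\<And>g. g \<in> G \<Longrightarrow> degree g < degree f"
  obtains Q0 where "Q0 \<in> \<Q>" "\<And>Q g. Q \<in> \<Q> \<Longrightarrow> \<nu> Q0 \<le> \<nu> Q \<Longrightarrow> g \<in> G \<Longrightarrow> nuQ \<nu> Q g = \<nu> g"
proof -
  have "\<exists>Q0\<in>\<Q>. \<forall>Q\<in>\<Q>. \<nu> Q0 \<le> \<nu> Q \<longrightarrow> (\<forall>g\<in>G. nuQ \<nu> Q g = \<nu> g)"
    using assms
  proof (induction G)
    case empty
    then show ?case using \<Q>_ne by auto
  next
    case (insert g G)
    then obtain Q0 where Q0: "Q0 \<in> \<Q>" "\<forall>Q\<in>\<Q>. \<nu> Q0 \<le> \<nu> Q \<longrightarrow> (\<forall>g\<in>G. nuQ \<nu> Q g = \<nu> g)" by auto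
    have "stable \<nu> \<Q> g" using insert.prems by (intro f_minimal) auto
    then obtain Q1 where Q1: "Q1 \<in> \<Q>" "\<forall>Q\<in>\<Q>. \<nu> Q1 \<le> \<nu> Q \<longrightarrow> nuQ \<nu> Q g = \<nu> g"
      by (auto simp: stable_def)
    show ?case
    proof (cases "\<nu> Q0 \<le> \<nu> Q1")
      case True
      with Q0 Q1 show ?thesis by (intro bexI[of _ Q1]) (auto intro: order_trans)
    next
      case False
      with Q0 Q1 show ?thesis by (intro bexI[of _ Q0]) (auto intro: order_trans)
    qed
  qed
  then show thesis using that by blast
qed

text \<open>Stability equates the value with one of \<open>nuQ\<close>, and the latter is finite on
  nonzero polynomials.\<close>

lemma val_finite:
  assumes "g \<noteq> 0" "degree g < degree f"
  shows "\<nu> g \<noteq> Pinf"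
proof -
  obtain Q0 where "Q0 \<in> \<Q>" "nuQ \<nu> Q0 g = \<nu> g"
    using stable_set[of "{g}"] assms by (metis finite.emptyI finite.insertI order_refl singletonD singletonI)
  then show ?thesis using \<Q>_gauss_key[of Q0] gauss_key_nuQ assms(1) by (metis extended.distinct(1))
qed

lemma stable_gauss_ge:
  assumes key: "gauss_key Q \<gamma> r \<delta>" and stab: "nuQ \<nu> Q h = \<nu> h" and ge: "Fin \<kappa> \<le> \<nu> h"
  shows "gauss_ge \<delta> (taylor h) \<kappa>"
proof (cases "h = 0")
  case True
  then show ?thesis by (simp add: taylor_def)
next
  case False
  then obtain \<kappa>' where "\<nu> h = Fin \<kappa>'" "gauss_top \<delta> (taylor h) \<kappa>' (r * degQ \<nu> Q h)"
    using gauss_key_nuQ[OF key] stab by metis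
  then show ?thesis using ge by (auto intro: gauss_ge_mono[OF gauss_topD(1)])
qed

text \<open>Let \<open>a * b = q * f + c\<close>. If reduction changed the value,
  \<open>q * f\<close> would have value \<open>min (\<nu> (a * b)) (\<nu> c)\<close>. Take
  \<open>Q\<close> so far out that \<open>a\<close>, \<open>b\<close>, \<open>c\<close>,
  \<open>q\<close> are stable, but with \<open>nuQ \<nu> Q f < \<nu> f\<close>. There
  \<open>a * b\<close> and \<open>c\<close> have Gauss value at least this minimum, hence so does
  \<open>q * f\<close>; cancelling the value of \<open>q\<close> gives
  \<open>\<nu> f \<le> nuQ \<nu> Q f\<close>.\<close>

lemma limit_val_mod:
  assumes a: "a \<noteq> 0" "degree a < degree f" and b: "b \<noteq> 0" "degree b < degree f"
  shows "\<nu> ((a * b) mod f) = \<nu> (a * b)"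
proof (rule ccontr)
  assume neq: "\<nu> ((a * b) mod f) \<noteq> \<nu> (a * b)"
  interpret T: ring_hom_map "taylor :: 'k poly \<Rightarrow> _" by (rule ring_hom_taylor)
  define q where "q = (a * b) div f"
  define c where "c = (a * b) mod f"
  have qf: "q * f = a * b - c" by (simp add: q_def c_def minus_mod_eq_div_mult)
  have deg: "degree f \<ge> 1" using degree_f m_pos by simp
  have "q \<noteq> 0"
  proof
    assume "q = 0"
    then have "a * b = c" using qf by simp
    then show False using neq by (simp add: c_def)
  qed
  have degc: "degree c < degree f" by (simp add: c_def degree_mod_lt[OF deg])
  have degq: "degree q < degree f"
  proof -
    have "degree q + degree f = degree (q * f)" using \<open>q \<noteq> 0\<close> f_nonzero by (simp add: degree_mult_eq)
    moreover have "degree (q * f) \<le> max (degree (a * b)) (degree c)"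
      unfolding qf by (rule degree_diff_le_max)
    moreover have "degree (a * b) \<le> degree a + degree b" by (rule degree_mult_le)
    ultimately show ?thesis using a b degc by linarith
  qed
  obtain Q0 where Q0: "Q0 \<in> \<Q>"
    "\<And>Q g. Q \<in> \<Q> \<Longrightarrow> \<nu> Q0 \<le> \<nu> Q \<Longrightarrow> g \<in> {a, b, c, q} \<Longrightarrow> nuQ \<nu> Q g = \<nu> g"
    by (rule stable_set[of "{a, b, c, q}"]) (use a b degc degq in auto)
  obtain Q where Q: "Q \<in> \<Q>" "\<nu> Q0 \<le> \<nu> Q" "nuQ \<nu> Q f < \<nu> f"
    using unstable_above[OF Q0(1)] .
  obtain \<gamma> r \<delta> where key: "gauss_key Q \<gamma> r \<delta>"
    using \<Q>_gauss_key[OF Q(1)] .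
  note t = gauss_key_nuQ[OF key]
  note st = Q0(2)[OF Q(1,2)]
  obtain va where va: "\<nu> a = Fin va" "gauss_top \<delta> (taylor a) va (r * degQ \<nu> Q a)"
    using t[OF a(1)] st[of a] by auto
  obtain vb where vb: "\<nu> b = Fin vb" "gauss_top \<delta> (taylor b) vb (r * degQ \<nu> Q b)"
    using t[OF b(1)] st[of b] by auto
  obtain vq where vq: "\<nu> q = Fin vq" "gauss_top \<delta> (taylor q) vq (r * degQ \<nu> Q q)"
    using t[OF \<open>q \<noteq> 0\<close>] st[of q] by auto
  obtain vf where vf: "nuQ \<nu> Q f = Fin vf" "gauss_top \<delta> (taylor f) vf (r * degQ \<nu> Q f)"
    using t[OF f_nonzero] by auto
  have ab: "\<nu> (a * b) = Fin (va + vb)" "gauss_ge \<delta> (taylor (a * b)) (va + vb)"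
    using gauss_topD(1)[OF gauss_top_mult[OF va(2) vb(2)]] val_mult_Fin[OF va(1) vb(1)]
    by (simp_all add: T.hom_mult)
  have eq: "\<nu> (q * f) = min (\<nu> (a * b)) (\<nu> c)"
    unfolding qf by (rule val_diff_neq) (use neq c_def in auto)
  then have "\<nu> (q * f) \<le> Fin (va + vb)" using ab(1) by simp
  then obtain \<kappa> where \<kappa>: "\<nu> (q * f) = Fin \<kappa>"
    by (cases "q * f" rule: val_cases) auto
  then have le: "Fin \<kappa> \<le> \<nu> (a * b)" "Fin \<kappa> \<le> \<nu> c"
    using eq unfolding \<kappa> by (metis min.cobounded1, metis min.cobounded2)
  have "gauss_ge \<delta> (taylor (q * f)) \<kappa>"
    unfolding qf T.hom_diff
    by (intro gauss_ge_diff gauss_ge_mono[OF ab(2)] stable_gauss_ge[OF key])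
      (use le ab(1) st[of c] in auto)
  then have "\<kappa> \<le> vq + vf"
    using gauss_top_mult[OF vq(2) vf(2)] by (auto simp: T.hom_mult intro: gauss_top_ge_le)
  \<comment> \<open>A limit key polynomial may lie in the support of \<open>\<nu>\<close>; in the
    situation to be refuted its value is finite because that of \<open>q * f\<close> is.\<close>
  moreover have "\<nu> f = Fin (\<kappa> - vq)"
    using \<kappa> vq(1) by (cases f rule: val_cases) (auto simp: val_mult)
  ultimately show False using Q(3) vf(1) by (simp add: algebra_simps)
qed

text \<open>For \<open>m < degree f\<close> the remainder is \<open>Q\<close>. For equal degrees,
  compare \<open>f\<close> with some \<open>R\<close> of value at least \<open>\<nu> Q\<close> at
  which \<open>nuQ\<close> is too small on \<open>f\<close>: if \<open>f - R\<close> had value below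
  \<open>\<nu> R\<close>, that value would be \<open>\<nu> f\<close> and also a Gauss bound for
  \<open>f\<close>, a contradiction. So \<open>f - R\<close> and \<open>Q - R\<close> both have
  value at least \<open>\<nu> Q\<close>.\<close>

lemma val_mod_f_ge:
  assumes Q: "Q \<in> \<Q>"
  shows "\<nu> Q \<le> \<nu> (Q mod f)"
proof (cases "m < degree f")
  case True
  then show ?thesis using \<Q>_deg[OF Q] by (simp add: mod_poly_less)
next
  case False
  then have degf: "degree f = m" using degree_f by simp
  interpret T: ring_hom_map "taylor :: 'k poly \<Rightarrow> _" by (rule ring_hom_taylor)
  obtain R where R: "R \<in> \<Q>" "\<nu> Q \<le> \<nu> R" "nuQ \<nu> R f < \<nu> f"
    using unstable_above[OF Q] .
  obtain \<gamma> r \<delta> where key: "gauss_key R \<gamma> r \<delta>"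
    using \<Q>_gauss_key[OF R(1)] .
  note \<gamma> = gauss_keyD(2)[OF key] and Rt = gauss_keyD(4)[OF key]
    and small = gauss_keyD(5)[OF key, unfolded \<Q>_deg[OF R(1)]] and t = gauss_key_nuQ[OF key]
  have monic: "lead_coeff Q = 1" "lead_coeff R = 1"
    using \<Q>_key[OF Q] \<Q>_key[OF R(1)] by (auto simp: key_poly_def)
  have lt: "degree (p - f) < m" if "degree p = m" "lead_coeff p = 1" for p
  proof -
    have "degree (p - f) \<noteq> m"
    proof
      assume *: "degree (p - f) = m"
      then have "lead_coeff (p - f) = 0"
        using that degf f_monic by simp
      then have "p - f = 0" by (simp only: leading_coeff_0_iff)
      then have "degree (p - f) = 0" by simp
      then show False using * m_pos by linarith
    qed
    moreover have "degree (p - f) \<le> m" using degree_diff_le_max[of p f] that degf by simp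
    ultimately show ?thesis by simp
  qed
  define a where "a = f - R"
  have dega: "degree a < m" using lt[of R] \<Q>_deg[OF R(1)] monic
    unfolding a_def by (metis degree_minus minus_diff_eq)
  have "Fin \<gamma> \<le> \<nu> a"
  proof (rule ccontr)
    assume "\<not> Fin \<gamma> \<le> \<nu> a"
    then have lta: "\<nu> a < \<nu> R" by (simp add: \<gamma>)
    then have "a \<noteq> 0" by auto
    then obtain va where va: "\<nu> a = Fin va" "gauss_top \<delta> (taylor a) va 0" using small dega by blast
    have f: "f = a + R" by (simp add: a_def)
    have vf: "\<nu> f = Fin va" unfolding f using val_add_eq[OF lta] va by simp
    have "gauss_ge \<delta> (taylor f) va"
      unfolding f T.hom_add
      by (intro gauss_ge_add gauss_topD(1)[OF va(2)] gauss_ge_mono[OF gauss_topD(1)[OF Rt]])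
        (use lta \<gamma> va in auto)
    moreover obtain \<kappa> where "nuQ \<nu> R f = Fin \<kappa>" "gauss_top \<delta> (taylor f) \<kappa> (r * degQ \<nu> R f)"
      using t[OF f_nonzero] by blast
    ultimately show False using R(3) vf gauss_top_ge_le by force
  qed
  then have "\<nu> Q \<le> \<nu> (Q - R - a)"
    using R(2) \<gamma> by (intro val_diff_ge) auto
  \<comment> \<open>Both polynomials are monic of degree \<open>m\<close>, so the quotient is
    \<open>1\<close>.\<close>
  moreover have "Q mod f = Q - R - a"
  proof -
    have "degree (Q - f) < degree f" using lt[of Q] \<Q>_deg[OF Q] monic degf by simp
    then have "(Q - f + f) mod f = Q - f" by (simp only: mod_add_self2 mod_poly_less)
    then show ?thesis by (simp add: a_def)
  qed
  ultimately show ?thesis by simp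
qed

end

subsection \<open>Conjugation in an algebraic closure\<close>

locale alg_closed_ext = ring_hom_map \<iota>
  for \<iota> :: "'k::field \<Rightarrow> 'e::alg_closed_field" +
  assumes algebraic: "\<exists>p. p \<noteq> 0 \<and> poly (map_poly \<iota> p) x = 0"
begin

abbreviation lift :: "'k poly \<Rightarrow> 'e poly" where "lift \<equiv> map_poly \<iota>"

lemma emb_eq_0_iff [simp]: "\<iota> x = 0 \<longleftrightarrow> x = 0"
proof
  assume "\<iota> x = 0"
  show "x = 0"
  proof (rule ccontr)
    assume "x \<noteq> 0"
    then have "\<iota> (x * inverse x) = 1" by simp
    then show False using \<open>\<iota> x = 0\<close> by (simp add: hom_mult)
  qed
qed simp

lemma emb_eq_iff [simp]: "\<iota> x = \<iota> y \<longleftrightarrow> x = y"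
  using emb_eq_0_iff[of "x - y"] by (simp add: hom_diff)

lemma emb_inverse: "\<iota> (inverse x) = inverse (\<iota> x)"
proof (cases "x = 0")
  case False
  have "\<iota> x * \<iota> (inverse x) = 1" using False by (simp flip: hom_mult)
  then show ?thesis by (metis inverse_unique)
qed simp

lemma emb_divide: "\<iota> (x / y) = \<iota> x / \<iota> y"
  by (simp add: divide_inverse hom_mult emb_inverse)

lemma degree_lift [simp]: "degree (lift p) = degree p"
  by (rule degree_map_poly) simp

lemma lift_eq_0_iff [simp]: "lift p = 0 \<longleftrightarrow> p = 0"
  by (rule map_poly_eq_0_iff) auto

lemma coeff_lift [simp]: "coeff (lift p) i = \<iota> (coeff p i)"
  by (simp add: coeff_map_poly)

lemma ring_hom_lift: "ring_hom_map lift"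
  by (rule map_poly_ring_hom)

definition is_minpoly :: "'k poly \<Rightarrow> 'e \<Rightarrow> bool" where
  "is_minpoly p x \<longleftrightarrow> lead_coeff p = 1 \<and> poly (lift p) x = 0 \<and>
     (\<forall>q. poly (lift q) x = 0 \<longrightarrow> p dvd q)"

lemma is_minpolyD:
  assumes "is_minpoly p x"
  shows "lead_coeff p = 1" "poly (lift p) x = 0" "poly (lift q) x = 0 \<longleftrightarrow> p dvd q"
proof -
  show *: "lead_coeff p = 1" "poly (lift p) x = 0" using assms by (auto simp: is_minpoly_def)
  have "poly (lift q) x = 0" if "p dvd q"
    using that * by (auto simp: map_poly_hom_mult)
  then show "poly (lift q) x = 0 \<longleftrightarrow> p dvd q" using assms by (auto simp: is_minpoly_def)
qed

lemma minpoly_exists: "\<exists>p. is_minpoly p x"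
proof -
  define R where "R p \<longleftrightarrow> p \<noteq> 0 \<and> poly (lift p) x = 0" for p
  obtain p where p: "R p" "\<And>q. R q \<Longrightarrow> degree p \<le> degree q"
    using ex_has_least_nat[of R _ degree] algebraic[of x] unfolding R_def by blast
  define p' where "p' = smult (inverse (lead_coeff p)) p"
  have "p \<noteq> 0" using p(1) by (simp add: R_def)
  have "p' dvd q" if q: "poly (lift q) x = 0" for q
  proof -
    have "lift q = lift (q div p) * lift p + lift (q mod p)"
      by (simp flip: map_poly_hom_mult map_poly_hom_add)
    then have "poly (lift (q mod p)) x = 0" using q p(1) by (simp add: R_def)
    then have "q mod p = 0"
      using p(2)[of "q mod p"] degree_mod_less[OF \<open>p \<noteq> 0\<close>, of q] by (force simp: R_def)
    then show ?thesis using \<open>p \<noteq> 0\<close> by (simp add: p'_def smult_dvd_iff mod_eq_0_iff_dvd)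
  qed
  moreover have "lead_coeff p' = 1" using \<open>p \<noteq> 0\<close> by (simp add: p'_def)
  moreover have "poly (lift p') x = 0"
    using p(1) by (simp add: p'_def R_def map_poly_smult hom_mult)
  ultimately show ?thesis by (auto simp: is_minpoly_def)
qed

lemma minpoly_degree: "is_minpoly p x \<Longrightarrow> degree p \<ge> 1"
proof (rule ccontr)
  assume p: "is_minpoly p x" and "\<not> degree p \<ge> 1"
  then obtain c where "p = [:c:]" by (metis One_nat_def degree_eq_zeroE less_one not_le)
  then have "p = 1" using is_minpolyD(1)[OF p] by (simp add: one_pCons)
  then show False using is_minpolyD(2)[OF p] by simp
qed

text \<open>Let \<open>p = q * s\<close> with \<open>q\<close> the minimal polynomial of
  \<open>y\<close>. The degree of \<open>s\<close> is too small for \<open>x\<close> to be a root of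
  it, so \<open>x\<close> is a root of \<open>q\<close>, and \<open>p\<close> and \<open>q\<close>
  divide each other.\<close>

lemma minpoly_conj:
  assumes p: "is_minpoly p x" and y: "poly (lift p) y = 0"
  shows "is_minpoly p y"
proof -
  obtain q where q: "is_minpoly q y" using minpoly_exists by blast
  have "q dvd p" using is_minpolyD(3)[OF q] y by blast
  then obtain s where s: "p = q * s" ..
  have ne: "p \<noteq> 0" "q \<noteq> 0" "s \<noteq> 0" using is_minpolyD(1)[OF p] s by auto
  have "poly (lift q) x = 0 \<or> poly (lift s) x = 0"
    using is_minpolyD(2)[OF p] by (simp add: s map_poly_hom_mult)
  then have "p dvd q"
  proof
    assume "poly (lift s) x = 0"
    then have "p dvd s" using is_minpolyD(3)[OF p] by blast
    then have "degree p \<le> degree s" using ne by (intro dvd_imp_degree_le)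
    then show ?thesis using ne minpoly_degree[OF q] by (simp add: s degree_mult_eq)
  qed (use is_minpolyD(3)[OF p] in blast)
  then show ?thesis
    using is_minpolyD(1)[OF p] y is_minpolyD(3)[OF q] dvd_trans by (auto simp: is_minpoly_def)
qed

lemma minpoly_coeff_0: "is_minpoly p x \<Longrightarrow> x \<noteq> 0 \<Longrightarrow> coeff p 0 \<noteq> 0"
proof
  assume p: "is_minpoly p x" and "x \<noteq> 0" "coeff p 0 = 0"
  then obtain q where q: "p = pCons 0 q" by (metis coeff_pCons_0 pCons_cases)
  then have "poly (lift q) x = 0" using is_minpolyD(2)[OF p] \<open>x \<noteq> 0\<close> by (simp add: map_poly_pCons)
  then have "p dvd q" using is_minpolyD(3)[OF p] by blast
  moreover have "q \<noteq> 0" using q is_minpolyD(1)[OF p] by auto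
  ultimately have "degree p \<le> degree q" by (intro dvd_imp_degree_le)
  then show False using q \<open>q \<noteq> 0\<close> by simp
qed

text \<open>Graphs of \<open>K\<close>-homomorphisms defined on a subring of the algebraic closure.\<close>

definition partial_hom :: "('e \<times> 'e) set \<Rightarrow> bool" where
  "partial_hom G \<longleftrightarrow> (\<forall>c. (\<iota> c, \<iota> c) \<in> G) \<and>
    (\<forall>a b c d. (a, b) \<in> G \<longrightarrow> (c, d) \<in> G \<longrightarrow> (a + c, b + d) \<in> G \<and> (a * c, b * d) \<in> G) \<and>
    (\<forall>b. (0, b) \<in> G \<longrightarrow> b = 0)"

definition poly_rel :: "('e \<times> 'e) set \<Rightarrow> 'e poly \<Rightarrow> 'e poly \<Rightarrow> bool" where
  "poly_rel G p q \<longleftrightarrow> (\<forall>i. (coeff p i, coeff q i) \<in> G)"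

context
  fixes G assumes G: "partial_hom G"
begin

lemma ph_const: "(\<iota> k, \<iota> k) \<in> G"
  and ph_add: "(a, b) \<in> G \<Longrightarrow> (c, d) \<in> G \<Longrightarrow> (a + c, b + d) \<in> G"
  and ph_mult: "(a, b) \<in> G \<Longrightarrow> (c, d) \<in> G \<Longrightarrow> (a * c, b * d) \<in> G"
  and ph_zero: "(0, b) \<in> G \<Longrightarrow> b = 0"
  using G unfolding partial_hom_def by blast+

lemma ph_0: "(0, 0) \<in> G" and ph_1: "(1, 1) \<in> G"
  using ph_const[of 0] ph_const[of 1] by simp_all

lemma ph_uminus: "(a, b) \<in> G \<Longrightarrow> (- a, - b) \<in> G"
  using ph_mult[OF ph_const[of "- 1"]] by (force simp: hom_uminus)

lemma ph_diff: "(a, b) \<in> G \<Longrightarrow> (c, d) \<in> G \<Longrightarrow> (a - c, b - d) \<in> G"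
  using ph_add[OF _ ph_uminus] by force

lemma ph_unique: "(a, b) \<in> G \<Longrightarrow> (a, c) \<in> G \<Longrightarrow> b = c"
  using ph_diff[of a b a c] ph_zero by force

lemma ph_power: "(a, b) \<in> G \<Longrightarrow> (a ^ n, b ^ n) \<in> G"
  by (induction n) (auto intro: ph_1 ph_mult)

lemma ph_sum: "(\<And>i. i \<in> A \<Longrightarrow> (g i, h i) \<in> G) \<Longrightarrow> (sum g A, sum h A) \<in> G"
  by (induction A rule: infinite_finite_induct) (auto intro: ph_0 ph_add)

lemma poly_rel_lift: "poly_rel G (lift p) (lift p)"
  by (simp add: poly_rel_def ph_const)

lemma poly_rel_diff: "poly_rel G p p' \<Longrightarrow> poly_rel G q q' \<Longrightarrow> poly_rel G (p - q) (p' - q')"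
  by (simp add: poly_rel_def ph_diff)

lemma poly_rel_add: "poly_rel G p p' \<Longrightarrow> poly_rel G q q' \<Longrightarrow> poly_rel G (p + q) (p' + q')"
  by (simp add: poly_rel_def ph_add)

lemma poly_rel_mult: "poly_rel G p p' \<Longrightarrow> poly_rel G q q' \<Longrightarrow> poly_rel G (p * q) (p' * q')"
  by (auto simp: poly_rel_def coeff_mult intro!: ph_sum ph_mult)

lemma poly_rel_monom: "(a, b) \<in> G \<Longrightarrow> poly_rel G (monom a n) (monom b n)"
  by (auto simp: poly_rel_def ph_0)

lemma poly_rel_0: "poly_rel G 0 p \<Longrightarrow> p = 0"
  by (auto simp: poly_rel_def poly_eq_iff dest: ph_zero)

lemma poly_rel_eval:
  assumes "poly_rel G p q" "(a, b) \<in> G"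
  shows "(poly p a, poly q b) \<in> G"
proof -
  define N where "N = max (degree p) (degree q)"
  have "poly r x = (\<Sum>i\<le>N. coeff r i * x ^ i)" if "degree r \<le> N" for r :: "'e poly" and x
    unfolding poly_altdef using that
    by (intro sum.mono_neutral_left) (auto simp: coeff_eq_0)
  then show ?thesis
    using assms by (auto simp: N_def poly_rel_def intro!: ph_sum ph_mult ph_power)
qed

text \<open>The minimal polynomial of \<open>a\<close> has coefficients in \<open>K\<close>, so it
  also vanishes at \<open>b\<close>; its constant coefficient is nonzero.\<close>

lemma ph_nonzero:
  assumes "(a, b) \<in> G" "a \<noteq> 0" shows "b \<noteq> 0"
proof
  assume "b = 0"
  obtain p where p: "is_minpoly p a" using minpoly_exists by blast
  have "poly (lift p) b = 0"
    using poly_rel_eval[OF poly_rel_lift[of p] assms(1)] is_minpolyD(2)[OF p] ph_zero by simp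
  then show False using minpoly_coeff_0[OF p assms(2)] by (simp add: \<open>b = 0\<close> poly_0_coeff_0)
qed

lemma poly_rel_degree: "poly_rel G p q \<Longrightarrow> degree q = degree p"
  unfolding degree_def poly_rel_def by (metis ph_nonzero ph_zero)

text \<open>\<open>G'\<close> is the induced map on the ring generated by \<open>\<gamma>\<close>
  over the domain of \<open>G\<close>. The hypothesis, that relations of \<open>\<gamma>\<close> are
  carried to relations of \<open>\<gamma>'\<close>, is its well-definedness.\<close>

lemma partial_hom_extend:
  assumes ext: "\<And>p q. poly_rel G p q \<Longrightarrow> poly p \<gamma> = 0 \<Longrightarrow> poly q \<gamma>' = 0"
  shows "\<exists>G'. partial_hom G' \<and> G \<subseteq> G' \<and> (\<gamma>, \<gamma>') \<in> G'"
proof -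
  define G' where "G' = {(poly p \<gamma>, poly q \<gamma>') |p q. poly_rel G p q}"
  have mem: "(poly p \<gamma>, poly q \<gamma>') \<in> G'" if "poly_rel G p q" for p q
    using that by (auto simp: G'_def)
  have "partial_hom G'"
    unfolding partial_hom_def
  proof (intro conjI allI impI)
    show "(\<iota> c, \<iota> c) \<in> G'" for c
      using mem[OF poly_rel_monom[OF ph_const, of c 0]] by (simp add: poly_monom)
  next
    fix a b c d assume "(a, b) \<in> G'" "(c, d) \<in> G'"
    then obtain p q r s where *: "poly_rel G p q" "poly_rel G r s"
      "a = poly p \<gamma>" "b = poly q \<gamma>'" "c = poly r \<gamma>" "d = poly s \<gamma>'"
      by (auto simp: G'_def)
    show "(a + c, b + d) \<in> G'" using mem[OF poly_rel_add[OF *(1,2)]] * by simp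
    show "(a * c, b * d) \<in> G'" using mem[OF poly_rel_mult[OF *(1,2)]] * by simp
  next
    fix b assume "(0, b) \<in> G'"
    then obtain p q where "poly_rel G p q" "poly p \<gamma> = 0" "b = poly q \<gamma>'" by (auto simp: G'_def)
    then show "b = 0" using ext by simp
  qed
  moreover have "G \<subseteq> G'"
  proof
    fix z assume "z \<in> G"
    then have "poly_rel G (monom (fst z) 0) (monom (snd z) 0)" by (intro poly_rel_monom) simp
    from mem[OF this] show "z \<in> G'" by (simp add: poly_monom)
  qed
  moreover have "(\<gamma>, \<gamma>') \<in> G'"
    using mem[OF poly_rel_monom[OF ph_1, of 1]] by (simp add: poly_monom)
  ultimately show ?thesis by blast
qed

end

text \<open>A maximal partial homomorphism extending \<open>q(x) \<mapsto> q(y)\<close> is defined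
  everywhere: its domain is a field, and any element can be sent to a root of the image of its
  relation of least degree over that field.\<close>

lemma conj_hom:
  assumes p: "is_minpoly p x" and y: "poly (lift p) y = 0"
  shows "\<exists>\<tau>. ring_hom_map \<tau> \<and> (\<forall>c. \<tau> (\<iota> c) = \<iota> c) \<and> \<tau> x = y"
proof -
  define G0 where "G0 = {(poly (lift q) x, poly (lift q) y) |q. True}"
  define \<A> where "\<A> = {G. partial_hom G \<and> G0 \<subseteq> G}"
  have "partial_hom G0"
    unfolding partial_hom_def
  proof (intro conjI allI impI)
    show "(\<iota> c, \<iota> c) \<in> G0" for c
      by (auto simp: G0_def map_poly_pCons intro!: exI[of _ "[:c:]"])
  next
    fix a b c d assume "(a, b) \<in> G0" "(c, d) \<in> G0"
    then obtain q r where *: "a = poly (lift q) x" "b = poly (lift q) y"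
      "c = poly (lift r) x" "d = poly (lift r) y" by (auto simp: G0_def)
    show "(a + c, b + d) \<in> G0"
      by (auto simp: G0_def * map_poly_hom_add intro!: exI[of _ "q + r"])
    show "(a * c, b * d) \<in> G0"
      by (auto simp: G0_def * map_poly_hom_mult intro!: exI[of _ "q * r"])
  next
    fix b assume "(0, b) \<in> G0"
    then obtain q where q: "poly (lift q) x = 0" "b = poly (lift q) y" by (auto simp: G0_def)
    then have "p dvd q" using is_minpolyD(3)[OF p] by blast
    then show "b = 0" using q y by (auto simp: map_poly_hom_mult)
  qed
  then have "\<A> \<noteq> {}" by (auto simp: \<A>_def)
  moreover have "\<Union>C \<in> \<A>" if C: "C \<noteq> {}" "subset.chain \<A> C" for C
  proof -
    have mem: "partial_hom H" "G0 \<subseteq> H" if "H \<in> C" for H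
      using C(2) that by (auto simp: subset.chain_def \<A>_def)
    have dir: "\<exists>H\<in>C. z \<in> H \<and> w \<in> H" if zw: "z \<in> \<Union>C" "w \<in> \<Union>C" for z w
    proof -
      obtain H I where HI: "H \<in> C" "I \<in> C" "z \<in> H" "w \<in> I" using zw by blast
      then have "H \<subseteq> I \<or> I \<subseteq> H" using C(2) by (auto simp: subset_chain_def)
      then show ?thesis using HI by blast
    qed
    have "partial_hom (\<Union>C)"
      unfolding partial_hom_def
    proof (intro conjI allI impI)
      show "(\<iota> c, \<iota> c) \<in> \<Union>C" for c using C(1) ph_const[OF mem(1)] by blast
      show "b = 0" if "(0, b) \<in> \<Union>C" for b using that ph_zero[OF mem(1)] by blast
      fix a b c d assume "(a, b) \<in> \<Union>C" "(c, d) \<in> \<Union>C"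
      then obtain H where "H \<in> C" "(a, b) \<in> H" "(c, d) \<in> H" using dir by blast
      then show "(a + c, b + d) \<in> \<Union>C" "(a * c, b * d) \<in> \<Union>C"
        using ph_add[OF mem(1)] ph_mult[OF mem(1)] by blast+
    qed
    moreover have "G0 \<subseteq> \<Union>C" using C(1) mem(2) by blast
    ultimately show ?thesis by (simp add: \<A>_def)
  qed
  ultimately obtain G where "G \<in> \<A>" and max: "\<And>H. H \<in> \<A> \<Longrightarrow> G \<subseteq> H \<Longrightarrow> H = G"
    using subset_Zorn_nonempty[of \<A>] by blast
  then have G: "partial_hom G" and G0: "G0 \<subseteq> G" by (auto simp: \<A>_def)
  have ext: "(\<gamma>, \<gamma>') \<in> G"
    if rel: "\<And>p q. poly_rel G p q \<Longrightarrow> poly p \<gamma> = 0 \<Longrightarrow> poly q \<gamma>' = 0" for \<gamma> \<gamma>'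
  proof -
    have "\<exists>G'. partial_hom G' \<and> G \<subseteq> G' \<and> (\<gamma>, \<gamma>') \<in> G'"
      by (rule partial_hom_extend[OF G]) (rule rel)
    then obtain G' where "partial_hom G'" "G \<subseteq> G'" "(\<gamma>, \<gamma>') \<in> G'" by blast
    then show ?thesis using max[of G'] G0 by (auto simp: \<A>_def)
  qed
  \<comment> \<open>Reversing coefficients turns a relation for \<open>1 / a\<close> into one for
    \<open>a\<close>, which \<open>G\<close> transports. Reversal commutes with the transport
    because degrees are preserved.\<close>
  have inv: "(inverse a, inverse b) \<in> G" if ab: "(a, b) \<in> G" "a \<noteq> 0" for a b
  proof (rule ext)
    fix r s assume rs: "poly_rel G r s" "poly r (inverse a) = 0"
    have "b \<noteq> 0" using ph_nonzero[OF G ab] .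
    have "poly_rel G (reflect_poly r) (reflect_poly s)"
      using rs(1) by (auto simp: poly_rel_def coeff_reflect_poly poly_rel_degree[OF G rs(1)] ph_0[OF G])
    then have "(poly (reflect_poly r) a, poly (reflect_poly s) b) \<in> G"
      by (rule poly_rel_eval[OF G _ ab(1)])
    then have "poly (reflect_poly s) b = 0"
      using rs(2) ab(2) ph_zero[OF G] by (simp add: poly_reflect_poly_nz)
    then show "poly s (inverse b) = 0" using \<open>b \<noteq> 0\<close> by (simp add: poly_reflect_poly_nz)
  qed
  have total: "\<exists>\<gamma>'. (\<gamma>, \<gamma>') \<in> G" for \<gamma>
  proof -
    define R where "R r \<longleftrightarrow> r \<noteq> 0 \<and> poly r \<gamma> = 0 \<and> (\<exists>s. poly_rel G r s)" for r
    obtain q where "is_minpoly q \<gamma>" using minpoly_exists by blast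
    then have "R (lift q)"
      using poly_rel_lift[OF G] by (auto simp: R_def is_minpoly_def)
    then obtain r where r: "R r" "\<And>r'. R r' \<Longrightarrow> degree r \<le> degree r'"
      using ex_has_least_nat[of R _ degree] by blast
    then obtain s where s: "poly_rel G r s" "r \<noteq> 0" "poly r \<gamma> = 0" by (auto simp: R_def)
    have degr: "degree r \<ge> 1"
    proof (rule ccontr)
      assume "\<not> degree r \<ge> 1"
      then obtain c where "r = [:c:]" by (metis One_nat_def degree_eq_zeroE less_one not_le)
      then show False using s by simp
    qed
    have degs: "degree s = degree r" by (rule poly_rel_degree[OF G s(1)])
    then obtain \<gamma>' where \<gamma>': "poly s \<gamma>' = 0"
      using alg_closed_imp_poly_has_root[of s] degr by auto
    \<comment> \<open>Division by \<open>r\<close>, one leading term at a time and in parallel on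
      both sides; minimality of \<open>degree r\<close> leaves remainder \<open>0\<close>. The
      quotients of leading coefficients stay in the domain by \<open>inv\<close>.\<close>
    have "poly q' \<gamma>' = 0" if "poly_rel G q q'" "poly q \<gamma> = 0" for q q'
      using that
    proof (induction "degree q" arbitrary: q q' rule: less_induct)
      case less
      show ?case
      proof (cases "q = 0")
        case True
        then have "q' = 0" using less.prems(1) by (intro poly_rel_0[OF G]) simp
        then show ?thesis by simp
      next
        case False
        then have le: "degree r \<le> degree q" using r(2)[of q] less.prems by (auto simp: R_def)
        have degq': "degree q' = degree q" by (rule poly_rel_degree[OF G less.prems(1)])
        define c where "c = lead_coeff q * inverse (lead_coeff r)"
        define d where "d = lead_coeff q' * inverse (lead_coeff s)"
        define k where "k = degree q - degree r"
        have "(c, d) \<in> G" unfolding c_def d_def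
          using less.prems(1) s(1,2) degs degq'
          by (intro ph_mult[OF G] inv) (auto simp: poly_rel_def)
        define q2 where "q2 = q - monom c k * r"
        define q2' where "q2' = q' - monom d k * s"
        have rel: "poly_rel G q2 q2'"
          unfolding q2_def q2'_def using less.prems(1) s(1) \<open>(c, d) \<in> G\<close>
          by (intro poly_rel_diff[OF G] poly_rel_mult[OF G] poly_rel_monom[OF G])
        have z: "poly q2 \<gamma> = 0" using less.prems(2) s(3) by (simp add: q2_def)
        have "degree q2 < degree q"
        proof -
          have "degree (monom c k * r) \<le> degree q"
            using degree_mult_le[of "monom c k" r] degree_monom_le[of c k] le unfolding k_def by linarith
          then have "degree q2 \<le> degree q" unfolding q2_def by (intro degree_diff_le) auto
          moreover have "coeff q2 (degree q) = 0"
            using le s(2) by (simp add: q2_def coeff_monom_mult k_def c_def)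
          ultimately show ?thesis using le degr
            by (metis degree_0 eq_zero_or_degree_less less_le_trans less_numeral_extra(1))
        qed
        from less.hyps[OF this rel z] show ?thesis using \<gamma>' by (simp add: q2'_def)
      qed
    qed
    then show ?thesis using ext by blast
  qed
  define \<tau> where "\<tau> \<gamma> = (SOME \<gamma>'. (\<gamma>, \<gamma>') \<in> G)" for \<gamma>
  have \<tau>: "(\<gamma>, \<tau> \<gamma>) \<in> G" for \<gamma>
    unfolding \<tau>_def using total by (rule someI_ex)
  have \<tau>_eq: "\<tau> a = b" if "(a, b) \<in> G" for a b
    using ph_unique[OF G \<tau> that] .
  have "ring_hom_map \<tau>"
    by unfold_locales (auto intro!: \<tau>_eq ph_1[OF G] ph_add[OF G] ph_mult[OF G] \<tau>)
  moreover have "\<tau> (\<iota> c) = \<iota> c" for c by (intro \<tau>_eq ph_const[OF G])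
  moreover have "(poly (lift [:0, 1:]) x, poly (lift [:0, 1:]) y) \<in> G0" unfolding G0_def by blast
  then have "(x, y) \<in> G" using G0 by (auto simp: map_poly_pCons)
  then have "\<tau> x = y" by (rule \<tau>_eq)
  ultimately show ?thesis by blast
qed

end

subsection \<open>Extension of valuations to an algebraic closure\<close>

locale valued_alg_closed_ext = alg_closed_ext \<iota> + ring_valuation v
  for \<iota> :: "'k::field \<Rightarrow> 'e::alg_closed_field"
    and v :: "'k \<Rightarrow> 'g::linordered_ab_group_add extended" +
  assumes divisible: "divisible_group TYPE('g)" and val_eq_Pinf: "v a = Pinf \<longleftrightarrow> a = 0"
begin

lemma val_Fin: "a \<noteq> 0 \<Longrightarrow> \<exists>\<gamma>. v a = Fin \<gamma>"
  using val_eq_Pinf by (cases a rule: val_cases) auto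

lemma val_inverse: "v a = Fin \<gamma> \<Longrightarrow> v (inverse a) = Fin (- \<gamma>)"
proof -
  assume a: "v a = Fin \<gamma>"
  then have "a \<noteq> 0" by auto
  then have "v a + v (inverse a) = Fin 0" by (simp flip: val_mult)
  then show ?thesis using a
    by (cases "inverse a" rule: val_cases) (auto simp: eq_neg_iff_add_eq_0 add.commute)
qed

lemma val_divide: "v a = Fin \<alpha> \<Longrightarrow> v b = Fin \<beta> \<Longrightarrow> v (a / b) = Fin (\<alpha> - \<beta>)"
  unfolding divide_inverse by (simp add: val_mult val_inverse)

text \<open>Chevalley's argument: a subring maximal among those meeting \<open>K\<close> in the valuation ring of \<open>v\<close> is
  a valuation ring. A relation as in \<open>proper_rel\<close> is what obstructs adjoining \<open>x\<close> to such a ring.\<close>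

definition ext_ring :: "'e set \<Rightarrow> bool" where
  "ext_ring B \<longleftrightarrow> (\<forall>x\<in>B. \<forall>y\<in>B. x + y \<in> B \<and> x * y \<in> B) \<and> (\<forall>c. \<iota> c \<in> B \<longleftrightarrow> Fin 0 \<le> v c)"

definition coeffs_in :: "'e set \<Rightarrow> 'e poly \<Rightarrow> bool" where
  "coeffs_in B p \<longleftrightarrow> (\<forall>i. coeff p i \<in> B)"

context
  fixes B assumes B: "ext_ring B"
begin

lemma er_add: "x \<in> B \<Longrightarrow> y \<in> B \<Longrightarrow> x + y \<in> B"
  and er_mult: "x \<in> B \<Longrightarrow> y \<in> B \<Longrightarrow> x * y \<in> B"
  and er_const: "\<iota> c \<in> B \<longleftrightarrow> Fin 0 \<le> v c"
  using B unfolding ext_ring_def by blast+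

lemma er_0: "0 \<in> B" and er_1: "1 \<in> B"
  using er_const[of 0] er_const[of 1] by simp_all

lemma er_uminus: "x \<in> B \<Longrightarrow> - x \<in> B"
  using er_mult[of "\<iota> (- 1)" x] er_const[of "- 1"] by (simp add: hom_uminus)

lemma er_diff: "x \<in> B \<Longrightarrow> y \<in> B \<Longrightarrow> x - y \<in> B"
  using er_add[OF _ er_uminus] by force

lemma er_power: "x \<in> B \<Longrightarrow> x ^ n \<in> B"
  by (induction n) (auto intro: er_1 er_mult)

lemma er_sum: "(\<And>i. i \<in> A \<Longrightarrow> g i \<in> B) \<Longrightarrow> sum g A \<in> B"
  by (induction A rule: infinite_finite_induct) (auto intro: er_0 er_add)

lemma coeffs_in_add: "coeffs_in B p \<Longrightarrow> coeffs_in B q \<Longrightarrow> coeffs_in B (p + q)"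
  by (simp add: coeffs_in_def er_add)

lemma coeffs_in_diff: "coeffs_in B p \<Longrightarrow> coeffs_in B q \<Longrightarrow> coeffs_in B (p - q)"
  by (simp add: coeffs_in_def er_diff)

lemma coeffs_in_mult: "coeffs_in B p \<Longrightarrow> coeffs_in B q \<Longrightarrow> coeffs_in B (p * q)"
  by (auto simp: coeffs_in_def coeff_mult intro!: er_sum er_mult)

lemma coeffs_in_monom: "a \<in> B \<Longrightarrow> coeffs_in B (monom a n)"
  by (simp add: coeffs_in_def er_0)

lemma coeffs_in_smult: "a \<in> B \<Longrightarrow> coeffs_in B p \<Longrightarrow> coeffs_in B (smult a p)"
  by (simp add: coeffs_in_def er_mult)

lemma coeffs_in_reflect: "coeffs_in B p \<Longrightarrow> coeffs_in B (reflect_poly p)"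
  by (simp add: coeffs_in_def coeff_reflect_poly er_0)

lemma poly_in: "coeffs_in B p \<Longrightarrow> x \<in> B \<Longrightarrow> poly p x \<in> B"
  by (auto simp: poly_altdef coeffs_in_def intro!: er_sum er_mult er_power)

text \<open>Otherwise \<open>b\<close> would be the image of \<open>inverse c\<close>, which has
  negative value although \<open>B\<close> meets \<open>K\<close> in the valuation ring of
  \<open>v\<close>.\<close>

lemma er_no_inverse: "Fin 0 < v c \<Longrightarrow> b \<in> B \<Longrightarrow> \<iota> c * b \<noteq> 1"
proof
  assume c: "Fin 0 < v c" "b \<in> B" "\<iota> c * b = 1"
  then have "c \<noteq> 0" by auto
  then obtain \<gamma> where \<gamma>: "v c = Fin \<gamma>" using val_Fin by blast
  have "b = \<iota> (inverse c)" using c(3) by (simp add: emb_inverse inverse_unique)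
  then have "Fin 0 \<le> v (inverse c)" using c(2) er_const by simp
  then show False using c(1) \<gamma> by (simp add: val_inverse)
qed

text \<open>Whichever of \<open>c\<close>, \<open>d\<close> has the smaller value divides the other.
  Two relations with factors \<open>c\<close> and \<open>d\<close> can thus be rewritten with one
  factor \<open>e\<close>.\<close>

lemma er_common_divisor:
  assumes "Fin 0 < v c" "Fin 0 < v d"
  obtains e c' d' where "Fin 0 < v e" "c' \<in> B" "d' \<in> B" "\<iota> c = \<iota> e * c'" "\<iota> d = \<iota> e * d'"
proof -
  have *: "\<exists>c'\<in>B. \<iota> c = \<iota> e * c'" if "v e \<le> v c" "Fin 0 < v e" for c e
  proof (cases "c = 0")
    case True
    then show ?thesis using er_0 by force
  next
    case False
    then obtain \<gamma> \<epsilon> where v: "v c = Fin \<gamma>" "v e = Fin \<epsilon>"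
      using \<open>v e \<le> v c\<close> val_Fin by (cases e rule: val_cases) force+
    then have "e \<noteq> 0" by auto
    moreover have "\<iota> (c / e) \<in> B"
      unfolding er_const val_divide[OF v] using v that(1) by simp
    ultimately show ?thesis by (intro bexI[of _ "\<iota> (c / e)"]) (auto simp: emb_divide)
  qed
  show thesis
  proof (cases "v c \<le> v d")
    case True
    then show thesis using *[of c d] *[of c c] assms that[of c] by auto
  next
    case False
    then have "v d \<le> v c" by simp
    then show thesis using *[of d c] *[of d d] assms that[of d] by auto
  qed
qed

end

definition proper_rel :: "'e set \<Rightarrow> 'e \<Rightarrow> nat \<Rightarrow> bool" where
  "proper_rel B x n \<longleftrightarrow>
     (\<exists>c p. Fin 0 < v c \<and> coeffs_in B p \<and> degree p \<le> n \<and> \<iota> c * poly p x = 1)"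

lemma not_proper_rel_0: "ext_ring B \<Longrightarrow> \<not> proper_rel B x 0"
proof
  assume B: "ext_ring B" and "proper_rel B x 0"
  then obtain c p where *: "Fin 0 < v c" "coeffs_in B p" "degree p = 0" "\<iota> c * poly p x = 1"
    unfolding proper_rel_def by auto
  then have "poly p x = coeff p 0" by (auto elim: degree_eq_zeroE)
  then show False using er_no_inverse[OF B *(1), of "coeff p 0"] * by (simp add: coeffs_in_def)
qed

context
  fixes B assumes B: "ext_ring B" and max: "\<And>A. ext_ring A \<Longrightarrow> B \<subseteq> A \<Longrightarrow> A = B"
begin

text \<open>By maximality \<open>B[x]\<close> must contain some \<open>\<iota> c\<close> with
  \<open>v c < 0\<close>; division by it gives the relation.\<close>

lemma proper_rel_exists:
  assumes "x \<notin> B"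
  shows "\<exists>n. proper_rel B x n"
proof -
  define A where "A = {poly p x |p. coeffs_in B p}"
  have mem: "poly p x \<in> A" if "coeffs_in B p" for p using that by (auto simp: A_def)
  have sub: "B \<subseteq> A"
  proof
    fix b assume "b \<in> B"
    from mem[OF coeffs_in_monom[OF B this, of 0]] show "b \<in> A" by (simp add: poly_monom)
  qed
  have "x \<in> A" using mem[OF coeffs_in_monom[OF B er_1[OF B], of 1]] by (simp add: poly_monom)
  then have "\<not> ext_ring A" using max[of A] sub assms by blast
  moreover have "\<forall>y\<in>A. \<forall>z\<in>A. y + z \<in> A \<and> y * z \<in> A"
  proof (intro ballI conjI)
    fix y z assume "y \<in> A" "z \<in> A"
    then obtain p q where *: "coeffs_in B p" "coeffs_in B q" "y = poly p x" "z = poly q x"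
      by (auto simp: A_def)
    show "y + z \<in> A" using mem[OF coeffs_in_add[OF B *(1,2)]] * by simp
    show "y * z \<in> A" using mem[OF coeffs_in_mult[OF B *(1,2)]] * by simp
  qed
  moreover have "\<iota> c \<in> A" if "Fin 0 \<le> v c" for c
    using that sub er_const[OF B] by blast
  ultimately obtain c where c: "\<iota> c \<in> A" "\<not> Fin 0 \<le> v c"
    unfolding ext_ring_def by blast
  then obtain p where p: "coeffs_in B p" "\<iota> c = poly p x" by (auto simp: A_def)
  obtain \<gamma> where \<gamma>: "v c = Fin \<gamma>" "\<gamma> < 0" using c(2) by (cases c rule: val_cases) auto
  then have "c \<noteq> 0" by auto
  have "Fin 0 < v (inverse c)" using val_inverse[OF \<gamma>(1)] \<gamma>(2) by simp
  moreover have "\<iota> (inverse c) * poly p x = 1" using \<open>c \<noteq> 0\<close> by (simp flip: p(2) hom_mult)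
  ultimately show ?thesis using p(1) unfolding proper_rel_def by blast
qed

text \<open>If \<open>z = 1 - \<iota> d * b\<close> had no inverse in \<open>B\<close>, a relation
  for \<open>1 / z\<close> would give \<open>z^n = \<iota> c * a\<close> after clearing
  denominators, whereas expansion gives \<open>z^n = 1 - \<iota> d * b'\<close>. With a common
  factor \<open>e\<close> of \<open>c\<close> and \<open>d\<close>, comparing the two yields an
  inverse of \<open>\<iota> e\<close> in \<open>B\<close>.\<close>

lemma er_one_minus_unit:
  assumes d: "Fin 0 < v d" and b: "b \<in> B"
  shows "inverse (1 - \<iota> d * b) \<in> B" "1 - \<iota> d * b \<noteq> 0"
proof -
  define z where "z = 1 - \<iota> d * b"
  have z0: "z \<noteq> 0" using er_no_inverse[OF B d b] by (simp add: z_def)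
  then show "1 - \<iota> d * b \<noteq> 0" by (simp add: z_def)
  have \<iota>d: "\<iota> d \<in> B" using d by (simp add: er_const[OF B] less_imp_le)
  have zB: "z \<in> B" unfolding z_def by (intro er_diff[OF B] er_1[OF B] er_mult[OF B] \<iota>d b)
  have "inverse z \<in> B"
  proof (rule ccontr)
    assume "inverse z \<notin> B"
    then obtain c p where p: "Fin 0 < v c" "coeffs_in B p" "\<iota> c * poly p (inverse z) = 1"
      using proper_rel_exists unfolding proper_rel_def by blast
    define n where "n = degree p"
    define a where "a = poly (reflect_poly p) z"
    have "a \<in> B" unfolding a_def by (intro poly_in[OF B] coeffs_in_reflect[OF B] p zB)
    have "a = z ^ n * poly p (inverse z)" using z0 by (simp add: a_def n_def poly_reflect_poly_nz)
    then have za: "z ^ n = \<iota> c * a" using p(3) by (simp add: mult_ac)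
    have "\<exists>b'\<in>B. z ^ n = 1 - \<iota> d * b'" for n
    proof (induction n)
      case 0
      then show ?case using er_0[OF B] by force
    next
      case (Suc n)
      then obtain b' where "b' \<in> B" "z ^ n = 1 - \<iota> d * b'" by blast
      then have "z ^ Suc n = (1 - \<iota> d * b) * (1 - \<iota> d * b')"
        by (simp add: z_def)
      also have "\<dots> = 1 - \<iota> d * (b + b' - \<iota> d * b * b')"
        by (simp add: algebra_simps)
      finally have "z ^ Suc n = 1 - \<iota> d * (b + b' - \<iota> d * b * b')" .
      with b \<open>b' \<in> B\<close> \<iota>d show ?case
        by (intro bexI[of _ "b + b' - \<iota> d * b * b'"]) (auto intro!: er_diff[OF B] er_add[OF B] er_mult[OF B])
    qed
    then obtain b' where b': "b' \<in> B" "z ^ n = 1 - \<iota> d * b'" by blast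
    obtain e c' d' where e: "Fin 0 < v e" "c' \<in> B" "d' \<in> B" "\<iota> c = \<iota> e * c'" "\<iota> d = \<iota> e * d'"
      using er_common_divisor[OF B p(1) d] .
    have "\<iota> e * (c' * a + d' * b') = 1" using za b'(2) e by (simp add: algebra_simps)
    moreover have "c' * a + d' * b' \<in> B"
      by (intro er_add[OF B] er_mult[OF B] e b' \<open>a \<in> B\<close>)
    ultimately show False using er_no_inverse[OF B e(1)] by blast
  qed
  then show "inverse (1 - \<iota> d * b) \<in> B" by (simp add: z_def)
qed

text \<open>Multiplied by \<open>x^k\<close>, the relation for \<open>1 / x\<close> expresses
  \<open>x^k\<close> through lower powers, because the factor \<open>1 - \<iota> e * q0\<close> of
  \<open>x^k\<close> is a unit of \<open>B\<close>. As \<open>k \<le> n\<close>, this eliminates the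
  term of degree \<open>n\<close> from the relation for \<open>x\<close>.\<close>

lemma proper_rel_reduce:
  assumes x: "x \<noteq> 0" and n: "proper_rel B x n" and k: "proper_rel B (inverse x) k" and "1 \<le> k" "k \<le> n"
  shows "proper_rel B x (n - 1)"
proof -
  obtain c p where p: "Fin 0 < v c" "coeffs_in B p" "degree p \<le> n" "\<iota> c * poly p x = 1"
    using n unfolding proper_rel_def by blast
  obtain d q where q: "Fin 0 < v d" "coeffs_in B q" "degree q \<le> k" "\<iota> d * poly q (inverse x) = 1"
    using k unfolding proper_rel_def by blast
  obtain e c' d' where e: "Fin 0 < v e" "c' \<in> B" "d' \<in> B" "\<iota> c = \<iota> e * c'" "\<iota> d = \<iota> e * d'"
    using er_common_divisor[OF B p(1) q(1)] .
  define p1 where "p1 = smult c' p"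
  define q1 where "q1 = smult d' q"
  have p1: "coeffs_in B p1" "degree p1 \<le> n" "\<iota> e * poly p1 x = 1"
    using p e by (auto simp: p1_def coeffs_in_smult[OF B] mult_ac intro: order_trans[OF degree_smult_le])
  have q1: "coeffs_in B q1" "degree q1 \<le> k" "\<iota> e * poly q1 (inverse x) = 1"
    using q e by (auto simp: q1_def coeffs_in_smult[OF B] mult_ac intro: order_trans[OF degree_smult_le])
  obtain q0 q2 where q2: "q1 = pCons q0 q2" by (rule pCons_cases)
  have q2B: "coeffs_in B q2" "q0 \<in> B"
    using q1(1) unfolding q2 coeffs_in_def by (metis coeff_pCons_Suc, metis coeff_pCons_0)
  have degq2: "degree q2 \<le> k - 1" using q1(2) \<open>1 \<le> k\<close> by (auto simp: q2 split: if_splits)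
  define z where "z = 1 - \<iota> e * q0"
  have z: "inverse z \<in> B" "z \<noteq> 0" unfolding z_def by (rule er_one_minus_unit[OF e(1) q2B(2)])+
  \<comment> \<open>The polynomial with \<open>s(x) = x^(k - 1) * q2(1 / x)\<close>. Since
    \<open>reflect_poly\<close> reverses at the actual degree of \<open>q2\<close>, the monomial
    supplies the missing powers.\<close>
  define s where "s = monom 1 (k - 1 - degree q2) * reflect_poly q2"
  have sB: "coeffs_in B s"
    unfolding s_def by (intro coeffs_in_mult[OF B] coeffs_in_monom[OF B] er_1[OF B] coeffs_in_reflect[OF B] q2B)
  have degs: "degree s \<le> k - 1"
    unfolding s_def
    using degree_mult_le[of "monom 1 (k - 1 - degree q2)" "reflect_poly q2"]
      degree_monom_le[of "1 :: 'e" "k - 1 - degree q2"] degree_reflect_poly_le[of q2] degq2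
    by linarith
  have "x ^ (k - 1 - degree q2) * x ^ degree q2 = x ^ (k - 1)"
    using degq2 by (metis le_add_diff_inverse2 power_add)
  then have s: "poly s x = x ^ (k - 1) * poly q2 (inverse x)"
    using x by (simp add: s_def poly_monom poly_reflect_poly_nz flip: mult.assoc)
  have "z = \<iota> e * (inverse x * poly q2 (inverse x))"
    using q1(3) by (simp add: z_def q2 algebra_simps)
  then have "x ^ k * z = \<iota> e * (x ^ k * inverse x) * poly q2 (inverse x)"
    by (simp add: mult_ac)
  also have "x ^ k * inverse x = x ^ (k - 1)"
    using x \<open>1 \<le> k\<close> by (simp add: power_diff field_simps)
  finally have "x ^ k * z = \<iota> e * poly s x" by (simp add: s mult_ac)
  then have xk: "x ^ k = \<iota> e * inverse z * poly s x"
    using z(2) by (simp add: field_simps)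
  define an where "an = coeff p1 n"
  define p3 where "p3 = p1 - monom an n"
  have anB: "an \<in> B" using p1(1) by (simp add: an_def coeffs_in_def)
  have p3B: "coeffs_in B p3" unfolding p3_def by (intro coeffs_in_diff[OF B] coeffs_in_monom[OF B] anB p1)
  have degp3: "degree p3 \<le> n - 1"
  proof (rule degree_le, intro allI impI)
    fix i assume "n - 1 < i"
    then have "i = n \<or> i > n" by linarith
    then show "coeff p3 i = 0" using p1(2) by (auto simp: p3_def an_def coeff_eq_0)
  qed
  define a where "a = an * \<iota> e * inverse z"
  have "\<iota> e \<in> B" using e(1) by (simp add: er_const[OF B] less_imp_le)
  then have aB: "a \<in> B" unfolding a_def by (intro er_mult[OF B] anB z)
  define w where "w = p3 + smult a (monom 1 (n - k) * s)"
  have "coeffs_in B w"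
    unfolding w_def by (intro coeffs_in_add[OF B] coeffs_in_smult[OF B] coeffs_in_mult[OF B]
        coeffs_in_monom[OF B] p3B sB aB er_1[OF B])
  moreover have "degree w \<le> n - 1"
    unfolding w_def
  proof (rule degree_add_le[OF degp3])
    have "degree (monom 1 (n - k) * s) \<le> (n - k) + (k - 1)"
      using degree_mult_le[of "monom 1 (n - k)" s] degree_monom_le[of "1 :: 'e" "n - k"] degs by linarith
    also have "\<dots> \<le> n - 1" using assms(4,5) by linarith
    finally show "degree (smult a (monom 1 (n - k) * s)) \<le> n - 1"
      by (rule order_trans[OF degree_smult_le])
  qed
  moreover have "\<iota> e * poly w x = 1"
  proof -
    have "x ^ n = x ^ (n - k) * x ^ k" using assms(5) by (simp flip: power_add)
    then have "an * x ^ n = a * (x ^ (n - k) * poly s x)"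
      by (simp add: xk a_def mult_ac)
    then have "poly w x = poly p1 x" by (simp add: w_def p3_def poly_monom)
    then show ?thesis using p1(3) by simp
  qed
  ultimately show ?thesis using e(1) unfolding proper_rel_def by blast
qed

text \<open>If both \<open>x\<close> and its inverse were missing, both would have relations of
  least degree, and the one of larger degree could be shortened.\<close>

lemma er_maximal_valuation_ring:
  assumes x: "x \<noteq> 0"
  shows "x \<in> B \<or> inverse x \<in> B"
proof (rule ccontr)
  assume "\<not> ?thesis"
  then obtain n k where n: "proper_rel B x n" "\<And>m. proper_rel B x m \<Longrightarrow> n \<le> m"
    and k: "proper_rel B (inverse x) k" "\<And>m. proper_rel B (inverse x) m \<Longrightarrow> k \<le> m"
    using proper_rel_exists ex_has_least_nat[of "proper_rel B x" _ "\<lambda>n. n"]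
      ex_has_least_nat[of "proper_rel B (inverse x)" _ "\<lambda>n. n"] by metis
  have pos: "n \<ge> 1" "k \<ge> 1"
    using n(1) k(1) not_proper_rel_0[OF B] by (metis One_nat_def not_less less_one)+
  show False
  proof (cases "k \<le> n")
    case True
    then show False using n(2)[OF proper_rel_reduce[OF x n(1) k(1) pos(2)]] pos by simp
  next
    case False
    then show False using k(2)[OF proper_rel_reduce[of "inverse x" k n]] x n(1) k(1) pos by simp
  qed
qed

end

lemma valuation_ring_exists: "\<exists>B. ext_ring B \<and> (\<forall>x. x \<noteq> 0 \<longrightarrow> x \<in> B \<or> inverse x \<in> B)"
proof -
  \<comment> \<open>Zorn's lemma starts from the valuation ring of \<open>v\<close>; prescribing the
    intersection with \<open>K\<close> is compatible with unions of chains.\<close>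
  have "ext_ring (\<iota> ` {c. Fin 0 \<le> v c})"
    unfolding ext_ring_def
  proof (intro conjI ballI allI)
    fix x y assume "x \<in> \<iota> ` {c. Fin 0 \<le> v c}" "y \<in> \<iota> ` {c. Fin 0 \<le> v c}"
    then obtain c d where *: "Fin 0 \<le> v c" "Fin 0 \<le> v d" "x = \<iota> c" "y = \<iota> d" by blast
    show "x + y \<in> \<iota> ` {c. Fin 0 \<le> v c}"
      using * by (auto simp flip: hom_add intro: val_add_ge)
    show "x * y \<in> \<iota> ` {c. Fin 0 \<le> v c}"
      using val_mult_ge[OF *(1,2)] * by (auto simp flip: hom_mult)
  qed auto
  then have "{B. ext_ring B} \<noteq> {}" by auto
  moreover have "\<Union>C \<in> {B. ext_ring B}" if C: "C \<noteq> {}" "subset.chain {B. ext_ring B} C" for C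
  proof -
    have mem: "ext_ring H" if "H \<in> C" for H
      using C(2) that by (auto simp: subset.chain_def)
    have "ext_ring (\<Union>C)"
      unfolding ext_ring_def
    proof (intro conjI ballI allI)
      fix x y assume "x \<in> \<Union>C" "y \<in> \<Union>C"
      then obtain H I where HI: "H \<in> C" "I \<in> C" "x \<in> H" "y \<in> I" by blast
      then have "H \<subseteq> I \<or> I \<subseteq> H" using C(2) by (auto simp: subset_chain_def)
      then obtain J where "J \<in> C" "x \<in> J" "y \<in> J" using HI by blast
      then show "x + y \<in> \<Union>C" "x * y \<in> \<Union>C"
        using er_add[OF mem] er_mult[OF mem] by blast+
    next
      fix c show "\<iota> c \<in> \<Union>C \<longleftrightarrow> Fin 0 \<le> v c"
        using C(1) er_const[OF mem] by blast
    qed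
    then show ?thesis by simp
  qed
  ultimately obtain B where "ext_ring B" "\<And>A. ext_ring A \<Longrightarrow> B \<subseteq> A \<Longrightarrow> A = B"
    using subset_Zorn_nonempty[of "{B. ext_ring B}"] by blast
  then show ?thesis using er_maximal_valuation_ring by blast
qed

end

section \<open>The valuation attached to a valuation ring of the closure\<close>

context valued_alg_closed_ext
begin

context
  fixes B assumes B: "ext_ring B" and val_ring: "\<And>x. x \<noteq> 0 \<Longrightarrow> x \<in> B \<or> inverse x \<in> B"
begin

definition unit_in :: "'e \<Rightarrow> bool" where
  "unit_in x \<longleftrightarrow> x \<noteq> 0 \<and> x \<in> B \<and> inverse x \<in> B"

lemma unit_in_mult: "unit_in x \<Longrightarrow> unit_in y \<Longrightarrow> unit_in (x * y)"
  by (auto simp: unit_in_def er_mult[OF B])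

lemma unit_in_inverse: "unit_in x \<Longrightarrow> unit_in (inverse x)"
  by (auto simp: unit_in_def)

lemma unit_in_power: "unit_in x \<Longrightarrow> unit_in (x ^ n)"
  by (auto simp: unit_in_def er_power[OF B] simp flip: power_inverse)

lemma unit_in_const: "unit_in (\<iota> c) \<longleftrightarrow> v c = Fin 0"
proof (cases "c = 0")
  case False
  then obtain \<gamma> where \<gamma>: "v c = Fin \<gamma>" using val_Fin by blast
  show ?thesis using False
    by (simp add: unit_in_def er_const[OF B] \<gamma> val_inverse[OF \<gamma>] flip: emb_inverse) auto
qed (simp add: unit_in_def)

lemma er_division: "x \<noteq> 0 \<Longrightarrow> y \<noteq> 0 \<Longrightarrow> x / y \<in> B \<or> y / x \<in> B"
  using val_ring[of "x / y"] by simp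

text \<open>\<open>B\<close> is local: of two nonzero summands one divides the other in
  \<open>B\<close>, hence divides their sum, and so would be a unit if the sum were.\<close>

lemma nonunit_sum:
  assumes "finite A" "\<And>i. i \<in> A \<Longrightarrow> g i \<in> B \<and> \<not> unit_in (g i)"
  shows "sum g A \<in> B \<and> \<not> unit_in (sum g A)"
  using assms
proof (induction A)
  case empty
  then show ?case by (simp add: er_0[OF B] unit_in_def)
next
  case (insert a A)
  define x y where "x = g a" and "y = sum g A"
  have *: "x \<in> B" "\<not> unit_in x" "y \<in> B" "\<not> unit_in y"
    using insert by (auto simp: x_def y_def)
  have nu: "\<not> unit_in (x + y)" if xy: "x \<in> B" "\<not> unit_in x" "y \<in> B" "x \<noteq> 0" "y / x \<in> B" for x y
  proof
    assume "unit_in (x + y)"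
    then have "x + y \<noteq> 0" "inverse (x + y) \<in> B" by (auto simp: unit_in_def)
    moreover have "inverse x = inverse (x + y) * (1 + y / x)"
      using \<open>x + y \<noteq> 0\<close> xy(4) by (simp add: field_simps)
    ultimately have "inverse x \<in> B" using xy(5) by (simp add: er_mult[OF B] er_add[OF B] er_1[OF B])
    then show False using xy by (simp add: unit_in_def)
  qed
  have "\<not> unit_in (x + y)"
  proof (cases "x = 0 \<or> y = 0")
    case True
    then show ?thesis using * by auto
  next
    case False
    then show ?thesis
      using er_division[of x y] nu[of x y] nu[of y x] * by (auto simp: add.commute)
  qed
  then show ?case using insert.hyps er_add[OF B *(1,3)] by (simp add: x_def y_def)
qed

text \<open>The terms \<open>t i\<close> of the minimal polynomial at \<open>x\<close> sum to
  \<open>0\<close>, so the least value occurs twice: otherwise, after division by a dominant term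
  \<open>t i0\<close>, nonunits would add up to \<open>- 1\<close>. Two terms of equal value say
  that a power of \<open>x\<close> is a constant up to a unit.\<close>

lemma value_witness:
  assumes x: "x \<noteq> 0"
  shows "\<exists>k c. k \<ge> 1 \<and> c \<noteq> 0 \<and> unit_in (x ^ k / \<iota> c)"
proof -
  obtain p where p: "is_minpoly p x" using minpoly_exists by blast
  define I where "I = {i. i \<le> degree p \<and> coeff p i \<noteq> 0}"
  define t where "t i = \<iota> (coeff p i) * x ^ i" for i
  have I: "finite I" "I \<noteq> {}" using is_minpolyD(1)[OF p] by (auto simp: I_def intro: exI[of _ "degree p"])
  have t0: "t i \<noteq> 0" if "i \<in> I" for i using that x by (simp add: I_def t_def)
  have "\<exists>i0\<in>I. \<forall>i\<in>I. t i / t i0 \<in> B"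
    using I t0
  proof (induction I rule: finite_ne_induct)
    case (singleton i)
    then show ?case by (simp add: er_1[OF B])
  next
    case (insert i I)
    then obtain i0 where i0: "i0 \<in> I" "\<forall>j\<in>I. t j / t i0 \<in> B" by auto
    show ?case
    proof (cases "t i / t i0 \<in> B")
      case True
      then show ?thesis using i0 by auto
    next
      case False
      then have *: "t i0 / t i \<in> B" using er_division[of "t i" "t i0"] insert.prems i0 by auto
      have "t j / t i \<in> B" if "j \<in> insert i I" for j
      proof (cases "j = i")
        case True
        then show ?thesis using insert.prems by (simp add: er_1[OF B])
      next
        case False
        then have "t j / t i0 * (t i0 / t i) \<in> B" using that i0 * by (intro er_mult[OF B]) auto
        then show ?thesis using insert.prems i0 by simp
      qed
      then show ?thesis by blast
    qed
  qed
  then obtain i0 where i0: "i0 \<in> I" "\<And>i. i \<in> I \<Longrightarrow> t i / t i0 \<in> B" by blast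
  have "\<exists>i\<in>I - {i0}. unit_in (t i / t i0)"
  proof (rule ccontr)
    assume no: "\<not> ?thesis"
    have "(\<Sum>i\<in>I. t i) = poly (lift p) x"
      unfolding poly_altdef t_def I_def by (auto intro!: sum.mono_neutral_cong_left)
    also have "\<dots> = 0" using is_minpolyD(2)[OF p] .
    finally have "t i0 + (\<Sum>i\<in>I - {i0}. t i) = 0"
      using sum.remove[OF I(1) i0(1), of t] by simp
    then have "(\<Sum>i\<in>I - {i0}. t i) = - t i0" by (simp add: eq_neg_iff_add_eq_0 add.commute)
    then have "(\<Sum>i\<in>I - {i0}. t i / t i0) = - 1"
      using t0[OF i0(1)] by (simp flip: sum_divide_distrib)
    moreover have "\<not> unit_in (\<Sum>i\<in>I - {i0}. t i / t i0)"
      using nonunit_sum[of "I - {i0}" "\<lambda>i. t i / t i0"] I no i0 by auto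
    ultimately show False using unit_in_const[of "- 1"] by (simp add: hom_uminus)
  qed
  then obtain i where i: "i \<in> I" "i \<noteq> i0" "unit_in (t i / t i0)" by blast
  have *: "\<exists>k c. k \<ge> 1 \<and> c \<noteq> 0 \<and> unit_in (x ^ k / \<iota> c)"
    if ij: "i \<in> I" "j \<in> I" "i < j" "unit_in (t j / t i)" for i j
  proof -
    have "t j / t i = x ^ (j - i) / \<iota> (coeff p i / coeff p j)"
      using ij x by (simp add: t_def I_def emb_divide power_diff mult.commute)
    then show ?thesis
      using ij by (intro exI[of _ "j - i"] exI[of _ "coeff p i / coeff p j"]) (auto simp: I_def)
  qed
  show ?thesis
  proof (cases "i < i0")
    case True
    then show ?thesis using *[OF i(1) i0(1)] unit_in_inverse[OF i(3)] by simp
  next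
    case False
    then show ?thesis using *[OF i0(1) i(1)] i by simp
  qed
qed

text \<open>The value is \<open>v c / k\<close>, written without division; it exists in
  \<open>'g\<close> by divisibility.\<close>

definition is_value :: "'e \<Rightarrow> 'g \<Rightarrow> bool" where
  "is_value x \<gamma> \<longleftrightarrow> (\<exists>k c. k \<ge> 1 \<and> c \<noteq> 0 \<and> unit_in (x ^ k / \<iota> c) \<and> v c = Fin (nsm k \<gamma>))"

lemma is_value_exists: "x \<noteq> 0 \<Longrightarrow> \<exists>\<gamma>. is_value x \<gamma>"
proof -
  assume "x \<noteq> 0"
  then obtain k c where kc: "k \<ge> 1" "c \<noteq> 0" "unit_in (x ^ k / \<iota> c)" using value_witness by blast
  obtain \<gamma> where "v c = Fin \<gamma>" using val_Fin[OF kc(2)] by blast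
  then have "v c = Fin (nsm k (ndiv k \<gamma>))" using nsm_ndiv[OF divisible, of k \<gamma>] kc(1) by simp
  then show ?thesis using kc unfolding is_value_def by blast
qed

lemma is_value_unique: "is_value x \<gamma> \<Longrightarrow> is_value x \<gamma>' \<Longrightarrow> \<gamma> = \<gamma>'"
proof -
  assume "is_value x \<gamma>" "is_value x \<gamma>'"
  then obtain k c l d where *: "k \<ge> 1" "c \<noteq> 0" "unit_in (x ^ k / \<iota> c)" "v c = Fin (nsm k \<gamma>)"
    "l \<ge> 1" "d \<noteq> 0" "unit_in (x ^ l / \<iota> d)" "v d = Fin (nsm l \<gamma>')"
    unfolding is_value_def by blast
  have "x \<noteq> 0" using * by (auto simp: unit_in_def)
  have "unit_in ((x ^ k / \<iota> c) ^ l * inverse ((x ^ l / \<iota> d) ^ k))"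
    by (intro unit_in_mult unit_in_inverse unit_in_power *)
  also have "(x ^ k / \<iota> c) ^ l * inverse ((x ^ l / \<iota> d) ^ k) = \<iota> (d ^ k / c ^ l)"
  proof -
    have "(x ^ k) ^ l = (x ^ l) ^ k" by (simp add: mult.commute flip: power_mult)
    then show ?thesis using \<open>x \<noteq> 0\<close> * by (simp add: power_divide emb_divide hom_power)
  qed
  finally have "v (d ^ k / c ^ l) = Fin 0" by (simp add: unit_in_const)
  moreover have "v (d ^ k / c ^ l) = Fin (nsm k (nsm l \<gamma>') - nsm l (nsm k \<gamma>))"
    by (intro val_divide val_power_Fin *)
  ultimately have "nsm (k * l) \<gamma>' = nsm (k * l) \<gamma>"
    by (simp add: nsm_mult[symmetric] mult.commute)
  then show ?thesis using *(1,5) nsm_eq_iff[of "k * l" \<gamma>' \<gamma>] by simp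
qed

lemma is_value_mult: "is_value x \<gamma> \<Longrightarrow> is_value y \<gamma>' \<Longrightarrow> is_value (x * y) (\<gamma> + \<gamma>')"
proof -
  assume "is_value x \<gamma>" "is_value y \<gamma>'"
  then obtain k c l d where *: "k \<ge> 1" "c \<noteq> 0" "unit_in (x ^ k / \<iota> c)" "v c = Fin (nsm k \<gamma>)"
    "l \<ge> 1" "d \<noteq> 0" "unit_in (y ^ l / \<iota> d)" "v d = Fin (nsm l \<gamma>')"
    unfolding is_value_def by blast
  have "unit_in ((x ^ k / \<iota> c) ^ l * (y ^ l / \<iota> d) ^ k)"
    by (intro unit_in_mult unit_in_power *)
  also have "(x ^ k / \<iota> c) ^ l * (y ^ l / \<iota> d) ^ k = (x * y) ^ (k * l) / \<iota> (c ^ l * d ^ k)"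
  proof -
    have "(x ^ k) ^ l = x ^ (k * l)" "(y ^ l) ^ k = y ^ (k * l)"
      by (simp_all add: mult.commute flip: power_mult)
    then show ?thesis by (simp add: power_divide hom_mult hom_power power_mult_distrib)
  qed
  finally have "unit_in ((x * y) ^ (k * l) / \<iota> (c ^ l * d ^ k))" .
  moreover have "v (c ^ l * d ^ k) = Fin (nsm l (nsm k \<gamma>) + nsm k (nsm l \<gamma>'))"
    by (intro val_mult_Fin val_power_Fin *)
  then have "v (c ^ l * d ^ k) = Fin (nsm (k * l) (\<gamma> + \<gamma>'))"
    by (simp add: nsm_add_right nsm_mult[symmetric] mult.commute)
  ultimately show ?thesis
    unfolding is_value_def using *(1,2,5,6)
    by (intro exI[of _ "k * l"] exI[of _ "c ^ l * d ^ k"]) auto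
qed

lemma is_value_const: "v c = Fin \<gamma> \<Longrightarrow> is_value (\<iota> c) \<gamma>"
proof -
  assume c: "v c = Fin \<gamma>"
  then have "c \<noteq> 0" by auto
  then show ?thesis unfolding is_value_def
    using c unit_in_const[of 1] by (intro exI[of _ 1] exI[of _ c]) simp
qed

lemma is_value_nonneg: "is_value z \<gamma> \<Longrightarrow> 0 \<le> \<gamma> \<longleftrightarrow> z \<in> B"
proof -
  assume "is_value z \<gamma>"
  then obtain k c where *: "k \<ge> 1" "c \<noteq> 0" "unit_in (z ^ k / \<iota> c)" "v c = Fin (nsm k \<gamma>)"
    unfolding is_value_def by blast
  have z: "z \<noteq> 0" using * by (auto simp: unit_in_def)
  have u: "z ^ k / \<iota> c \<in> B" "\<iota> c / z ^ k \<in> B" using *(3) by (auto simp: unit_in_def)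
  have "0 \<le> \<gamma> \<longleftrightarrow> Fin 0 \<le> v c" using *(1) nsm_le_iff[of k 0 \<gamma>] by (simp add: *(4))
  also have "\<dots> \<longleftrightarrow> \<iota> c \<in> B" by (simp add: er_const[OF B])
  also have "\<dots> \<longleftrightarrow> z ^ k \<in> B"
    using er_mult[OF B u(1), of "\<iota> c"] er_mult[OF B u(2), of "z ^ k"] z *(2) by auto
  also have "\<dots> \<longleftrightarrow> z \<in> B"
  proof
    assume zk: "z ^ k \<in> B"
    show "z \<in> B"
    proof (rule ccontr)
      assume "z \<notin> B"
      then have "inverse z \<in> B" using val_ring z by blast
      \<comment> \<open>Integral closedness of a valuation ring, here through the identity
        \<open>z = z^k * (1 / z)^(k - 1)\<close>.\<close>
      then have "z ^ k * inverse z ^ (k - 1) \<in> B" by (intro er_mult[OF B zk] er_power[OF B])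
      moreover have "z ^ k * inverse z ^ (k - 1) = z"
      proof -
        have "z ^ k = z * z ^ (k - 1)" using *(1) by (cases k) auto
        then show ?thesis using z by (simp add: power_inverse mult.assoc)
      qed
      ultimately show False using \<open>z \<notin> B\<close> by simp
    qed
  qed (rule er_power[OF B])
  finally show ?thesis .
qed

definition ext_val :: "'e \<Rightarrow> 'g extended" where
  "ext_val x = (if x = 0 then Pinf else Fin (SOME \<gamma>. is_value x \<gamma>))"

lemma ext_val_eq: "is_value x \<gamma> \<Longrightarrow> ext_val x = Fin \<gamma>"
proof -
  assume *: "is_value x \<gamma>"
  then have "x \<noteq> 0" by (auto simp: is_value_def unit_in_def)
  moreover have "is_value x (SOME \<gamma>. is_value x \<gamma>)" using * by (rule someI)
  ultimately show ?thesis using is_value_unique[OF _ *] by (simp add: ext_val_def)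
qed

lemma ext_val_Fin: "x \<noteq> 0 \<Longrightarrow> \<exists>\<gamma>. is_value x \<gamma> \<and> ext_val x = Fin \<gamma>"
  using is_value_exists ext_val_eq by blast

lemma ext_val_mult: "ext_val (x * y) = ext_val x + ext_val y"
proof (cases "x = 0 \<or> y = 0")
  case True
  then show ?thesis
    using ext_val_Fin[of x] ext_val_Fin[of y] by (auto simp: ext_val_def)
next
  case False
  then obtain \<gamma> \<gamma>' where "is_value x \<gamma>" "is_value y \<gamma>'" using is_value_exists by blast
  then show ?thesis using is_value_mult[of x \<gamma> y \<gamma>'] by (simp add: ext_val_eq)
qed

lemma ext_val_nonneg: "Fin 0 \<le> ext_val z \<longleftrightarrow> z \<in> B"
proof (cases "z = 0")
  case True
  then show ?thesis by (simp add: er_0[OF B] ext_val_def)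
next
  case False
  then show ?thesis using ext_val_Fin is_value_nonneg by fastforce
qed

lemma ext_val_add_aux:
  assumes "x \<noteq> 0" "y / x \<in> B"
  shows "ext_val x \<le> ext_val (x + y)"
proof -
  obtain \<gamma> where \<gamma>: "ext_val x = Fin \<gamma>" using ext_val_Fin[OF assms(1)] by blast
  have "1 + y / x \<in> B" using assms(2) by (intro er_add[OF B] er_1[OF B])
  then have "Fin 0 \<le> ext_val (1 + y / x)" by (simp add: ext_val_nonneg)
  moreover have "x + y = x * (1 + y / x)" using assms(1) by (simp add: field_simps)
  then have "ext_val (x + y) = ext_val x + ext_val (1 + y / x)" by (simp only: ext_val_mult)
  ultimately show ?thesis by (cases "ext_val (1 + y / x)") (auto simp: \<gamma>)
qed

lemma ext_val_add: "min (ext_val x) (ext_val y) \<le> ext_val (x + y)"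
proof (cases "x = 0 \<or> y = 0")
  case False
  then show ?thesis
    using er_division[of x y] ext_val_add_aux[of x y] ext_val_add_aux[of y x]
    by (auto simp: add.commute min_le_iff_disj)
qed auto

lemma ring_valuation_ext_val: "ring_valuation ext_val"
proof
  show "ext_val 1 = Fin 0" using is_value_const[of 1 0] by (simp add: ext_val_eq)
qed (simp_all add: ext_val_mult ext_val_add, simp_all add: ext_val_def)

lemma ext_val_const: "ext_val (\<iota> c) = v c"
proof (cases "c = 0")
  case False
  then show ?thesis using val_Fin[OF False] is_value_const ext_val_eq by metis
qed (simp add: ext_val_def)

lemma ext_val_eq_Pinf: "ext_val x = Pinf \<longleftrightarrow> x = 0"
  by (simp add: ext_val_def)

end

lemma valuation_extension:
  "\<exists>w :: 'e \<Rightarrow> 'g extended. ring_valuation w \<and> (\<forall>c. w (\<iota> c) = v c) \<and> (\<forall>x. w x = Pinf \<longleftrightarrow> x = 0)"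
proof -
  obtain B where "ext_ring B" "\<And>x. x \<noteq> 0 \<Longrightarrow> x \<in> B \<or> inverse x \<in> B"
    using valuation_ring_exists by blast
  note B = this
  show ?thesis
    using ring_valuation_ext_val[OF B] ext_val_const[OF B] ext_val_eq_Pinf[OF B] by blast
qed

end

subsection \<open>Henselian fields\<close>

context ring_valuation
begin

lemma val_of_nat_ge: "Fin 0 \<le> u (of_nat n)"
  by (induction n) (auto intro: val_add_ge)

lemma val_poly_ge_0:
  assumes "\<And>i. Fin 0 \<le> u (coeff p i)" "Fin 0 \<le> u x"
  shows "Fin 0 \<le> u (poly p x)"
  unfolding poly_altdef
  using val_mult_ge[OF assms(1) val_power_ge[OF assms(2)]] by (intro val_sum_ge) simp

lemma val_prod_mset_ge:
  "(\<And>a. a \<in># A \<Longrightarrow> Fin \<alpha> \<le> u (f a)) \<Longrightarrow> Fin (nsm (size A) \<alpha>) \<le> u (\<Prod>a\<in>#A. f a)"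
proof (induction A)
  case (add a A)
  then show ?case using val_mult_ge[of \<alpha> "f a" "nsm (size A) \<alpha>" "\<Prod>a\<in>#A. f a"]
    by (simp add: add.commute)
qed simp

lemma val_prod_mset_gt:
  assumes "\<And>a. a \<in># A \<Longrightarrow> Fin \<alpha> \<le> u (f a)" "a0 \<in># A" "Fin \<alpha> < u (f a0)"
  shows "Fin (nsm (size A) \<alpha>) < u (\<Prod>a\<in>#A. f a)"
proof -
  obtain A' where A: "A = add_mset a0 A'" using assms(2) by (meson multi_member_split)
  then have "Fin (nsm (size A') \<alpha>) \<le> u (\<Prod>a\<in>#A'. f a)" using assms(1) by (intro val_prod_mset_ge) auto
  from val_mult_gt[OF assms(3) this] show ?thesis by (simp add: A add.commute)
qed

lemma val_prod_mset_eq: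
  "(\<And>a. a \<in># A \<Longrightarrow> u (f a) = Fin \<alpha>) \<Longrightarrow> u (\<Prod>a\<in>#A. f a) = Fin (nsm (size A) \<alpha>)"
proof (induction A)
  case (add a A)
  then show ?case using val_mult_Fin[of "f a" \<alpha> "\<Prod>a\<in>#A. f a" "nsm (size A) \<alpha>"]
    by (simp add: add.commute)
qed simp

lemma val_eq_0_if_near_1: "Fin 0 < u (x - 1) \<Longrightarrow> u x = Fin 0"
  using val_add_eq[of 1 "x - 1"] by simp

end

lemma prod_linear_nonzero:
  fixes A :: "'a::idom multiset"
  shows "(\<Prod>a\<in>#A. [:- a, 1:]) \<noteq> 0"
  by auto

lemma prod_linear_eq_iff:
  fixes A B :: "'a::idom multiset"
  shows "(\<Prod>a\<in>#A. [:- a, 1:]) = (\<Prod>a\<in>#B. [:- a, 1:]) \<longleftrightarrow> A = B"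
proof -
  have "proots (\<Prod>a\<in>#A. [:- a, 1:]) = A" for A :: "'a multiset"
  proof (induction A)
    case (add a A)
    have "proots ([:- a, 1:] * (\<Prod>a\<in>#A. [:- a, 1:])) = {#a#} + A"
      using prod_linear_nonzero by (subst proots_mult) (auto simp: add)
    then show ?case by (simp del: mult_pCons_left)
  qed simp
  then show ?thesis by metis
qed

lemma poly_prod_linear:
  fixes A :: "'a::comm_ring_1 multiset"
  shows "poly (\<Prod>a\<in>#A. [:- a, 1:]) x = (\<Prod>a\<in>#A. x - a)"
  by (induction A) (auto simp: algebra_simps)

lemma lead_coeff_prod_linear:
  fixes A :: "'a::idom multiset"
  shows "lead_coeff (\<Prod>a\<in>#A. [:- a, 1:]) = 1"
  by (induction A) (simp_all add: lead_coeff_mult del: mult_pCons_left)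

lemma degree_prod_linear:
  fixes A :: "'a::idom multiset"
  shows "degree (\<Prod>a\<in>#A. [:- a, 1:]) = size A"
proof (induction A)
  case (add a A)
  have "degree ([:- a, 1:] * (\<Prod>a\<in>#A. [:- a, 1:])) = 1 + size A"
    using prod_linear_nonzero by (subst degree_mult_eq) (auto simp: add)
  then show ?case by (simp del: mult_pCons_left)
qed simp

lemma alg_closed_monic_factorization:
  fixes p :: "'a::alg_closed_field poly"
  assumes "lead_coeff p = 1"
  obtains A where "p = (\<Prod>a\<in>#A. [:- a, 1:])" "size A = degree p"
proof -
  have "p \<noteq> 0" using assms by auto
  then show thesis using alg_closed_imp_factorization[of p] that assms by auto
qed

lemma poly_prod_linear_eq_0_iff:
  fixes A :: "'a::idom multiset"
  shows "poly (\<Prod>a\<in>#A. [:- a, 1:]) x = 0 \<longleftrightarrow> x \<in># A"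
  by (auto simp: poly_prod_linear prod_mset_zero_iff)

section \<open>Equal values of conjugates and uniqueness of the extended valuation\<close>

locale henselian_ext = valued_alg_closed_ext \<iota> v + w: ring_valuation w
  for \<iota> :: "'k::field \<Rightarrow> 'e::alg_closed_field"
    and v :: "'k \<Rightarrow> 'g::linordered_ab_group_add extended"
    and w :: "'e \<Rightarrow> 'g extended" +
  assumes w_emb [simp]: "w (\<iota> c) = v c" and w_eq_Pinf: "w x = Pinf \<longleftrightarrow> x = 0"
    and henselian: "henselian v"
begin

definition conj_map :: "('e \<Rightarrow> 'e) \<Rightarrow> bool" where
  "conj_map \<tau> \<longleftrightarrow> ring_hom_map \<tau> \<and> (\<forall>c. \<tau> (\<iota> c) = \<iota> c)"

lemma conj_map_exists:
  "is_minpoly p x \<Longrightarrow> poly (lift p) y = 0 \<Longrightarrow> \<exists>\<tau>. conj_map \<tau> \<and> \<tau> x = y"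
  using conj_hom unfolding conj_map_def by blast

lemma conj_map_lift: "conj_map \<tau> \<Longrightarrow> map_poly \<tau> (lift p) = lift p"
  by (rule poly_eqI) (simp add: conj_map_def coeff_map_poly ring_hom_map.hom_0)

text \<open>Applied to coefficients, \<open>\<tau>\<close> fixes \<open>lift p\<close>; by unique
  factorisation it permutes the roots, multiplicities included.\<close>

lemma conj_map_roots:
  assumes "conj_map \<tau>" "lift p = (\<Prod>a\<in>#A. [:- a, 1:])"
  shows "image_mset \<tau> A = A"
proof -
  interpret \<tau>: ring_hom_map \<tau> using assms(1) by (simp add: conj_map_def)
  interpret T: ring_hom_map "map_poly \<tau>" by (rule \<tau>.map_poly_ring_hom)
  have "map_poly \<tau> (\<Prod>a\<in>#A. [:- a, 1:]) = (\<Prod>a\<in>#image_mset \<tau> A. [:- a, 1:])"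
    by (simp add: T.hom_prod_mset image_mset.compositionality comp_def map_poly_pCons \<tau>.hom_uminus)
  then have "(\<Prod>a\<in>#image_mset \<tau> A. [:- a, 1:]) = (\<Prod>a\<in>#A. [:- a, 1:])"
    using conj_map_lift[OF assms(1), of p] assms(2) by simp
  then show ?thesis by (simp add: prod_linear_eq_iff)
qed

lemma pderiv_lift: "pderiv (lift p) = lift (pderiv p)"
proof -
  have "\<iota> (of_nat n) = of_nat n" for n by (induction n) (auto simp: hom_add)
  then show ?thesis by (intro poly_eqI) (simp add: coeff_pderiv hom_mult hom_add)
qed

text \<open>If the derivative vanishes, all exponents are divisible by the characteristic
  \<open>q\<close>, so \<open>p(x) = r(x^q)\<close> for a polynomial \<open>r\<close> of smaller
  degree.\<close>

lemma lift_frobenius: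
  assumes "pderiv p = 0" "degree p \<ge> 1"
  shows "\<exists>q r. q \<ge> 1 \<and> r \<noteq> 0 \<and> degree r < degree p \<and>
    (\<forall>x. poly (lift p) x = poly (lift r) (x ^ q))"
proof -
  define q where "q = CHAR('k)"
  have dvd: "q dvd i" if "coeff p i \<noteq> 0" for i
  proof (cases i)
    case (Suc j)
    have "coeff (pderiv p) j = 0" using assms(1) by simp
    then have "of_nat i = (0 :: 'k)" using that Suc by (simp add: coeff_pderiv)
    then show ?thesis by (simp add: q_def of_nat_eq_0_iff_char_dvd)
  qed simp
  define d where "d = degree p"
  have cd: "coeff p d \<noteq> 0" using assms(2) by (auto simp: d_def)
  then have "q dvd d" by (rule dvd)
  have "q \<noteq> 1" by (simp add: q_def)
  \<comment> \<open>This rules out characteristic \<open>0\<close>, where \<open>0 dvd d\<close>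
    would force \<open>d = 0\<close>.\<close>
  moreover have "q \<noteq> 0" using \<open>q dvd d\<close> assms(2) by (auto simp: d_def)
  ultimately have q: "q \<ge> 2" by linarith
  define r where "r = (\<Sum>i\<le>d div q. monom (coeff p (q * i)) i)"
  have coeff_r: "coeff r i = (if i \<le> d div q then coeff p (q * i) else 0)" for i
    by (auto simp: r_def coeff_sum)
  have "degree r \<le> d div q" by (rule degree_le) (simp add: coeff_r)
  also have "d div q < d" using q assms(2) by (simp add: d_def)
  finally have 1: "degree r < d" .
  have "coeff r (d div q) = coeff p d" using \<open>q dvd d\<close> by (simp add: coeff_r)
  then have 2: "r \<noteq> 0" using cd by auto
  have 3: "poly (lift p) x = poly (lift r) (x ^ q)" for x
  proof -
    have "poly (lift p) x = (\<Sum>i\<in>(\<lambda>i. q * i) ` {..d div q}. \<iota> (coeff p i) * x ^ i)"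
      unfolding poly_altdef degree_lift coeff_lift d_def[symmetric]
    proof (rule sum.mono_neutral_right)
      show "(\<lambda>i. q * i) ` {..d div q} \<subseteq> {..d}" using q
        by (auto simp: less_eq_div_iff_mult_less_eq mult.commute)
      show "\<forall>i\<in>{..d} - (\<lambda>i. q * i) ` {..d div q}. \<iota> (coeff p i) * x ^ i = 0"
      proof
        fix i assume i: "i \<in> {..d} - (\<lambda>i. q * i) ` {..d div q}"
        have "coeff p i = 0"
        proof (rule ccontr)
          assume "coeff p i \<noteq> 0"
          then obtain j where "i = q * j" using dvd by blast
          then show False using i q by (auto simp: less_eq_div_iff_mult_less_eq mult.commute)
        qed
        then show "\<iota> (coeff p i) * x ^ i = 0" by simp
      qed
    qed simp
    also have "\<dots> = (\<Sum>i\<le>d div q. \<iota> (coeff p (q * i)) * x ^ (q * i))"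
      using q by (subst sum.reindex) (auto simp: inj_on_def)
    also have "\<dots> = (\<Sum>i\<le>d div q. \<iota> (coeff r i) * (x ^ q) ^ i)"
      by (rule sum.cong) (auto simp: coeff_r power_mult)
    also have "\<dots> = poly (lift r) (x ^ q)"
      unfolding poly_altdef degree_lift coeff_lift
      by (rule sum.mono_neutral_right) (use \<open>degree r \<le> d div q\<close> in \<open>auto simp: coeff_eq_0\<close>)
    finally show ?thesis .
  qed
  show ?thesis using 1 2 3 q by (intro exI[of _ q] exI[of _ r]) (auto simp: d_def)
qed

text \<open>Among the powers of \<open>\<xi>\<close> the one of least degree over \<open>K\<close> is separable, since otherwise its
  \<open>p\<close>-th power would have smaller degree.\<close>

lemma separable_power:
  obtains j \<mu> where "j \<ge> 1" "is_minpoly \<mu> (\<xi> ^ j)" "poly (lift (pderiv \<mu>)) (\<xi> ^ j) \<noteq> 0"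
proof -
  define D where "D d \<longleftrightarrow> (\<exists>j \<mu>. j \<ge> 1 \<and> is_minpoly \<mu> (\<xi> ^ j) \<and> degree \<mu> = d)" for d
  obtain \<mu>0 where "is_minpoly \<mu>0 (\<xi> ^ 1)" using minpoly_exists by blast
  then have "D (degree \<mu>0)" unfolding D_def by (intro exI[of _ 1] exI[of _ \<mu>0]) simp
  then have L: "D (LEAST d. D d)" by (rule LeastI)
  then obtain j \<mu> where j: "j \<ge> 1" "is_minpoly \<mu> (\<xi> ^ j)" "degree \<mu> = (LEAST d. D d)"
    unfolding D_def by blast
  have pd: "pderiv \<mu> \<noteq> 0"
  proof
    assume "pderiv \<mu> = 0"
    then obtain q r where qr: "q \<ge> 1" "r \<noteq> 0" "degree r < degree \<mu>"
      "\<And>x. poly (lift \<mu>) x = poly (lift r) (x ^ q)"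
      using lift_frobenius[of \<mu>] minpoly_degree[OF j(2)] by blast
    obtain \<rho> where \<rho>: "is_minpoly \<rho> (\<xi> ^ (j * q))" using minpoly_exists by blast
    have "poly (lift r) (\<xi> ^ (j * q)) = 0"
      using is_minpolyD(2)[OF j(2)] by (simp add: qr(4) power_mult)
    then have "\<rho> dvd r" using is_minpolyD(3)[OF \<rho>] by blast
    then have "degree \<rho> < degree \<mu>" using dvd_imp_degree_le[OF _ qr(2)] qr(3) by fastforce
    moreover have "D (degree \<rho>)" unfolding D_def using \<rho> j(1) qr(1)
      by (intro exI[of _ "j * q"] exI[of _ \<rho>]) simp
    then have "(LEAST d. D d) \<le> degree \<rho>" by (rule Least_le)
    ultimately show False using j(3) by simp
  qed
  have "poly (lift (pderiv \<mu>)) (\<xi> ^ j) \<noteq> 0"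
  proof
    assume "poly (lift (pderiv \<mu>)) (\<xi> ^ j) = 0"
    then have "\<mu> dvd pderiv \<mu>" using is_minpolyD(3)[OF j(2)] by blast
    then have "degree \<mu> \<le> degree (pderiv \<mu>)" using pd by (intro dvd_imp_degree_le)
    moreover have "degree (pderiv \<mu>) \<le> degree \<mu> - 1"
      by (rule degree_le) (auto simp: coeff_pderiv coeff_eq_0)
    ultimately show False using minpoly_degree[OF j(2)] by linarith
  qed
  with j show thesis using that by blast
qed

text \<open>A separable power of \<open>\<xi>\<close> is a simple root near \<open>1\<close> of its minimal polynomial, whose other
  roots lie in the maximal ideal; hence the henselian property puts it into \<open>K\<close>.\<close>

lemma isolated_unit_power_rational:
  assumes near: "Fin 0 < w (\<xi> - 1)"
    and conj: "\<And>\<tau>. conj_map \<tau> \<Longrightarrow> \<tau> \<xi> = \<xi> \<or> Fin 0 < w (\<tau> \<xi>)"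
  shows "\<exists>j s. j \<ge> 1 \<and> \<xi> ^ j = \<iota> s"
proof -
  have val\<xi>: "w \<xi> = Fin 0" by (rule w.val_eq_0_if_near_1[OF near])
  obtain j \<mu> where j: "j \<ge> 1" "is_minpoly \<mu> (\<xi> ^ j)" "poly (lift (pderiv \<mu>)) (\<xi> ^ j) \<noteq> 0"
    by (rule separable_power)
  define \<eta> where "\<eta> = \<xi> ^ j"
  note \<mu> = is_minpolyD[OF j(2)[folded \<eta>_def]]
  have val_pow: "w (\<xi> ^ n) = Fin 0" for n using w.val_power_Fin[OF val\<xi>, of n] by simp
  have "Fin 0 < w (\<xi> ^ n - 1)" for n
  proof (induction n)
    case (Suc n)
    have "Fin (0 + 0) < w ((\<xi> - 1) * \<xi> ^ n)" using near val_pow[of n] by (intro w.val_mult_gt) auto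
    then have "Fin 0 < w ((\<xi> - 1) * \<xi> ^ n + (\<xi> ^ n - 1))" using Suc by (intro w.val_add_gt) auto
    then show ?case by (simp add: algebra_simps)
  qed simp
  then have near\<eta>: "Fin 0 < w (\<eta> - 1)" by (simp add: \<eta>_def)
  then have near\<eta>': "Fin 0 < w (1 - \<eta>)" by (simp add: w.val_diff_commute)
  have val\<eta>: "w \<eta> = Fin 0" by (simp add: \<eta>_def val_pow)
  obtain M where M: "lift \<mu> = (\<Prod>a\<in>#M. [:- a, 1:])"
    using alg_closed_monic_factorization[of "lift \<mu>"] \<mu>(1) by auto
  have "\<eta> \<in># M" using \<mu>(2) by (simp add: M poly_prod_linear_eq_0_iff)
  then obtain M' where M': "M = add_mset \<eta> M'" by (meson multi_member_split)
  define S where "S = (\<Prod>a\<in>#M'. [:- a, 1:])"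
  have \<mu>S: "lift \<mu> = [:- \<eta>, 1:] * S" by (simp add: M M' S_def)
  have pd: "pderiv (lift \<mu>) = S + [:- \<eta>, 1:] * pderiv S"
    unfolding \<mu>S pderiv_mult by (simp add: pderiv_pCons one_pCons)
  have "\<eta> \<notin># M'"
  proof
    assume "\<eta> \<in># M'"
    then have "poly S \<eta> = 0" by (simp add: S_def poly_prod_linear_eq_0_iff)
    then have "poly (pderiv (lift \<mu>)) \<eta> = 0" unfolding pd by simp
    then show False using j(3) by (simp add: pderiv_lift \<eta>_def)
  qed
  \<comment> \<open>Such a root is \<open>\<tau> \<eta> = (\<tau> \<xi>)^j\<close> for some
    conjugation \<open>\<tau>\<close>. It differs from \<open>\<eta>\<close>, a simple root, so
    \<open>\<tau> \<xi> \<noteq> \<xi>\<close> and the hypothesis on conjugates applies.\<close>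
  have small: "Fin 0 < w a" if "a \<in># M'" for a
  proof -
    have "poly (lift \<mu>) a = 0" using that by (simp add: M M' poly_prod_linear_eq_0_iff)
    then obtain \<tau> where \<tau>: "conj_map \<tau>" "\<tau> \<eta> = a"
      using conj_map_exists[OF j(2)[folded \<eta>_def]] by blast
    interpret \<tau>: ring_hom_map \<tau> using \<tau>(1) by (simp add: conj_map_def)
    have a: "a = \<tau> \<xi> ^ j" using \<tau>(2) by (simp add: \<eta>_def \<tau>.hom_power)
    have "a \<noteq> \<eta>" using that \<open>\<eta> \<notin># M'\<close> by auto
    then have "\<tau> \<xi> \<noteq> \<xi>" using a by (auto simp: \<eta>_def)
    then have "Fin 0 < w (\<tau> \<xi>)" using conj[OF \<tau>(1)] by blast
    then show ?thesis using w.val_power_gt[of 0 "\<tau> \<xi>" j] j(1) by (simp add: a)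
  qed
  have coeff_ge: "Fin 0 \<le> w (coeff (\<Prod>a\<in>#N. [:- a, 1:]) i)"
    if "\<And>a. a \<in># N \<Longrightarrow> Fin 0 \<le> w a" for N i
    using w.gauss_ge_prod_linear[of N 0 "\<lambda>a. - a"] that by (simp add: w.gauss_ge_def)
  have intM: "Fin 0 \<le> w a" if "a \<in># M" for a
    using that small val\<eta> by (auto simp: M' less_imp_le)
  \<comment> \<open>This prepares Hensel's condition at \<open>1\<close>: with
    \<open>\<mu> = (y - \<eta>) * S\<close> and \<open>S(1)\<close> a product of units
    \<open>1 - a\<close>, the value of \<open>\<mu>(1)\<close> is positive, and the derivative at
    \<open>1\<close> differs from \<open>S(1)\<close> by an element of positive value.\<close>
  have S1: "w (poly S 1) = Fin 0"
  proof -
    have "w (1 - a) = Fin 0" if "a \<in># M'" for a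
      using w.val_add_eq[of 1 "- a"] small[OF that] by simp
    then have "w (\<Prod>a\<in>#M'. 1 - a) = Fin (nsm (size M') 0)" by (rule w.val_prod_mset_eq)
    then show ?thesis by (simp add: S_def poly_prod_linear)
  qed
  have "v (coeff \<mu> i) \<ge> 0" for i
    using coeff_ge[of M i] intM by (simp add: zero_extended_def flip: M)
  moreover have "v (poly \<mu> 1) > 0"
  proof -
    have "\<iota> (poly \<mu> 1) = (1 - \<eta>) * poly S 1"
      using poly_map_poly[of \<mu> 1] by (simp add: \<mu>S algebra_simps)
    moreover have "Fin (0 + 0) < w ((1 - \<eta>) * poly S 1)"
      using near\<eta>' S1 by (intro w.val_mult_gt) auto
    ultimately show ?thesis unfolding zero_extended_def by (metis add_0 w_emb)
  qed
  moreover have "v (poly (pderiv \<mu>) 1) = 0"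
  proof -
    have coeffS: "Fin 0 \<le> w (coeff S i)" for i
      unfolding S_def using small by (intro coeff_ge) (auto simp: less_imp_le)
    have "Fin 0 \<le> w (poly (pderiv S) 1)"
    proof (rule w.val_poly_ge_0)
      fix i
      have "Fin (0 + 0) \<le> w (of_nat (Suc i) * coeff S (Suc i))"
        by (intro w.val_mult_ge w.val_of_nat_ge coeffS)
      then show "Fin 0 \<le> w (coeff (pderiv S) i)" by (simp add: coeff_pderiv)
    qed simp
    then have "Fin (0 + 0) < w ((1 - \<eta>) * poly (pderiv S) 1)"
      using near\<eta>' by (intro w.val_mult_gt)
    then have "w (poly S 1 + (1 - \<eta>) * poly (pderiv S) 1) = Fin 0"
      using w.val_add_eq[of "poly S 1"] S1 by simp
    moreover have "\<iota> (poly (pderiv \<mu>) 1) = poly S 1 + (1 - \<eta>) * poly (pderiv S) 1"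
      using poly_map_poly[of "pderiv \<mu>" 1] unfolding pderiv_lift[symmetric] pd by (simp add: algebra_simps)
    ultimately show ?thesis unfolding zero_extended_def by (metis w_emb)
  qed
  ultimately obtain s where s: "poly \<mu> s = 0" "v (s - 1) > 0"
    using henselian \<mu>(1) unfolding henselian_def by (metis val_1 zero_extended_def order_refl)
  have "poly (lift \<mu>) (\<iota> s) = 0" using s(1) by (simp add: poly_map_poly)
  then have "\<iota> s \<in># M" by (simp add: M poly_prod_linear_eq_0_iff)
  \<comment> \<open>All roots in \<open>M'\<close> have positive value, so value \<open>0\<close>
    identifies the root as \<open>\<eta>\<close>.\<close>
  moreover have "w (\<iota> s) = Fin 0"
    using val_eq_0_if_near_1[of s] s(2) by (simp add: zero_extended_def)
  ultimately have "\<iota> s = \<eta>" using small[of "\<iota> s"] by (auto simp: M')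
  then show ?thesis using j(1) unfolding \<eta>_def by metis
qed

text \<open>Factor \<open>lift p = G * H\<close> along \<open>A0\<close> and \<open>A1\<close>. As
  \<open>H\<close> is monic of degree \<open>n = size A1\<close>, the coefficient of index
  \<open>n\<close> contains \<open>G(0)\<close>, the stated product. In any other summand, going
  from index \<open>0\<close> to \<open>i\<close> in \<open>G\<close> lowers the bound by
  \<open>i \<alpha>\<close>, while going from \<open>n\<close> to \<open>n - i\<close> in
  \<open>H\<close> gains strictly more.\<close>

lemma lowest_slope_coeff:
  assumes A0: "\<And>a. a \<in># A0 \<Longrightarrow> w a = Fin \<alpha>" and A1: "\<And>a. a \<in># A1 \<Longrightarrow> Fin \<alpha> < w a"
    and p: "lift p = (\<Prod>a\<in>#A0 + A1. [:- a, 1:])"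
  shows "Fin (nsm (size A0) \<alpha>) < w (\<iota> (coeff p (size A1)) - (\<Prod>a\<in>#A0. - a))"
proof -
  define G where "G = (\<Prod>a\<in>#A0. [:- a, 1:])"
  define H where "H = (\<Prod>a\<in>#A1. [:- a, 1:])"
  define n where "n = size A1"
  have G0: "coeff G 0 = (\<Prod>a\<in>#A0. - a)"
    using poly_prod_linear[of A0 0] by (simp add: G_def poly_0_coeff_0)
  have Hn: "coeff H n = 1"
    using lead_coeff_prod_linear[of A1] unfolding degree_prod_linear H_def n_def .
  have Gge: "Fin (nsm (size A0) \<alpha> - nsm i \<alpha>) \<le> w (coeff G i)" for i
    using w.gauss_ge_prod_linear[of A0 \<alpha> "\<lambda>a. - a"] A0 by (simp add: w.gauss_ge_def G_def)
  have Hgt: "Fin (nsm i \<alpha>) < w (coeff H (n - i))" if i: "1 \<le> i" "i \<le> n" for i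
  \<comment> \<open>Without an element of finite value there is no slope \<open>\<alpha>'\<close> to
    use; then \<open>H = y^n\<close>, whose lower coefficients vanish.\<close>
  proof (cases "\<forall>a\<in>#A1. w a = Pinf")
    case True
    then have "A1 = replicate_mset n 0"
      by (simp add: w_eq_Pinf n_def multiset_eqI set_mset_subset_singletonD subset_iff)
    then have "H = monom 1 n" by (simp add: H_def monom_altdef)
    moreover have "n - i \<noteq> n" using i by linarith
    ultimately show ?thesis by simp
  next
    case False
    then have ne: "w ` set_mset A1 \<noteq> {}" by auto
    have fin: "finite (w ` set_mset A1)" by simp
    obtain a0 where a0: "a0 \<in># A1" "w a0 \<noteq> Pinf" using False by auto
    obtain a1 where a1: "a1 \<in># A1" "Min (w ` set_mset A1) = w a1" using Min_in[OF fin ne] by auto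
    have le: "w a1 \<le> w a" if "a \<in># A1" for a
      using that fin unfolding a1(2)[symmetric] by (intro Min_le) auto
    obtain \<alpha>' where \<alpha>': "w a1 = Fin \<alpha>'" using le[OF a0(1)] a0(2)
      by (cases a1 rule: w.val_cases) auto
    have "\<alpha> < \<alpha>'" using A1[OF a1(1)] \<alpha>' by simp
    then have "Fin (nsm i \<alpha>) < Fin (nsm i \<alpha>')" using i by (simp add: nsm_strict_mono)
    also have "nsm n \<alpha>' = nsm i \<alpha>' + nsm (n - i) \<alpha>'"
      using i by (metis le_add_diff_inverse nsm_add_left)
    then have "Fin (nsm i \<alpha>') = Fin (nsm n \<alpha>' - nsm (n - i) \<alpha>')" by simp
    also have "\<dots> \<le> w (coeff H (n - i))"
      using w.gauss_ge_prod_linear[of A1 \<alpha>' "\<lambda>a. - a"] le \<alpha>'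
      by (simp add: w.gauss_ge_def H_def n_def)
    finally show ?thesis .
  qed
  have "\<iota> (coeff p n) = (\<Sum>i\<le>n. coeff G i * coeff H (n - i))"
    unfolding coeff_lift[symmetric] p by (simp add: G_def H_def coeff_mult)
  also have "\<dots> = coeff G 0 * coeff H n + (\<Sum>i\<in>{..n} - {0}. coeff G i * coeff H (n - i))"
    by (subst sum.remove[of _ 0]) auto
  finally have "\<iota> (coeff p n) - coeff G 0 = (\<Sum>i\<in>{..n} - {0}. coeff G i * coeff H (n - i))"
    by (simp add: Hn)
  moreover have "Fin (nsm (size A0) \<alpha>) < w (\<Sum>i\<in>{..n} - {0}. coeff G i * coeff H (n - i))"
  proof (rule w.val_sum_gt)
    fix i assume "i \<in> {..n} - {0}"
    then have "Fin (nsm (size A0) \<alpha> - nsm i \<alpha> + nsm i \<alpha>) < w (coeff G i * coeff H (n - i))"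
      by (intro w.val_mult_gt' Gge Hgt) auto
    then show "Fin (nsm (size A0) \<alpha>) < w (coeff G i * coeff H (n - i))" by simp
  qed
  ultimately show ?thesis by (simp add: G0 n_def)
qed

text \<open>The product of the conjugates of least value, normalised by a coefficient of the minimal
  polynomial, is close to \<open>1\<close>, whereas any other conjugate of it has positive value.\<close>

lemma conj_val_eq:
  assumes p: "is_minpoly p x" and y: "poly (lift p) y = 0"
  shows "w x = w y"
proof -
  obtain A where A: "lift p = (\<Prod>a\<in>#A. [:- a, 1:])"
    using alg_closed_monic_factorization[of "lift p"] is_minpolyD(1)[OF p] by auto
  have root: "a \<in># A \<longleftrightarrow> poly (lift p) a = 0" for a
    by (simp add: A poly_prod_linear_eq_0_iff)
  have mp: "is_minpoly p a" if "a \<in># A" for a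
    using minpoly_conj[OF p] that root by blast
  have xy: "x \<in># A" "y \<in># A" using is_minpolyD(2)[OF p] y root by auto
  have fin: "finite (w ` set_mset A)" by simp
  have "w ` set_mset A \<noteq> {}" using xy by blast
  then have "Min (w ` set_mset A) \<in> w ` set_mset A" by (rule Min_in[OF fin])
  then obtain r0 where r0: "r0 \<in># A" "Min (w ` set_mset A) = w r0" by (rule imageE) simp
  have le: "w r0 \<le> w a" if "a \<in># A" for a
    using that fin unfolding r0(2)[symmetric] by (intro Min_le) auto
  have "w a = w r0" if aA: "a \<in># A" for a
  proof (rule ccontr)
    assume neq: "w a \<noteq> w r0"
    then obtain \<alpha> where \<alpha>: "w r0 = Fin \<alpha>" using le[OF aA] by (cases r0 rule: w.val_cases) auto
    define A0 where "A0 = {#a \<in># A. w a = Fin \<alpha>#}"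
    define A1 where "A1 = {#a \<in># A. w a \<noteq> Fin \<alpha>#}"
    have AA: "A = A0 + A1" unfolding A0_def A1_def by (rule multiset_partition)
    have A0: "w a = Fin \<alpha>" if "a \<in># A0" for a using that by (simp add: A0_def)
    have A1: "Fin \<alpha> < w a" if "a \<in># A1" for a using that le[of a] \<alpha> by (auto simp: A1_def)
    have mem: "r0 \<in># A0" "a \<in># A1" using r0 \<alpha> neq aA by (auto simp: A0_def A1_def)
    define b where "b = nsm (size A0) \<alpha>"
    define \<beta> where "\<beta> = (\<Prod>a\<in>#A0. - a)"
    have val\<beta>: "w \<beta> = Fin b" unfolding \<beta>_def b_def by (rule w.val_prod_mset_eq) (simp add: A0)
    define c where "c = coeff p (size A1)"
    have diff: "Fin b < w (\<iota> c - \<beta>)"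
      unfolding b_def c_def \<beta>_def by (rule lowest_slope_coeff[OF A0 A1 A[unfolded AA]])
    then have valc: "w (\<iota> c) = Fin b" using w.val_add_eq[of \<beta> "\<iota> c - \<beta>"] val\<beta> by simp
    then have c0: "\<iota> c \<noteq> 0" using w_eq_Pinf by force
    define \<xi> where "\<xi> = \<beta> / \<iota> c"
    have pos: "Fin 0 < w z \<longleftrightarrow> Fin b < w (z * \<iota> c)" for z
      using valc by (cases z rule: w.val_cases) (auto simp: w.val_mult)
    have eq: "(\<xi> - 1) * \<iota> c = \<beta> - \<iota> c" using c0 by (simp add: \<xi>_def field_simps)
    have near: "Fin 0 < w (\<xi> - 1)"
      using diff unfolding pos eq w.val_diff_commute[of \<beta> "\<iota> c"] .
    have \<tau>\<beta>: "\<tau> \<beta> = (\<Prod>a\<in>#A0. - \<tau> a)" "\<tau> \<xi> * \<iota> c = \<tau> \<beta>" "image_mset \<tau> A = A"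
      if \<tau>: "conj_map \<tau>" for \<tau>
    proof -
      interpret \<tau>: ring_hom_map \<tau> using \<tau> by (simp add: conj_map_def)
      show "\<tau> \<beta> = (\<Prod>a\<in>#A0. - \<tau> a)"
        by (simp add: \<beta>_def \<tau>.hom_prod_mset image_mset.compositionality comp_def \<tau>.hom_uminus)
      have "\<xi> * \<iota> c = \<beta>" using c0 by (simp add: \<xi>_def)
      then have "\<tau> \<xi> * \<tau> (\<iota> c) = \<tau> \<beta>" by (metis \<tau>.hom_mult)
      then show "\<tau> \<xi> * \<iota> c = \<tau> \<beta>" using \<tau> by (simp add: conj_map_def)
      show "image_mset \<tau> A = A" by (rule conj_map_roots[OF \<tau> A])
    qed
    have gt: "Fin 0 < w (\<tau> \<xi>)" if \<tau>: "conj_map \<tau>" and a': "a' \<in># A0" "w (\<tau> a') \<noteq> Fin \<alpha>" for \<tau> a'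
    proof -
      have inA: "\<tau> a'' \<in># A" if "a'' \<in># A0" for a''
      proof -
        have "\<tau> a'' \<in># image_mset \<tau> A" using that by (auto simp: AA)
        then show ?thesis using \<tau>\<beta>(3)[OF \<tau>] by simp
      qed
      have "Fin b < w (\<Prod>a\<in>#A0. - \<tau> a)"
        unfolding b_def
      proof (rule w.val_prod_mset_gt)
        show "Fin \<alpha> \<le> w (- \<tau> a'')" if "a'' \<in># A0" for a''
          using le[OF inA[OF that]] \<alpha> by simp
        show "Fin \<alpha> < w (- \<tau> a')" using le[OF inA[OF a'(1)]] \<alpha> a'(2) by (simp add: less_le)
      qed (rule a')
      then show ?thesis using \<tau>\<beta>[OF \<tau>] by (simp add: pos)
    qed
    \<comment> \<open>\<open>\<tau>\<close> permutes the roots. Either it maps \<open>A0\<close>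
      into itself, hence onto itself by counting, and fixes the product; or some factor gains value
      while none loses any, \<open>\<alpha>\<close> being the least value.\<close>
    have "\<tau> \<xi> = \<xi> \<or> Fin 0 < w (\<tau> \<xi>)" if \<tau>: "conj_map \<tau>" for \<tau>
    proof (cases "\<forall>a\<in>#A0. w (\<tau> a) = Fin \<alpha>")
      case True
      have "image_mset \<tau> A0 = {#a \<in># image_mset \<tau> A0. w a = Fin \<alpha>#}"
        using True by (intro filter_mset_eq_conv[THEN iffD2, symmetric] conjI) auto
      also have "\<dots> \<subseteq># {#a \<in># image_mset \<tau> A. w a = Fin \<alpha>#}"
        by (intro multiset_filter_mono image_mset_subseteq_mono) (simp add: AA)
      also have "\<dots> = A0" by (simp add: \<tau>\<beta>(3)[OF \<tau>] A0_def)
      finally have "image_mset \<tau> A0 = A0"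
        by (metis mset_subset_size size_image_mset less_irrefl subset_mset.le_less)
      moreover have "\<tau> \<beta> = (\<Prod>a\<in>#image_mset \<tau> A0. - a)"
        unfolding \<tau>\<beta>(1)[OF \<tau>] by (simp add: image_mset.compositionality comp_def)
      ultimately have "\<tau> \<beta> = \<beta>" by (simp only: \<beta>_def)
      then show ?thesis using \<tau>\<beta>(2)[OF \<tau>] c0 by (simp add: \<xi>_def eq_divide_eq)
    next
      case False
      then show ?thesis using gt[OF \<tau>] by blast
    qed
    then obtain j s where js: "j \<ge> 1" "\<xi> ^ j = \<iota> s"
      using isolated_unit_power_rational[OF near] by blast
    \<comment> \<open>A conjugation moving a root of least value out of \<open>A0\<close> gives
      \<open>\<tau> \<xi>\<close> positive value, yet it fixes the rational power
      \<open>\<xi>^j\<close>, whose value is \<open>0\<close>.\<close>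
    obtain \<tau> where \<tau>: "conj_map \<tau>" "\<tau> r0 = a"
      using conj_map_exists[OF mp[OF r0(1)]] aA root by blast
    interpret \<tau>: ring_hom_map \<tau> using \<tau>(1) by (simp add: conj_map_def)
    have "Fin 0 < w (\<tau> \<xi>)" using gt[OF \<tau>(1) mem(1)] \<tau>(2) neq \<alpha> by simp
    then have "Fin 0 < w (\<tau> (\<xi> ^ j))" using w.val_power_gt[of 0 "\<tau> \<xi>" j] js(1) by (simp add: \<tau>.hom_power)
    also have "\<tau> (\<xi> ^ j) = \<xi> ^ j" using \<tau>(1) by (simp add: js(2) conj_map_def)
    also have "w (\<xi> ^ j) = Fin 0"
      using w.val_power_Fin[OF w.val_eq_0_if_near_1[OF near], of j] by simp
    finally show False by simp
  qed
  then show ?thesis using xy by metis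
qed

text \<open>Let \<open>\<mu>\<close> be the minimal polynomial of
  \<open>\<beta> = g(\<zeta>)\<close>. All its roots have the value \<open>t\<close> of
  \<open>\<beta>\<close>, so its Newton polygon is a single segment. As \<open>\<mu>(g)\<close>
  vanishes at \<open>\<zeta>\<close>, its \<open>u\<close>-value is infinite; if \<open>u g\<close>
  were not \<open>t\<close>, one of the two extreme terms of \<open>\<mu>(g)\<close> would dominate
  strictly.\<close>

lemma val_at_root:
  assumes u: "ring_valuation u" and const: "\<And>c. u [:c:] = v c" and P: "u P = Pinf"
    and fin: "\<And>g. g \<noteq> 0 \<Longrightarrow> degree g < degree P \<Longrightarrow> u g \<noteq> Pinf" and "P \<noteq> 0"
    and \<zeta>: "poly (lift P) \<zeta> = 0"
  shows "w (poly (lift g) \<zeta>) = u g"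
proof -
  interpret u: ring_valuation u by fact
  obtain p where p: "is_minpoly p \<zeta>" using minpoly_exists by blast
  \<comment> \<open>The aim is that every polynomial vanishing at \<open>\<zeta>\<close> has
    infinite \<open>u\<close>-value. \<open>P\<close> has, and the cofactor \<open>s\<close> has
    finite value because its degree is smaller, so \<open>p\<close> has.\<close>
  have "p dvd P" using is_minpolyD(3)[OF p] \<zeta> by blast
  then obtain s where s: "P = p * s" ..
  have ne: "p \<noteq> 0" "s \<noteq> 0" using \<open>P \<noteq> 0\<close> s by auto
  have "u s \<noteq> Pinf" using fin[OF ne(2)] minpoly_degree[OF p] ne by (simp add: s degree_mult_eq)
  then have up: "u p = Pinf" using P unfolding s u.val_mult
    by (cases p rule: u.val_cases; cases s rule: u.val_cases) auto
  have zero: "u h = Pinf" if "poly (lift h) \<zeta> = 0" for h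
  proof -
    have "p dvd h" using is_minpolyD(3)[OF p] that by blast
    then obtain k where "h = p * k" ..
    then show ?thesis using up by (cases k rule: u.val_cases) (auto simp: u.val_mult)
  qed
  define \<beta> where "\<beta> = poly (lift g) \<zeta>"
  show ?thesis
  proof (cases "\<beta> = 0")
    case True
    then show ?thesis using zero[of g] by (simp add: \<beta>_def)
  next
    case False
    then obtain t where t: "w \<beta> = Fin t" using w_eq_Pinf by (cases \<beta> rule: w.val_cases) auto
    obtain \<mu> where \<mu>: "is_minpoly \<mu> \<beta>" using minpoly_exists by blast
    define k where "k = degree \<mu>"
    have k1: "k \<ge> 1" using minpoly_degree[OF \<mu>] by (simp add: k_def)
    have "lead_coeff (lift \<mu>) = 1" using is_minpolyD(1)[OF \<mu>] by simp
    then obtain A where A: "lift \<mu> = (\<Prod>a\<in>#A. [:- a, 1:])" "size A = degree (lift \<mu>)"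
      by (rule alg_closed_monic_factorization)
    have sizeA: "size A = k" using A(2) by (simp only: degree_lift k_def)
    have wA: "w a = Fin t" if "a \<in># A" for a
      using conj_val_eq[OF \<mu>, of a] that t by (simp add: A poly_prod_linear_eq_0_iff)
    have ge: "Fin (nsm k t - nsm i t) \<le> v (coeff \<mu> i)" for i
      using w.gauss_ge_prod_linear[of A t "\<lambda>a. - a"] wA
      by (simp add: w.gauss_ge_def sizeA flip: A(1) w_emb)
    have c0: "v (coeff \<mu> 0) = Fin (nsm k t)"
    proof -
      have "\<iota> (coeff \<mu> 0) = (\<Prod>a\<in>#A. - a)"
        using poly_prod_linear[of A 0] by (simp add: poly_0_coeff_0 flip: A(1))
      moreover have "w (\<Prod>a\<in>#A. - a) = Fin (nsm k t)"
        unfolding sizeA[symmetric] by (rule w.val_prod_mset_eq) (simp add: wA)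
      ultimately show ?thesis by (metis w_emb)
    qed
    have ck: "coeff \<mu> k = 1" using is_minpolyD(1)[OF \<mu>] by (simp add: k_def)
    define T where "T i = [:coeff \<mu> i:] * g ^ i" for i
    have "(\<Sum>i\<le>k. T i) = pcompose \<mu> g"
    proof -
      have "degree (map_poly (\<lambda>c. [:c:]) \<mu>) = k" unfolding k_def by (rule degree_map_poly) simp
      then show ?thesis
        unfolding pcompose_altdef poly_altdef[of _ g] T_def by (simp add: coeff_map_poly)
    qed
    moreover have "poly (lift (pcompose q g)) \<zeta> = poly (lift q) \<beta>" for q
      unfolding \<beta>_def
      by (induction q) (simp_all add: pcompose_pCons map_poly_hom_add map_poly_hom_mult map_poly_pCons)
    ultimately have sum: "u (\<Sum>i\<le>k. T i) = Pinf"
      using zero is_minpolyD(2)[OF \<mu>] by simp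
    consider "u g = Fin t" | "Fin t < u g" | "u g < Fin t" by force
    then show ?thesis
    proof cases
      case 1
      then show ?thesis using t by (simp add: \<beta>_def)
    next
      case 2
      \<comment> \<open>Powers of \<open>g\<close> are too large here, so the constant term of
        \<open>\<mu>(g)\<close> dominates.\<close>
      have rest: "Fin (nsm k t) < u (\<Sum>i\<in>{..k} - {0}. T i)"
      proof (rule u.val_sum_gt)
        fix i assume "i \<in> {..k} - {0}"
        then have "Fin (nsm k t - nsm i t + nsm i t) < u (T i)"
          unfolding T_def using ge[of i] by (intro u.val_mult_gt' u.val_power_gt 2) (auto simp: const)
        then show "Fin (nsm k t) < u (T i)" by simp
      qed
      have T0: "u (T 0) = Fin (nsm k t)" using c0 by (simp add: T_def const)
      have split: "(\<Sum>i\<le>k. T i) = T 0 + (\<Sum>i\<in>{..k} - {0}. T i)" by (rule sum.remove) auto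
      have "u (\<Sum>i\<le>k. T i) = Fin (nsm k t)"
        unfolding split using u.val_add_eq[OF rest[folded T0]] T0 by (rule trans)
      then show ?thesis unfolding sum by (rule extended.distinct(1)[THEN notE, OF sym])
    next
      case 3
      then obtain \<omega> where \<omega>: "u g = Fin \<omega>" "\<omega> < t" by (cases g rule: u.val_cases) auto
      have uk: "u (T k) = Fin (nsm k \<omega>)"
        using u.val_power_Fin[OF \<omega>(1)] by (simp add: T_def ck flip: one_pCons)
      \<comment> \<open>Here \<open>g\<close> has too small a value, so the leading term
        \<open>g^k\<close> dominates.\<close>
      have rest: "Fin (nsm k \<omega>) < u (\<Sum>i\<in>{..k} - {k}. T i)"
      proof (rule u.val_sum_gt)
        fix i assume i: "i \<in> {..k} - {k}"
        then have "nsm k z = nsm i z + nsm (k - i) z" for z :: 'g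
          by (metis DiffD1 atMost_iff le_add_diff_inverse nsm_add_left)
        note nsm_split = this
        have "nsm (k - i) \<omega> < nsm (k - i) t" using \<omega>(2) i by (intro nsm_strict_mono) auto
        then have "Fin (nsm k \<omega>) < Fin (nsm k t - nsm i t + nsm i \<omega>)"
          by (simp add: nsm_split)
        also have "\<dots> \<le> u (T i)"
          unfolding T_def using ge[of i] by (intro u.val_mult_ge u.val_power_ge) (auto simp: const \<omega>)
        finally show "Fin (nsm k \<omega>) < u (T i)" .
      qed
      have split: "(\<Sum>i\<le>k. T i) = T k + (\<Sum>i\<in>{..k} - {k}. T i)" by (rule sum.remove) auto
      have "u (\<Sum>i\<le>k. T i) = Fin (nsm k \<omega>)"
        unfolding split using u.val_add_eq[OF rest[folded uk]] uk by (rule trans)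
      then show ?thesis unfolding sum by (rule extended.distinct(1)[THEN notE, OF sym])
    qed
  qed
qed

end

subsection \<open>Counting close pairs of roots\<close>

lemma degree_hasse_le: "degree (hasse s f) \<le> degree f"
  by (rule degree_le) (simp add: coeff_hasse_eq_0)

text \<open>Both sides count related pairs, with multiplicity.\<close>

lemma sum_size_filter_commute:
  "(\<Sum>x\<in>#A. size {#y \<in># B. R x y#}) = (\<Sum>y\<in>#B. size {#x \<in># A. R x y#})"
proof (induction A)
  case (add a A)
  have "size {#y \<in># B. R a y#} = (\<Sum>y\<in>#B. if R a y then 1 else 0)"
    by (induction B) auto
  moreover have "(\<Sum>y\<in>#B. size {#x \<in># add_mset a A. R x y#}) =
      (\<Sum>y\<in>#B. (if R a y then 1 else 0) + size {#x \<in># A. R x y#})"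
    by (rule arg_cong[of _ _ sum_mset], rule image_mset_cong) auto
  ultimately show ?case using add by (simp add: sum_mset.distrib)
qed simp

locale henselian_limit_key_poly = nu: limit_key_poly \<nu> \<Q> m f + henselian_ext \<iota> v w
  for \<nu> :: "'k::field poly \<Rightarrow> 'g::linordered_ab_group_add extended"
    and \<Q> m f and \<iota> :: "'k \<Rightarrow> 'e::alg_closed_field" and v :: "'k \<Rightarrow> 'g extended" and w :: "'e \<Rightarrow> 'g extended" +
  assumes nu_const: "\<nu> [:c:] = v c"
begin

text \<open>The Taylor expansion at a point of the closure: \<open>taylor g\<close> with its
  coefficients evaluated at \<open>x\<close>.\<close>

definition shift :: "'e \<Rightarrow> 'k poly \<Rightarrow> 'e poly" where
  "shift x g = pcompose (lift g) [:x, 1:]"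

lemma ring_hom_shift: "ring_hom_map (shift x)"
  unfolding shift_def by (intro ring_hom_map_comp[OF ring_hom_map_pcompose ring_hom_lift])

lemma coeff_shift: "coeff (shift x g) s = poly (lift (hasse s g)) x"
proof (induction g arbitrary: s)
  case (pCons a g)
  have "shift x (pCons a g) = [:\<iota> a:] + [:x, 1:] * shift x g"
    by (simp add: shift_def map_poly_pCons pcompose_pCons)
  then show ?case using pCons
    by (cases s) (auto simp: hasse_pCons map_poly_hom_add map_poly_hom_mult map_poly_pCons)
qed (simp add: shift_def)

text \<open>\<open>g(x + y)\<close> is the product of the factors \<open>y + (x - a)\<close>, each
  contributing \<open>1\<close> to the initial degree exactly when \<open>x - a\<close> has value at
  least \<open>\<delta>\<close>.\<close>

lemma gauss_top_shift_roots:
  assumes "lift g = (\<Prod>a\<in>#A. [:- a, 1:])" "w.gauss_top \<delta> (shift x g) \<gamma> n"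
  shows "n = size {#a \<in># A. Fin \<delta> \<le> w (x - a)#}"
proof -
  interpret P: ring_hom_map "\<lambda>p. pcompose p [:x, 1:]" by (rule ring_hom_map_pcompose)
  have "shift x g = (\<Prod>a\<in>#A. [:x - a, 1:])"
    unfolding shift_def assms(1) P.hom_prod_mset
    by (simp add: image_mset.compositionality comp_def pcompose_pCons)
  then show ?thesis
    using w.gauss_top_prod_linear[of \<delta> "\<lambda>a. x - a" A] w.gauss_top_unique(2)[OF assms(2)] by auto
qed

text \<open>Hasse derivatives of order at least \<open>1\<close> have degree below
  \<open>deg Q\<close>, so at \<open>x\<close> they keep their \<open>\<nu>\<close>-values. The
  constant coefficient may change its value, but as \<open>r \<ge> 1\<close> a lower bound for it is
  enough. This form serves roots of \<open>Q\<close> and of \<open>f\<close> alike.\<close>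

lemma gauss_top_shift_Q:
  assumes key: "nu.gauss_key Q \<gamma> r \<delta>" and 0: "Fin \<gamma> \<le> w (poly (lift Q) x)"
    and eq: "\<And>g. degree g < degree Q \<Longrightarrow> w (poly (lift g) x) = \<nu> g"
  shows "w.gauss_top \<delta> (shift x Q) \<gamma> r"
proof -
  note D = nu.gauss_keyD[OF key]
  have eq': "w (coeff (shift x Q) s) = \<nu> (coeff (taylor Q) s)" if "s \<ge> 1" for s
    unfolding coeff_shift hasse_taylor[symmetric]
    by (rule eq) (rule degree_hasse_less[OF that D(1)])
  show ?thesis
    unfolding w.gauss_top_def w.gauss_ge_def
  proof (intro conjI allI impI)
    show "Fin (\<gamma> - nsm s \<delta>) \<le> w (coeff (shift x Q) s)" for s
    proof (cases "s \<ge> 1")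
      case True
      then show ?thesis using nu.gauss_topD(1)[OF D(4)] by (simp add: eq' nu.gauss_ge_def)
    next
      case False
      then have "s = 0" by simp
      then show ?thesis using 0 by (simp add: coeff_shift)
    qed
    show "w (coeff (shift x Q) r) = Fin (\<gamma> - nsm r \<delta>)"
      using nu.gauss_topD(2)[OF D(4)] eq'[OF D(3)] by simp
    show "Fin (\<gamma> - nsm s \<delta>) < w (coeff (shift x Q) s)" if "s > r" for s
      using nu.gauss_topD(3)[OF D(4) that] eq'[of s] D(3) that by simp
  qed
qed

theorem degree_limit_key_poly:
  assumes Q: "Q \<in> \<Q>"
  shows "degree f = degQ \<nu> Q f * degree Q"
proof -
  obtain \<gamma> r \<delta> where key: "nu.gauss_key Q \<gamma> r \<delta>" using nu.\<Q>_gauss_key[OF Q] .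
  note D = nu.gauss_keyD[OF key]
  have monicQ: "lead_coeff Q = 1" using nu.\<Q>_key[OF Q] by (simp add: key_poly_def)
  have degf: "degree f \<ge> degree Q" "degree f \<ge> 1"
    using nu.degree_f nu.\<Q>_deg[OF Q] nu.m_pos by auto
  have Q0: "Q \<noteq> 0" using D(1) by auto
  have nu: "ring_valuation \<nu>" by (rule nu.ring_valuation_axioms)
  have at_Q: "w (poly (lift g) x) = \<nu> (g mod Q)" if "poly (lift Q) x = 0" for g x
  proof (rule val_at_root[OF _ _ _ _ Q0 that])
    show "ring_valuation (\<lambda>h. \<nu> (h mod Q))"
      by (rule ring_valuation_mod[OF nu D(1)]) (rule nu.key_poly_val_mod[OF nu.\<Q>_key[OF Q] D(1,2)])
    show "\<nu> ([:c:] mod Q) = v c" for c using D(1) by (simp add: mod_poly_less nu_const)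
    show "\<nu> (g mod Q) \<noteq> Pinf" if "g \<noteq> 0" "degree g < degree Q" for g
      using D(5)[OF that] that by (auto simp: mod_poly_less)
  qed simp
  have at_f: "w (poly (lift g) x) = \<nu> (g mod f)" if "poly (lift f) x = 0" for g x
  proof (rule val_at_root[OF _ _ _ _ nu.f_nonzero that])
    show "ring_valuation (\<lambda>h. \<nu> (h mod f))"
      by (rule ring_valuation_mod[OF nu degf(2)]) (rule nu.limit_val_mod)
    show "\<nu> ([:c:] mod f) = v c" for c using degf by (simp add: mod_poly_less nu_const)
    show "\<nu> (g mod f) \<noteq> Pinf" if "g \<noteq> 0" "degree g < degree f" for g
      using nu.val_finite[OF that] that by (auto simp: mod_poly_less)
  qed simp
  obtain E where E: "lift Q = (\<Prod>a\<in>#E. [:- a, 1:])" "size E = degree (lift Q)"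
    by (rule alg_closed_monic_factorization[of "lift Q"]) (use monicQ in simp)
  obtain F where F: "lift f = (\<Prod>a\<in>#F. [:- a, 1:])" "size F = degree (lift f)"
    by (rule alg_closed_monic_factorization[of "lift f"]) (use nu.f_monic in simp)
  have 1: "size {#\<theta> \<in># F. Fin \<delta> \<le> w (\<eta> - \<theta>)#} = r * degQ \<nu> Q f" if "\<eta> \<in># E" for \<eta>
  proof -
    have root: "poly (lift Q) \<eta> = 0" using that by (simp add: E(1) poly_prod_linear_eq_0_iff)
    have val: "w (poly (lift g) \<eta>) = \<nu> g" if "degree g < degree Q" for g
      using at_Q[OF root] that by (simp add: mod_poly_less)
    have "\<exists>a. \<nu> g = Fin a \<and> w.gauss_top \<delta> (shift \<eta> g) a 0" if g: "g \<noteq> 0" "degree g < degree Q" for g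
    proof -
      have "w (coeff (shift \<eta> g) s) = \<nu> (coeff (taylor g) s)" for s
        unfolding coeff_shift hasse_taylor[symmetric]
        by (rule val) (rule le_less_trans[OF degree_hasse_le g(2)])
      then show ?thesis using D(5)[OF g]
        by (simp add: nu.gauss_top_def nu.gauss_ge_def w.gauss_top_def w.gauss_ge_def)
    qed
    \<comment> \<open>At a root of \<open>Q\<close> the constant coefficient is \<open>0\<close>, so
      its lower bound is trivial.\<close>
    moreover have "w.gauss_top \<delta> (shift \<eta> Q) \<gamma> r"
      by (rule gauss_top_shift_Q[OF key]) (simp_all add: root val)
    ultimately obtain \<kappa> where "w.gauss_top \<delta> (shift \<eta> f) \<kappa> (r * degQ \<nu> Q f)"
      using w.gauss_top_Q_expansion[OF ring_hom_shift nu D(1) _ D(2) _ D(3) nu.f_nonzero] by blast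
    then show ?thesis by (rule gauss_top_shift_roots[OF F(1), symmetric])
  qed
  have 2: "size {#\<eta> \<in># E. Fin \<delta> \<le> w (\<eta> - \<theta>)#} = r" if "\<theta> \<in># F" for \<theta>
  proof -
    have root: "poly (lift f) \<theta> = 0" using that by (simp add: F(1) poly_prod_linear_eq_0_iff)
    have "w.gauss_top \<delta> (shift \<theta> Q) \<gamma> r"
    proof (rule gauss_top_shift_Q[OF key])
      show "Fin \<gamma> \<le> w (poly (lift Q) \<theta>)"
        using nu.val_mod_f_ge[OF Q] by (simp add: at_f[OF root] D(2))
      show "w (poly (lift g) \<theta>) = \<nu> g" if "degree g < degree Q" for g
        using that degf by (simp add: at_f[OF root] mod_poly_less)
    qed
    then have "size {#\<eta> \<in># E. Fin \<delta> \<le> w (\<theta> - \<eta>)#} = r"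
      by (rule gauss_top_shift_roots[OF E(1), symmetric])
    then show ?thesis by (simp add: w.val_diff_commute)
  qed
  have "(\<Sum>\<eta>\<in>#E. size {#\<theta> \<in># F. Fin \<delta> \<le> w (\<eta> - \<theta>)#}) = (\<Sum>\<eta>\<in>#E. r * degQ \<nu> Q f)"
    by (rule arg_cong[of _ _ sum_mset], rule image_mset_cong) (rule 1)
  moreover have "(\<Sum>\<theta>\<in>#F. size {#\<eta> \<in># E. Fin \<delta> \<le> w (\<eta> - \<theta>)#}) = (\<Sum>\<theta>\<in>#F. r)"
    by (rule arg_cong[of _ _ sum_mset], rule image_mset_cong) (rule 2)
  ultimately have "size E * (r * degQ \<nu> Q f) = size F * r"
    by (auto simp: sum_size_filter_commute[of _ _ E])
  then have "degree Q * (r * degQ \<nu> Q f) = degree f * r" by (simp only: E(2) F(2) degree_lift)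
  then show ?thesis using D(3) by (simp add: mult_ac)
qed

end

theorem mainTheorem5:
  fixes v :: "'k::field \<Rightarrow> 'g::linordered_ab_group_add extended"
    and \<nu> :: "'k poly \<Rightarrow> 'g extended"
    and m :: nat
    and \<Q> :: "'k poly set"
  assumes divisible: "divisible_group TYPE('g)"
    and v_val: "valuation_on_field v"
    and nu_val: "valuation_on_polys \<nu>"
    and nu_ext: "extends_val \<nu> v"
    and well_spec: "well_specified \<nu> v"
    and m_pos: "m \<ge> 1"
    and Psi_ne: "Psi \<nu> m \<noteq> {}"
    and Psi_nomax: "\<not> (\<exists>Q\<in>Psi \<nu> m. \<forall>P\<in>Psi \<nu> m. \<nu> P \<le> \<nu> Q)"
    and Q_sub: "\<Q> \<subseteq> Psi \<nu> m"
    and Q_inj: "inj_on \<nu> \<Q>"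
    and Q_wo: "\<forall>S. S \<subseteq> \<Q> \<and> S \<noteq> {} \<longrightarrow> (\<exists>Q\<in>S. \<forall>R\<in>S. \<nu> Q \<le> \<nu> R)"
    and Q_cofinal: "\<forall>P\<in>Psi \<nu> m. \<exists>Q\<in>\<Q>. \<nu> P \<le> \<nu> Q"
    and unstable_ex: "\<exists>f. \<not> stable \<nu> \<Q> f"
    and hens: "henselian v"
  shows "\<forall>f\<in>limit_key_polys \<nu> \<Q>. \<forall>Q\<in>\<Q>. degree f = degQ \<nu> Q f * degree Q"
proof (intro ballI)
  fix f Q assume f: "f \<in> limit_key_polys \<nu> \<Q>" and Q: "Q \<in> \<Q>"
  have v1: "v 1 = Fin 0"
  proof -
    have "v 1 + v 1 = v 1" "v 1 \<noteq> Pinf" "v 1 \<noteq> Minf"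
      using v_val unfolding valuation_on_field_def by (metis mult_1, simp, simp)
    then show ?thesis by (cases "v 1") auto
  qed
  have v: "ring_valuation v"
    using v_val v1 unfolding valuation_on_field_def ring_valuation_def by auto
  have const: "\<nu> [:c:] = v c" for c
    using nu_ext by (simp add: extends_val_def)
  have nu: "ring_valuation \<nu>"
    using nu_val v1 const[of 1] unfolding valuation_on_polys_def ring_valuation_def
    by (auto simp: one_pCons)
  \<comment> \<open>An element of infinite value would be maximal in
    \<open>Psi \<nu> m\<close>.\<close>
  have "\<nu> R \<noteq> Pinf" if "R \<in> \<Q>" for R
  proof
    assume "\<nu> R = Pinf"
    then have "\<forall>P\<in>Psi \<nu> m. \<nu> P \<le> \<nu> R" by simp
    then show False using Psi_nomax Q_sub that by blast
  qed
  then have limit: "limit_key_poly \<nu> \<Q> m f"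
    using nu divisible m_pos Q_sub Q f v_val
    unfolding limit_key_poly_def limit_key_poly_axioms_def poly_valuation_def poly_valuation_axioms_def
    by (auto simp: Psi_def const valuation_on_field_def)
  have ext: "valued_alg_closed_ext to_ac v"
  proof (intro valued_alg_closed_ext.intro alg_closed_ext.intro alg_closed_ext_axioms.intro
      valued_alg_closed_ext_axioms.intro v divisible)
    show "ring_hom_map (to_ac :: 'k \<Rightarrow> _)" by unfold_locales auto
    show "\<exists>p. p \<noteq> 0 \<and> poly (map_poly to_ac p) x = 0" for x :: "'k alg_closure"
      by (rule alg_closure_algebraic[of x]) auto
    show "v a = Pinf \<longleftrightarrow> a = 0" for a using v_val by (simp add: valuation_on_field_def)
  qed
  then obtain w :: "'k alg_closure \<Rightarrow> 'g extended" where w: "ring_valuation w"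
      "\<And>c. w (to_ac c) = v c" "\<And>x. w x = Pinf \<longleftrightarrow> x = 0"
    using valued_alg_closed_ext.valuation_extension by blast
  interpret henselian_limit_key_poly \<nu> \<Q> m f to_ac v w
    by (intro henselian_limit_key_poly.intro limit henselian_ext.intro ext w henselian_ext_axioms.intro
        hens henselian_limit_key_poly_axioms.intro const)
  show "degree f = degQ \<nu> Q f * degree Q" by (rule degree_limit_key_poly[OF Q])
qed

end
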